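(* Let $G$ be a connected distance hereditary graph. The following are equivalent: (1) $G$ is a permutation graph; (2) $G$ is AT-free; (3) the pruned decomposition tree of $G$ is a path.
   Context: A graph $G$ is distance hereditary if for every connected induced subgraph $H$ of $G$, the distance between every two vertices of $H$ is the same in $H$ as in $G$. A permutation graph is an intersection graph of straight segments joining two parallel lines. An asteroidal triple is a set of three vertices such that each two of them are joined by a path avoiding the closed neighbourhood of the third; $G$ is AT-free if it has no asteroidal triple. A split of $G=(V,E)$ is a partition $\{V_1,V_2\}$ of $V$ with $|V_1|,|V_2|>1$ such that the edges between $V_1$ and $V_2$ are exactly $\{xy: x\in N(V_2), y\in N(V_1)\}$ (where $N(W)$ is the set of vertices outside $W$ adjacent to $W$); $G$ is prime if it has no split. A simple split decomposition replaces $G$ by $G[V_1]+v$ with $N(v)=N_G(V_2)$ and $G[V_2]+v$ with $N(v)=N_G(V_1)$, $v$ a new marker vertex. A split decomposition is obtained by repeating this on the pieces; it is a tree whose nodes are graphs, adjacent iff they share a marker. The standard split decomposition tree $T_G$ of a connected graph $G$ is its unique split decomposition whose nodes are all prime graphs, cliques or stars and which is not a strict refinement of another such decomposition. The pruned decomposition tree is obtained from $T_G$ by repeatedly removing a leaf node whose marker vertex is universal in that leaf's graph (the other copy of the marker becoming an ordinary vertex) until no such leaf remains. *)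

theory Defs
  imports
    "HOL-Analysis.Analysis"
    "Graph_Theory.Graph_Theory"
begin

section \<open>Basic graph notions\<close>

text \<open>
  Finite simple graphs are \<^typ>\<open>'a pair_pre_digraph\<close> values satisfying \<^const>\<open>pair_graph\<close>:
  finite, loop-free, with a symmetric set of arcs, each edge being represented by both of its arcs.
\<close>

definition neighbours :: "'a pair_pre_digraph \<Rightarrow> 'a set \<Rightarrow> 'a set" where
  "neighbours G W = {x \<in> pverts G - W. \<exists>w\<in>W. (w, x) \<in> parcs G}"

definition closed_neighbourhood :: "'a pair_pre_digraph \<Rightarrow> 'a \<Rightarrow> 'a set" where
  "closed_neighbourhood G v = insert v (neighbours G {v})"

definition universal_vertex :: "'a pair_pre_digraph \<Rightarrow> 'a \<Rightarrow> bool" where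
  "universal_vertex G v \<longleftrightarrow> v \<in> pverts G \<and> (\<forall>u \<in> pverts G - {v}. (v, u) \<in> parcs G)"

definition clique_graph :: "'a pair_pre_digraph \<Rightarrow> bool" where
  "clique_graph G \<longleftrightarrow> (\<forall>u\<in>pverts G. \<forall>v\<in>pverts G. u \<noteq> v \<longrightarrow> (u, v) \<in> parcs G)"

definition star_graph :: "'a pair_pre_digraph \<Rightarrow> bool" where
  "star_graph G \<longleftrightarrow> (\<exists>c\<in>pverts G.
     parcs G = {c} \<times> (pverts G - {c}) \<union> (pverts G - {c}) \<times> {c})"

definition path_graph :: "'a pair_pre_digraph \<Rightarrow> bool" where
  "path_graph G \<longleftrightarrow> (\<exists>p. vpath p (with_proj G) \<and> set p = pverts G \<and>
     parcs G = set (vwalk_arcs p) \<union> (set (vwalk_arcs p))\<inverse>)"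


section \<open>Distance hereditary, permutation and AT-free graphs\<close>

definition graph_distance :: "'a pair_pre_digraph \<Rightarrow> 'a \<Rightarrow> 'a \<Rightarrow> ereal" where
  "graph_distance G u v = wf_digraph.\<mu> (with_proj G) (\<lambda>_. 1) u v"

definition distance_hereditary :: "'a pair_pre_digraph \<Rightarrow> bool" where
  "distance_hereditary G \<longleftrightarrow> (\<forall>H.
     induced_subgraph (with_proj H) (with_proj G) \<and> Digraph_Component.connected (with_proj H) \<longrightarrow>
     (\<forall>u\<in>pverts H. \<forall>v\<in>pverts H. graph_distance H u v = graph_distance G u v))"

text \<open>Parallel lines are understood to be distinct, hence disjoint.\<close>

definition parallel_lines :: "(real ^ 2) set \<Rightarrow> (real ^ 2) set \<Rightarrow> bool" where
  "parallel_lines L M \<longleftrightarrow> (\<exists>p q d. d \<noteq> 0 \<and> L = range (\<lambda>s::real. p + s *\<^sub>R d) \<and>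
     M = range (\<lambda>s::real. q + s *\<^sub>R d) \<and> L \<inter> M = {})"

definition permutation_graph :: "'a pair_pre_digraph \<Rightarrow> bool" where
  "permutation_graph G \<longleftrightarrow> (\<exists>L M a b. parallel_lines L M \<and>
     (\<forall>v\<in>pverts G. a v \<in> L \<and> b v \<in> M) \<and>
     (\<forall>u\<in>pverts G. \<forall>v\<in>pverts G. u \<noteq> v \<longrightarrow>
        ((u, v) \<in> parcs G \<longleftrightarrow> closed_segment (a u) (b u) \<inter> closed_segment (a v) (b v) \<noteq> {})))"

definition joined_avoiding :: "'a pair_pre_digraph \<Rightarrow> 'a \<Rightarrow> 'a \<Rightarrow> 'a \<Rightarrow> bool" where
  "joined_avoiding G x y z \<longleftrightarrow> (\<exists>p. vpath p (with_proj G) \<and> hd p = x \<and> last p = y \<and>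
     set p \<inter> closed_neighbourhood G z = {})"

definition asteroidal_triple :: "'a pair_pre_digraph \<Rightarrow> 'a \<Rightarrow> 'a \<Rightarrow> 'a \<Rightarrow> bool" where
  "asteroidal_triple G x y z \<longleftrightarrow>
     {x, y, z} \<subseteq> pverts G \<and> distinct [x, y, z] \<and>
     joined_avoiding G x y z \<and> joined_avoiding G y z x \<and> joined_avoiding G x z y"

definition AT_free :: "'a pair_pre_digraph \<Rightarrow> bool" where
  "AT_free G \<longleftrightarrow> (\<nexists>x y z. asteroidal_triple G x y z)"


section \<open>Split decompositions\<close>

text \<open>
  As arcs are symmetric, it suffices to constrain those from \<open>V1\<close> to \<open>V2\<close>. Finiteness makes
  \<open>card\<close> meaningful.
\<close>

definition is_split :: "'a pair_pre_digraph \<Rightarrow> 'a set \<Rightarrow> 'a set \<Rightarrow> bool" where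
  "is_split G V1 V2 \<longleftrightarrow> V1 \<union> V2 = pverts G \<and> V1 \<inter> V2 = {} \<and> card V1 > 1 \<and> card V2 > 1 \<and>
     parcs G \<inter> V1 \<times> V2 = neighbours G V2 \<times> neighbours G V1"

definition prime_graph :: "'a pair_pre_digraph \<Rightarrow> bool" where
  "prime_graph G \<longleftrightarrow> (\<nexists>V1 V2. is_split G V1 V2)"

text \<open>The graph \<open>G[A] + v\<close>, where \<open>v\<close> gets the neighbours in \<open>A\<close> of the rest of \<open>G\<close>.\<close>

definition split_piece :: "'a pair_pre_digraph \<Rightarrow> 'a set \<Rightarrow> 'a \<Rightarrow> 'a pair_pre_digraph" where
  "split_piece G A v =
     (let N = neighbours G (pverts G - A)
      in \<lparr> pverts = insert v A, parcs = Restr (parcs G) A \<union> {v} \<times> N \<union> N \<times> {v} \<rparr>)"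

text \<open>
  Nodes of a decomposition of \<open>G\<close> live over \<^typ>\<open>'a + nat\<close>: \<open>Inl x\<close> is the vertex \<open>x\<close> of \<open>G\<close>
  and \<open>Inr n\<close> is a marker. Both copies of a marker have the same name, and names are never
  reused. A decomposition is the set of its nodes. Two distinct nodes are never equal as graphs:
  a node created by a split has at least three vertices, and shares at most one with any other.
\<close>

type_synonym 'a node = "('a + nat) pair_pre_digraph"

definition initial_node :: "'a pair_pre_digraph \<Rightarrow> 'a node" where
  "initial_node G = \<lparr> pverts = Inl ` pverts G, parcs = map_prod Inl Inl ` parcs G \<rparr>"

definition simple_split_step :: "'a node set \<Rightarrow> 'a node set \<Rightarrow> bool" where
  "simple_split_step D D' \<longleftrightarrow> (\<exists>H\<in>D. \<exists>V1 V2 n.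
     is_split H V1 V2 \<and> (\<forall>K\<in>D. Inr n \<notin> pverts K) \<and>
     D' = (D - {H}) \<union> {split_piece H V1 (Inr n), split_piece H V2 (Inr n)})"

definition split_decomposition :: "'a pair_pre_digraph \<Rightarrow> 'a node set \<Rightarrow> bool" where
  "split_decomposition G D \<longleftrightarrow> simple_split_step\<^sup>*\<^sup>* {initial_node G} D"

definition strict_refinement :: "'a node set \<Rightarrow> 'a node set \<Rightarrow> bool" where
  "strict_refinement D' D \<longleftrightarrow> simple_split_step\<^sup>+\<^sup>+ D D'"

definition good_decomposition :: "'a pair_pre_digraph \<Rightarrow> 'a node set \<Rightarrow> bool" where
  "good_decomposition G D \<longleftrightarrow> split_decomposition G D \<and>
     (\<forall>H\<in>D. prime_graph H \<or> clique_graph H \<or> star_graph H)"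

text \<open>
  For a connected graph, the standard decomposition is unique up to the names of the markers;
  \<open>standard_decomposition G\<close> holds of all its named versions.
\<close>

definition standard_decomposition :: "'a pair_pre_digraph \<Rightarrow> 'a node set \<Rightarrow> bool" where
  "standard_decomposition G D \<longleftrightarrow> good_decomposition G D \<and>
     (\<nexists>D0. good_decomposition G D0 \<and> strict_refinement D D0)"


section \<open>Decomposition trees and pruning\<close>

definition shared_marker :: "'a node \<Rightarrow> 'a node \<Rightarrow> 'a + nat \<Rightarrow> bool" where
  "shared_marker H K m \<longleftrightarrow> m \<in> range Inr \<and> m \<in> pverts H \<and> m \<in> pverts K"

definition decomposition_tree :: "'a node set \<Rightarrow> 'a node pair_pre_digraph" where
  "decomposition_tree D = \<lparr> pverts = D,
     parcs = {(H, K). H \<in> D \<and> K \<in> D \<and> H \<noteq> K \<and> (\<exists>m. shared_marker H K m)} \<rparr>"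

definition prunable_leaf :: "'a node set \<Rightarrow> 'a node \<Rightarrow> bool" where
  "prunable_leaf D L \<longleftrightarrow> L \<in> D \<and> (\<exists>K m. neighbours (decomposition_tree D) {L} = {K} \<and>
     shared_marker L K m \<and> universal_vertex L m)"

text \<open>
  After removing a leaf, the remaining copy of its marker is no longer shared by two nodes, so it
  plays no role in \<^const>\<open>decomposition_tree\<close> any more: it has become an ordinary vertex.
\<close>

definition prune_step :: "'a node set \<Rightarrow> 'a node set \<Rightarrow> bool" where
  "prune_step D D' \<longleftrightarrow> (\<exists>L. prunable_leaf D L \<and> D' = D - {L})"

text \<open>
  Pruning is confluent except that, when the last two nodes are both prunable, either of them may be
  the one that remains; \<open>pruned_decomposition_tree G\<close> holds of every possible outcome.
\<close>

definition pruned_decomposition_tree ::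
  "'a pair_pre_digraph \<Rightarrow> 'a node pair_pre_digraph \<Rightarrow> bool" where
  "pruned_decomposition_tree G T \<longleftrightarrow> (\<exists>D P. standard_decomposition G D \<and> prune_step\<^sup>*\<^sup>* D P \<and>
     (\<nexists>L. prunable_leaf P L) \<and> T = decomposition_tree P)"

end

(*
  Glueing the nodes of a split decomposition along their markers in any order gives back G, so G
  and its pruned decompositions can be studied by cutting the tree at an arbitrary marker. As every
  prime distance hereditary graph has at most three vertices, all nodes are cliques or stars.

  Unpruning a leaf substitutes a clique or an independent set for a vertex, which preserves
  permutation graphs, and the glued pruned nodes form an induced subgraph of G. If the pruned tree is
  a path, then permutation models of its nodes, in which the markers to the neighbouring nodes are
  extremal, can be lined up to a model of G. If it is not a path, then it has a node with three
  branches. A leaf that cannot be pruned is a star attached at one of its leaves, so each branch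
  contains a vertex at distance two from its marker, and three such vertices form an asteroidal
  triple. Finally, permutation graphs are AT-free.
*)

theory Submission
  imports Defs
begin


section \<open>Splits and joins\<close>

text \<open>The implications run in a circle: path to permutation graph, permutation graph to
  AT-free, no path to an asteroidal triple. The obstacle is that \<open>split_decomposition\<close>
  records one order of splits, while the arguments on the tree must cut at a prescribed marker;
  hence the symmetric relation \<open>decomposes\<close> and the associativity of
  \<open>join\<close>. A marker is a placeholder: any of its neighbours on the other side can
  represent it, so every node embeds in \<open>G\<close> as an induced subgraph. Larger prime nodes
  are excluded because induced paths of a distance hereditary graph are shortest paths, which forces
  a module or a pendant vertex in or next to the last breadth-first layer of an incomplete graph.
  The coarseness of the standard decomposition enters around a star whose centre carries a branch:
  the other two branches are connected only through that one, and a neighbouring star attached at a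
  leaf might leave no detour. Graphs with at most two vertices are treated apart, being too small
  for \<open>node_graph\<close>.\<close>

definition simple_graph :: "'v pair_pre_digraph \<Rightarrow> bool" where
  "simple_graph G \<longleftrightarrow> finite (pverts G) \<and> parcs G \<subseteq> pverts G \<times> pverts G \<and>
     sym (parcs G) \<and> irrefl (parcs G)"

lemma simple_graphD:
  assumes "simple_graph G"
  shows "finite (pverts G)"
    and "(u, v) \<in> parcs G \<Longrightarrow> u \<in> pverts G" "(u, v) \<in> parcs G \<Longrightarrow> v \<in> pverts G"
    and "(u, v) \<in> parcs G \<Longrightarrow> (v, u) \<in> parcs G" "(u, u) \<notin> parcs G"
  using assms by (auto simp: simple_graph_def sym_def irrefl_def)

text \<open>Splitting produces nodes with at least three vertices, none of them isolated.\<close>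

definition node_graph :: "'v pair_pre_digraph \<Rightarrow> bool" where
  "node_graph G \<longleftrightarrow> simple_graph G \<and> 3 \<le> card (pverts G) \<and>
     (\<forall>v\<in>pverts G. \<exists>w. (v, w) \<in> parcs G)"

text \<open>The inverse of a simple split: both copies of the marker \<open>m\<close> disappear, and
  its former neighbours on the two sides become completely adjacent. It is used when
  \<open>m\<close> is the only vertex common to \<open>A\<close> and \<open>B\<close>.\<close>

definition join :: "'v \<Rightarrow> 'v pair_pre_digraph \<Rightarrow> 'v pair_pre_digraph \<Rightarrow> 'v pair_pre_digraph" where
  "join m A B = \<lparr> pverts = (pverts A \<union> pverts B) - {m},
     parcs = {(x, y). x \<noteq> m \<and> y \<noteq> m \<and> ((x, y) \<in> parcs A \<or> (x, y) \<in> parcs B \<or>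
       (x, m) \<in> parcs A \<and> (m, y) \<in> parcs B \<or> (x, m) \<in> parcs B \<and> (m, y) \<in> parcs A)} \<rparr>"

lemma pverts_join [simp]: "pverts (join m A B) = (pverts A \<union> pverts B) - {m}"
  by (simp add: join_def)

lemma parcs_join: "(x, y) \<in> parcs (join m A B) \<longleftrightarrow> x \<noteq> m \<and> y \<noteq> m \<and>
    ((x, y) \<in> parcs A \<or> (x, y) \<in> parcs B \<or>
     (x, m) \<in> parcs A \<and> (m, y) \<in> parcs B \<or> (x, m) \<in> parcs B \<and> (m, y) \<in> parcs A)"
  by (simp add: join_def)

lemma join_commute: "join m A B = join m B A"
  by (intro pair_pre_digraph.equality) (auto simp: join_def)

lemma parcs_join_left:
  assumes "simple_graph A" "simple_graph B" "pverts A \<inter> pverts B = {m}"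
    and "x \<in> pverts A" "y \<in> pverts A" "x \<noteq> m" "y \<noteq> m"
  shows "(x, y) \<in> parcs (join m A B) \<longleftrightarrow> (x, y) \<in> parcs A"
  using assms simple_graphD(2,3)[OF assms(1)] simple_graphD(2,3)[OF assms(2)]
  unfolding parcs_join by blast

lemma parcs_join_right:
  assumes "simple_graph A" "simple_graph B" "pverts A \<inter> pverts B = {m}"
    and "x \<in> pverts B" "y \<in> pverts B" "x \<noteq> m" "y \<noteq> m"
  shows "(x, y) \<in> parcs (join m A B) \<longleftrightarrow> (x, y) \<in> parcs B"
  using assms simple_graphD(2,3)[OF assms(1)] simple_graphD(2,3)[OF assms(2)]
  unfolding parcs_join by blast

lemma parcs_join_cross:
  assumes "simple_graph A" "simple_graph B" "pverts A \<inter> pverts B = {m}"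
    and "x \<in> pverts A" "y \<in> pverts B" "x \<noteq> m" "y \<noteq> m"
  shows "(x, y) \<in> parcs (join m A B) \<longleftrightarrow> (x, m) \<in> parcs A \<and> (m, y) \<in> parcs B"
    and "(y, x) \<in> parcs (join m A B) \<longleftrightarrow> (x, m) \<in> parcs A \<and> (m, y) \<in> parcs B"
proof -
  note a = simple_graphD[OF assms(1)] and b = simple_graphD[OF assms(2)]
  have "x \<notin> pverts B" "y \<notin> pverts A" using assms(3-7) by auto
  then have "(x, y) \<notin> parcs A" "(x, y) \<notin> parcs B" "(y, x) \<notin> parcs A" "(y, x) \<notin> parcs B"
    "(x, m) \<notin> parcs B" "(m, x) \<notin> parcs B" "(m, y) \<notin> parcs A" "(y, m) \<notin> parcs A"
    using a(2,3) b(2,3) by blast+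
  moreover have "(m, x) \<in> parcs A \<longleftrightarrow> (x, m) \<in> parcs A" "(y, m) \<in> parcs B \<longleftrightarrow> (m, y) \<in> parcs B"
    using a(4) b(4) by blast+
  ultimately show "(x, y) \<in> parcs (join m A B) \<longleftrightarrow> (x, m) \<in> parcs A \<and> (m, y) \<in> parcs B"
    and "(y, x) \<in> parcs (join m A B) \<longleftrightarrow> (x, m) \<in> parcs A \<and> (m, y) \<in> parcs B"
    using assms(6,7) unfolding parcs_join by auto
qed

lemma simple_graph_join:
  assumes "simple_graph A" "simple_graph B" "pverts A \<inter> pverts B = {m}"
  shows "simple_graph (join m A B)"
proof -
  note a = simple_graphD[OF assms(1)] and b = simple_graphD[OF assms(2)]
  have "sym (parcs (join m A B))"
    unfolding sym_def parcs_join using a(4) b(4) by blast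
  moreover have "irrefl (parcs (join m A B))"
    unfolding irrefl_def parcs_join using a b assms(3) by blast
  moreover have "parcs (join m A B) \<subseteq> pverts (join m A B) \<times> pverts (join m A B)"
    using a(2,3) b(2,3) by (auto simp: parcs_join)
  ultimately show ?thesis
    using a(1) b(1) by (simp add: simple_graph_def)
qed

lemma card_pverts_join:
  assumes "simple_graph A" "simple_graph B" "pverts A \<inter> pverts B = {m}"
  shows "card (pverts (join m A B)) + 2 = card (pverts A) + card (pverts B)"
proof -
  have f: "finite (pverts A)" "finite (pverts B)"
    using assms simple_graphD(1) by blast+
  have m: "m \<in> pverts A" "m \<in> pverts B" using assms(3) by auto
  have "card (pverts A \<union> pverts B) + 1 = card (pverts A) + card (pverts B)"
    using card_Un_Int[OF f] assms(3) by simp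
  moreover have "card (pverts A \<union> pverts B) = card (pverts A \<union> pverts B - {m}) + 1"
    using f m card_Suc_Diff1[of "pverts A \<union> pverts B" m] by simp
  ultimately show ?thesis by simp
qed

text \<open>A vertex whose only neighbour in its own part was \<open>m\<close> inherits the
  neighbours of \<open>m\<close> in the other part, and there are some because nodes have no
  isolated vertices.\<close>

lemma node_graph_join:
  assumes "node_graph A" "node_graph B" "pverts A \<inter> pverts B = {m}"
  shows "node_graph (join m A B)"
proof -
  have s: "simple_graph A" "simple_graph B" using assms by (auto simp: node_graph_def)
  note a = simple_graphD[OF s(1)] and b = simple_graphD[OF s(2)]
  have m: "m \<in> pverts A" "m \<in> pverts B" using assms(3) by auto
  obtain p where p: "(m, p) \<in> parcs A" using assms(1) m by (auto simp: node_graph_def)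
  obtain q where q: "(m, q) \<in> parcs B" using assms(2) m by (auto simp: node_graph_def)
  have "\<exists>w. (v, w) \<in> parcs (join m A B)" if v: "v \<in> pverts (join m A B)" for v
  proof (cases "v \<in> pverts A")
    case True
    then obtain w where w: "(v, w) \<in> parcs A" using assms(1) by (auto simp: node_graph_def)
    have "v \<noteq> m" "q \<noteq> m" using v q b(5) by auto
    then show ?thesis using w q unfolding parcs_join by metis
  next
    case False
    then obtain w where w: "(v, w) \<in> parcs B" using v assms(2) by (auto simp: node_graph_def)
    have "v \<noteq> m" "p \<noteq> m" using v p a(5) by auto
    then show ?thesis using w p unfolding parcs_join by metis
  qed
  then show ?thesis
    using simple_graph_join[OF s assms(3)] card_pverts_join[OF s assms(3)] assms(1,2)
    by (auto simp: node_graph_def)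
qed

text \<open>\<open>B\<close> and \<open>C\<close> are attached to \<open>A\<close> at different
  markers and do not meet, so neither glueing touches the marker of the other. The freedom to choose
  the order of glueings rests on this.\<close>

lemma join_assoc:
  assumes "simple_graph A" "simple_graph B" "simple_graph C"
    and "pverts A \<inter> pverts B = {m}" "pverts A \<inter> pverts C = {n}" "pverts B \<inter> pverts C = {}"
  shows "join n (join m A B) C = join m (join n A C) B"
proof -
  note a = simple_graphD[OF assms(1)] and b = simple_graphD[OF assms(2)]
    and c = simple_graphD[OF assms(3)]
  have mn: "m \<noteq> n" "m \<notin> pverts C" "n \<notin> pverts B" using assms(4-6) by auto
  have "(x, y) \<in> parcs (join n (join m A B) C) \<longleftrightarrow> (x, y) \<in> parcs (join m (join n A C) B)" for x y
  proof -
    have "(u, n) \<notin> parcs B" "(n, u) \<notin> parcs B" "(u, m) \<notin> parcs C" "(m, u) \<notin> parcs C" for u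
      using b(2,3) c(2,3) mn by blast+
    then show ?thesis
      unfolding parcs_join using mn by (cases "x = m"; cases "y = m"; cases "x = n"; cases "y = n") auto
  qed
  then have "parcs (join n (join m A B) C) = parcs (join m (join n A C) B)" by auto
  moreover have "pverts (join n (join m A B) C) = pverts (join m (join n A C) B)"
    using mn by auto
  ultimately show ?thesis by (intro pair_pre_digraph.equality) auto
qed

text \<open>A vertex of \<open>A\<close> has a neighbour beyond the split iff it is adjacent to
  \<open>m\<close>, because \<open>m\<close> has a neighbour in \<open>B\<close> that takes its
  place; so the pieces are recovered exactly. An isolated marker would lose this
  information.\<close>

lemma is_split_join:
  assumes "node_graph A" "node_graph B" "pverts A \<inter> pverts B = {m}"
  shows "is_split (join m A B) (pverts A - {m}) (pverts B - {m})"
    and "split_piece (join m A B) (pverts A - {m}) m = A"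
    and "split_piece (join m A B) (pverts B - {m}) m = B"
proof -
  have *: "neighbours (join m A B) (pverts B - {m}) = {x. (x, m) \<in> parcs A}"
    if nodes: "node_graph A" "node_graph B" and inter: "pverts A \<inter> pverts B = {m}" for A B
  proof -
    have s: "simple_graph A" "simple_graph B" using nodes by (auto simp: node_graph_def)
    note a = simple_graphD[OF s(1)] and b = simple_graphD[OF s(2)]
    have m: "m \<in> pverts A" "m \<in> pverts B" using inter by auto
    obtain q where q: "(m, q) \<in> parcs B" using nodes(2) m by (auto simp: node_graph_def)
    have q': "q \<in> pverts B" "q \<noteq> m" using q b by auto
    show ?thesis
    proof (intro set_eqI iffI)
      fix x assume "x \<in> neighbours (join m A B) (pverts B - {m})"
      then obtain w where "x \<in> pverts A" "x \<noteq> m" "w \<in> pverts B" "w \<noteq> m"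
        "(w, x) \<in> parcs (join m A B)"
        by (auto simp: neighbours_def)
      then show "x \<in> {x. (x, m) \<in> parcs A}" using parcs_join_cross(2)[OF s inter] by auto
    next
      fix x assume x: "x \<in> {x. (x, m) \<in> parcs A}"
      have x': "x \<in> pverts A" "x \<noteq> m" using x a by auto
      have "(q, x) \<in> parcs (join m A B)"
        using parcs_join_cross(2)[OF s inter x'(1) q'(1) x'(2) q'(2)] x q by auto
      moreover have "x \<notin> pverts B" using x' inter by auto
      ultimately show "x \<in> neighbours (join m A B) (pverts B - {m})"
        using x' q' by (auto simp: neighbours_def)
    qed
  qed
  have s: "simple_graph A" "simple_graph B" using assms by (auto simp: node_graph_def)
  note a = simple_graphD[OF s(1)] and b = simple_graphD[OF s(2)]
  have m: "m \<in> pverts A" "m \<in> pverts B" using assms(3) by auto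
  have inter': "pverts B \<inter> pverts A = {m}" using assms(3) by auto
  have c: "1 < card (pverts A - {m})" "1 < card (pverts B - {m})"
    using assms(1,2) m a(1) b(1) by (auto simp: node_graph_def)
  note nA = *[OF assms] and nB = *[OF assms(2,1) inter', folded join_commute[of m A B]]
  have "parcs (join m A B) \<inter> (pverts A - {m}) \<times> (pverts B - {m}) =
    neighbours (join m A B) (pverts B - {m}) \<times> neighbours (join m A B) (pverts A - {m})"
  proof (intro set_eqI iffI)
    fix e assume "e \<in> parcs (join m A B) \<inter> (pverts A - {m}) \<times> (pverts B - {m})"
    then obtain x y where "e = (x, y)" "(x, y) \<in> parcs (join m A B)" "x \<in> pverts A" "y \<in> pverts B"
      "x \<noteq> m" "y \<noteq> m" by auto
    then show "e \<in> neighbours (join m A B) (pverts B - {m}) \<times> neighbours (join m A B) (pverts A - {m})"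
      using parcs_join_cross(1)[OF s assms(3)] b(4) by (auto simp: nA nB)
  next
    fix e assume "e \<in> neighbours (join m A B) (pverts B - {m}) \<times> neighbours (join m A B) (pverts A - {m})"
    then obtain x y where e: "e = (x, y)" "(x, m) \<in> parcs A" "(y, m) \<in> parcs B"
      by (auto simp: nA nB)
    have "x \<in> pverts A" "x \<noteq> m" "y \<in> pverts B" "y \<noteq> m" using e(2,3) a b by auto
    then show "e \<in> parcs (join m A B) \<inter> (pverts A - {m}) \<times> (pverts B - {m})"
      using parcs_join_cross(1)[OF s assms(3)] b(4) e by auto
  qed
  then show "is_split (join m A B) (pverts A - {m}) (pverts B - {m})"
    using c assms(3) by (auto simp: is_split_def)
  have dA: "pverts (join m A B) - (pverts A - {m}) = pverts B - {m}"
    and dB: "pverts (join m A B) - (pverts B - {m}) = pverts A - {m}"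
    using assms(3) by auto
  have e: "parcs A = Restr (parcs (join m A B)) (pverts A - {m}) \<union>
      {m} \<times> {x. (x, m) \<in> parcs A} \<union> {x. (x, m) \<in> parcs A} \<times> {m}"
  proof (intro set_eqI)
    fix e :: "'a \<times> 'a"
    obtain x y where e: "e = (x, y)" by (cases e)
    show "e \<in> parcs A \<longleftrightarrow> e \<in> Restr (parcs (join m A B)) (pverts A - {m}) \<union>
      {m} \<times> {x. (x, m) \<in> parcs A} \<union> {x. (x, m) \<in> parcs A} \<times> {m}"
    proof (cases "x = m \<or> y = m")
      case True
      then show ?thesis using a(4,5) e by auto
    next
      case False
      then show ?thesis using parcs_join_left[OF s assms(3)] a(2,3) e by blast
    qed
  qed
  show "split_piece (join m A B) (pverts A - {m}) m = A"
    unfolding split_piece_def Let_def dA nA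
    using e m by (intro pair_pre_digraph.equality) auto
  have e: "parcs B = Restr (parcs (join m A B)) (pverts B - {m}) \<union>
      {m} \<times> {x. (x, m) \<in> parcs B} \<union> {x. (x, m) \<in> parcs B} \<times> {m}"
  proof (intro set_eqI)
    fix e :: "'a \<times> 'a"
    obtain x y where e: "e = (x, y)" by (cases e)
    show "e \<in> parcs B \<longleftrightarrow> e \<in> Restr (parcs (join m A B)) (pverts B - {m}) \<union>
      {m} \<times> {x. (x, m) \<in> parcs B} \<union> {x. (x, m) \<in> parcs B} \<times> {m}"
    proof (cases "x = m \<or> y = m")
      case True
      then show ?thesis using b(4,5) e by auto
    next
      case False
      then show ?thesis using parcs_join_right[OF s assms(3)] b(2,3) e by blast
    qed
  qed
  show "split_piece (join m A B) (pverts B - {m}) m = B"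
    unfolding split_piece_def Let_def dB nB
    using e m by (intro pair_pre_digraph.equality) auto
qed

lemma is_split_commute:
  assumes "is_split H V1 V2" "simple_graph H" shows "is_split H V2 V1"
proof -
  have "parcs H \<inter> V2 \<times> V1 = (parcs H \<inter> V1 \<times> V2)\<inverse>"
    using simple_graphD(4)[OF assms(2)] by auto
  then show ?thesis using assms(1) by (auto simp: is_split_def)
qed

lemma pverts_split_piece [simp]: "pverts (split_piece H V v) = insert v V"
  by (simp add: split_piece_def Let_def)

lemma parcs_split_piece:
  "parcs (split_piece H V v) = Restr (parcs H) V \<union> {v} \<times> neighbours H (pverts H - V) \<union>
     neighbours H (pverts H - V) \<times> {v}"
  by (simp add: split_piece_def Let_def)

lemma simple_graph_split_piece:
  assumes "simple_graph H" "V \<subseteq> pverts H" "v \<notin> pverts H"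
  shows "simple_graph (split_piece H V v)"
proof -
  have "finite V" using assms simple_graphD(1) finite_subset by metis
  moreover have "neighbours H (pverts H - V) \<subseteq> V"
    by (auto simp: neighbours_def)
  ultimately show ?thesis
    using assms simple_graphD[OF assms(1)]
    unfolding simple_graph_def parcs_split_piece
    by (auto simp: sym_def irrefl_def)
qed

text \<open>The split condition says that the crossing edges form a complete bipartite graph between
  the two frontiers, which is what \<open>join\<close> rebuilds from the two copies of the
  marker.\<close>

lemma join_split_pieces:
  assumes "is_split H V1 V2" "simple_graph H" "v \<notin> pverts H"
  shows "join v (split_piece H V1 v) (split_piece H V2 v) = H"
proof -
  have V: "V1 \<union> V2 = pverts H" "V1 \<inter> V2 = {}"
    and cross: "parcs H \<inter> V1 \<times> V2 = neighbours H V2 \<times> neighbours H V1"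
    using assms(1) by (auto simp: is_split_def)
  have cross': "parcs H \<inter> V2 \<times> V1 = neighbours H V1 \<times> neighbours H V2"
    using is_split_commute[OF assms(1,2)] by (auto simp: is_split_def)
  have d: "pverts H - V1 = V2" "pverts H - V2 = V1" using V by auto
  have n: "neighbours H V2 \<subseteq> V1" "neighbours H V1 \<subseteq> V2" using V by (auto simp: neighbours_def)
  have v: "v \<notin> V1" "v \<notin> V2" using V assms(3) by auto
  have "(x, y) \<in> parcs (join v (split_piece H V1 v) (split_piece H V2 v)) \<longleftrightarrow> (x, y) \<in> parcs H" for x y
  proof
    assume "(x, y) \<in> parcs (join v (split_piece H V1 v) (split_piece H V2 v))"
    then show "(x, y) \<in> parcs H"
      unfolding parcs_join parcs_split_piece d using n v cross cross' by blast
  next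
    assume e: "(x, y) \<in> parcs H"
    have "x \<in> V1 \<union> V2" "y \<in> V1 \<union> V2" using e V simple_graphD[OF assms(2)] by auto
    show "(x, y) \<in> parcs (join v (split_piece H V1 v) (split_piece H V2 v))"
    proof (cases "x \<in> V1 \<longleftrightarrow> y \<in> V1")
      case True
      then have "(x, y) \<in> Restr (parcs H) V1 \<or> (x, y) \<in> Restr (parcs H) V2"
        using e \<open>x \<in> V1 \<union> V2\<close> \<open>y \<in> V1 \<union> V2\<close> by auto
      then show ?thesis using v unfolding parcs_join parcs_split_piece d by auto
    next
      case False
      then have "(x, y) \<in> parcs H \<inter> V1 \<times> V2 \<or> (x, y) \<in> parcs H \<inter> V2 \<times> V1"
        using e \<open>x \<in> V1 \<union> V2\<close> \<open>y \<in> V1 \<union> V2\<close> by auto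
      then have "x \<in> neighbours H V2 \<and> y \<in> neighbours H V1 \<or>
          x \<in> neighbours H V1 \<and> y \<in> neighbours H V2"
        unfolding cross cross' by auto
      moreover have "x \<noteq> v" "y \<noteq> v" using v \<open>x \<in> V1 \<union> V2\<close> \<open>y \<in> V1 \<union> V2\<close> by auto
      ultimately show ?thesis unfolding parcs_join parcs_split_piece d by auto
    qed
  qed
  then have "parcs (join v (split_piece H V1 v) (split_piece H V2 v)) = parcs H" by auto
  then show ?thesis
    using V v by (intro pair_pre_digraph.equality) auto
qed

abbreviation graph_connected :: "'v pair_pre_digraph \<Rightarrow> bool" where
  "graph_connected H \<equiv> \<forall>u\<in>pverts H. \<forall>v\<in>pverts H. (u, v) \<in> (parcs H)\<^sup>*"

lemma node_graphI:
  assumes "simple_graph H" "graph_connected H" "3 \<le> card (pverts H)"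
  shows "node_graph H"
proof -
  have "\<exists>w. (v, w) \<in> parcs H" if v: "v \<in> pverts H" for v
  proof -
    have "\<exists>u. u \<in> pverts H \<and> u \<noteq> v"
    proof (rule ccontr)
      assume "\<not> ?thesis"
      then have "pverts H = {v}" using v by blast
      then show False using assms(3) by simp
    qed
    then obtain u where "u \<in> pverts H" "u \<noteq> v" by blast
    then have "(v, u) \<in> (parcs H)\<^sup>*" "u \<noteq> v" using assms(2) v by auto
    then show ?thesis by (auto elim: converse_rtranclE)
  qed
  then show ?thesis using assms by (simp add: node_graph_def)
qed

text \<open>Contracting the far side of the split to the new vertex maps walks to walks.\<close>

lemma graph_connected_split_piece:
  assumes "is_split H V1 V2" "simple_graph H" "v \<notin> pverts H" "graph_connected H"
  shows "graph_connected (split_piece H V1 v)"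
proof -
  have V: "V1 \<union> V2 = pverts H" "V1 \<inter> V2 = {}" and V2: "1 < card V2"
    using assms(1) by (auto simp: is_split_def)
  define \<pi> where "\<pi> x = (if x \<in> V1 then x else v)" for x
  have step: "(\<pi> x, \<pi> y) \<in> (parcs (split_piece H V1 v))\<^sup>*" if "(x, y) \<in> parcs H" for x y
  proof -
    have xy: "x \<in> pverts H" "y \<in> pverts H" "(y, x) \<in> parcs H"
      using simple_graphD[OF assms(2)] that by auto
    then have "(\<pi> x, \<pi> y) \<in> parcs (split_piece H V1 v) \<or> \<pi> x = \<pi> y"
      using that V by (auto simp: parcs_split_piece \<pi>_def neighbours_def)
    then show ?thesis by auto
  qed
  have walk: "(\<pi> x, \<pi> y) \<in> (parcs (split_piece H V1 v))\<^sup>*" if "(x, y) \<in> (parcs H)\<^sup>*" for x y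
    using that by induction (auto intro: rtrancl_trans step)
  obtain z where z: "z \<in> V2" using V2 by (cases "V2 = {}") auto
  have surj: "\<exists>x \<in> pverts H. \<pi> x = u" if "u \<in> pverts (split_piece H V1 v)" for u
  proof (cases "u = v")
    case True
    have "z \<in> pverts H" "\<pi> z = v" using z V by (auto simp: \<pi>_def)
    then show ?thesis using True by blast
  next
    case False
    then have "u \<in> pverts H" "\<pi> u = u" using that V by (auto simp: \<pi>_def)
    then show ?thesis by blast
  qed
  show ?thesis
  proof (intro ballI)
    fix a b assume "a \<in> pverts (split_piece H V1 v)" "b \<in> pverts (split_piece H V1 v)"
    then obtain x y where "x \<in> pverts H" "y \<in> pverts H" "\<pi> x = a" "\<pi> y = b" using surj by metis
    then show "(a, b) \<in> (parcs (split_piece H V1 v))\<^sup>*" using walk assms(4) by blast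
  qed
qed

lemma node_graph_split_piece:
  assumes "is_split H V1 V2" "simple_graph H" "v \<notin> pverts H" "graph_connected H"
  shows "node_graph (split_piece H V1 v)"
proof (rule node_graphI)
  have V: "V1 \<union> V2 = pverts H" "1 < card V1" using assms(1) by (auto simp: is_split_def)
  then have "finite V1" "v \<notin> V1" using assms(2,3) simple_graphD(1) by (auto simp: card_ge_0_finite)
  then show "3 \<le> card (pverts (split_piece H V1 v))" using V(2) by simp
  show "simple_graph (split_piece H V1 v)"
    using simple_graph_split_piece[OF assms(2) _ assms(3)] V(1) by auto
qed (rule graph_connected_split_piece[OF assms])


section \<open>Decompositions as sets of glued nodes\<close>

definition all_verts :: "'v pair_pre_digraph set \<Rightarrow> 'v set" where
  "all_verts D = \<Union>(pverts ` D)"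

lemma all_vertsI [intro]: "X \<in> D \<Longrightarrow> v \<in> pverts X \<Longrightarrow> v \<in> all_verts D"
  by (auto simp: all_verts_def)

lemma all_vertsE: "v \<in> all_verts D \<Longrightarrow> (\<And>X. X \<in> D \<Longrightarrow> v \<in> pverts X \<Longrightarrow> P) \<Longrightarrow> P"
  by (auto simp: all_verts_def)

lemma all_verts_simps [simp]:
  "all_verts {} = {}" "all_verts (insert X D) = pverts X \<union> all_verts D"
  "all_verts (D1 \<union> D2) = all_verts D1 \<union> all_verts D2"
  by (auto simp: all_verts_def)

lemma all_verts_DiffD [dest]: "v \<in> all_verts (D - S) \<Longrightarrow> v \<in> all_verts D"
  by (auto simp: all_verts_def)

lemma Int_singletonI:
  "A \<inter> C = {m} \<Longrightarrow> m \<in> P \<Longrightarrow> m \<in> C \<Longrightarrow> B \<inter> C \<subseteq> {m} \<Longrightarrow> P \<subseteq> A \<union> B \<Longrightarrow> P \<inter> C = {m}"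
  by blast

lemma all_verts_mono: "D1 \<subseteq> D2 \<Longrightarrow> all_verts D1 \<subseteq> all_verts D2"
  by (auto simp: all_verts_def)

text \<open>
  \<open>decomposes D H\<close>: glueing the nodes in \<open>D\<close> along their shared markers yields \<open>H\<close>. Other than in
  \<^const>\<open>split_decomposition\<close>, the order of the splits plays no role here, and \<open>H\<close> may itself have
  marker vertices.
\<close>

inductive decomposes :: "'a node set \<Rightarrow> 'a node \<Rightarrow> bool" where
  single: "node_graph H \<Longrightarrow> decomposes {H} H"
| glue: "decomposes D1 H1 \<Longrightarrow> decomposes D2 H2 \<Longrightarrow> m \<in> pverts H1 \<Longrightarrow> m \<in> pverts H2 \<Longrightarrow>
    all_verts D1 \<inter> all_verts D2 = {m} \<Longrightarrow> m \<in> range Inr \<Longrightarrow> decomposes (D1 \<union> D2) (join m H1 H2)"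

lemma decomposes_basic:
  assumes "decomposes D H"
  shows "node_graph H \<and> pverts H \<subseteq> all_verts D \<and> finite D \<and> D \<noteq> {} \<and> (\<forall>X\<in>D. node_graph X)"
  using assms
proof induction
  case (glue D1 H1 D2 H2 m)
  have V: "pverts H1 \<subseteq> all_verts D1" "pverts H2 \<subseteq> all_verts D2" using glue.IH by auto
  then have "pverts H1 \<inter> pverts H2 = {m}" using glue.hyps(3-5) by blast
  then have "node_graph (join m H1 H2)" using glue.IH by (intro node_graph_join) auto
  moreover have "pverts (join m H1 H2) \<subseteq> all_verts (D1 \<union> D2)" using V by auto
  ultimately show ?case using glue.IH by auto
qed auto

lemma decomposesD:
  assumes "decomposes D H"
  shows "node_graph H" "simple_graph H" "pverts H \<subseteq> all_verts D" "finite D" "D \<noteq> {}"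
    and "X \<in> D \<Longrightarrow> node_graph X" "X \<in> D \<Longrightarrow> simple_graph X"
  using decomposes_basic[OF assms] by (auto simp: node_graph_def)

text \<open>Decompositions are sets, so \<open>D - {X}\<close> must not remove a node from the other
  side of a cut. A node has three vertices and does not fit into the single vertex shared by the two
  sides.\<close>

lemma node_graph_not_in:
  assumes "node_graph X" "pverts X \<inter> all_verts C \<subseteq> {m}"
  shows "X \<notin> C"
proof
  assume "X \<in> C"
  then have "pverts X \<subseteq> {m}" using assms(2) by blast
  then have "card (pverts X) \<le> card {m}" by (intro card_mono) auto
  then show False using assms(1) by (simp add: node_graph_def)
qed

text \<open>A node contributes at least three vertices, and each glueing removes two from the sum.
  This bounds the number of nodes over all decompositions of a graph, so one with the most nodes
  exists.\<close>

lemma decomposes_card: "decomposes D H \<Longrightarrow> card D + 2 \<le> card (pverts H)"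
proof (induction rule: decomposes.induct)
  case (single H)
  then show ?case by (simp add: node_graph_def)
next
  case (glue D1 H1 D2 H2 m)
  have i: "pverts H1 \<inter> pverts H2 = {m}"
    using glue.hyps decomposesD(3)[OF glue.hyps(1)] decomposesD(3)[OF glue.hyps(2)] by blast
  have "card (D1 \<union> D2) \<le> card D1 + card D2" by (rule card_Un_le)
  then show ?case
    using card_pverts_join[OF decomposesD(2)[OF glue.hyps(1)] decomposesD(2)[OF glue.hyps(2)] i]
      glue.IH by simp
qed

lemma decomposes_unique:
  assumes "decomposes D H" "v \<in> pverts H" "X \<in> D" "Y \<in> D" "v \<in> pverts X" "v \<in> pverts Y"
  shows "X = Y"
  using assms
proof (induction arbitrary: X Y)
  case (glue D1 H1 D2 H2 m)
  have V: "pverts H1 \<subseteq> all_verts D1" "pverts H2 \<subseteq> all_verts D2"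
    using glue.hyps decomposesD(3) by blast+
  have v: "v \<noteq> m" "v \<in> pverts H1 \<or> v \<in> pverts H2" using glue.prems by auto
  show ?case
  proof (cases "v \<in> pverts H1")
    case True
    then have "v \<notin> all_verts D2" using V v glue.hyps by blast
    then show ?thesis using glue.IH(1)[OF True] glue.prems by blast
  next
    case False
    then have t: "v \<in> pverts H2" using v by blast
    then have "v \<notin> all_verts D1" using V v glue.hyps by blast
    then show ?thesis using glue.IH(2)[OF t] glue.prems by blast
  qed
qed auto

section \<open>Cutting a decomposition at one edge of its tree\<close>

text \<open>The edge of the tree between \<open>X\<close> and \<open>Y\<close> is cut:
  \<open>D1\<close> and \<open>D2\<close> are the nodes of the two components, which glue to
  \<open>H1\<close> and \<open>H2\<close>. In other words, the glueing at \<open>m\<close> may be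
  performed last.\<close>

definition edge_split :: "'a node set \<Rightarrow> 'a node \<Rightarrow> 'a + nat \<Rightarrow> 'a node \<Rightarrow> 'a node \<Rightarrow>
    'a node set \<Rightarrow> 'a node set \<Rightarrow> 'a node \<Rightarrow> 'a node \<Rightarrow> bool" where
  "edge_split D H m X Y D1 D2 H1 H2 \<longleftrightarrow> D = D1 \<union> D2 \<and> X \<in> D1 \<and> Y \<in> D2 \<and>
     decomposes D1 H1 \<and> decomposes D2 H2 \<and> m \<in> pverts H1 \<and> m \<in> pverts H2 \<and>
     all_verts D1 \<inter> all_verts D2 = {m} \<and> m \<in> range Inr \<and> H = join m H1 H2"

lemma edge_split_sym:
  "edge_split D H m X Y D1 D2 H1 H2 \<Longrightarrow> edge_split D H m Y X D2 D1 H2 H1"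
  unfolding edge_split_def by (metis Int_commute Un_commute join_commute)

text \<open>A further part \<open>D2\<close>, glued at \<open>n\<close> to the side of
  \<open>X\<close>, leaves the cut at \<open>m\<close> intact: as \<open>n\<close> is a vertex of
  \<open>HA\<close> other than \<open>m\<close>, \<open>D2\<close> does not meet \<open>B\<close>,
  and \<open>join_assoc\<close> exchanges the two glueings.\<close>

lemma edge_split_glue:
  assumes "edge_split D1 H1 m X Y A B HA HB" "decomposes D2 H2"
    and "n \<in> pverts HA" "n \<in> pverts H2" "n \<noteq> m" "all_verts D1 \<inter> all_verts D2 = {n}" "n \<in> range Inr"
  shows "edge_split (D1 \<union> D2) (join n H1 H2) m X Y (A \<union> D2) B (join n HA H2) HB"
proof -
  have s: "D1 = A \<union> B" "X \<in> A" "Y \<in> B" "decomposes A HA" "decomposes B HB" "m \<in> pverts HA"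
    "m \<in> pverts HB" "all_verts A \<inter> all_verts B = {m}" "m \<in> range Inr" "H1 = join m HA HB"
    using assms(1) by (auto simp: edge_split_def)
  have V: "pverts HA \<subseteq> all_verts A" "pverts HB \<subseteq> all_verts B" "pverts H2 \<subseteq> all_verts D2"
    using decomposesD(3) s(4,5) assms(2) by blast+
  have A2: "all_verts A \<inter> all_verts D2 = {n}" and B2: "all_verts B \<inter> all_verts D2 = {}"
  proof -
    have "n \<in> all_verts A" "n \<in> all_verts D2" using V assms(3,4) by blast+
    moreover from this have "n \<notin> all_verts B" using s(8) assms(5) by blast
    moreover have "(all_verts A \<union> all_verts B) \<inter> all_verts D2 = {n}" using assms(6) s(1) by simp
    ultimately show "all_verts A \<inter> all_verts D2 = {n}" "all_verts B \<inter> all_verts D2 = {}" by auto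
  qed
  have "decomposes (A \<union> D2) (join n HA H2)"
    using decomposes.glue[OF s(4) assms(2-4) A2 assms(7)] .
  moreover have "join n (join m HA HB) H2 = join m (join n HA H2) HB"
  proof (rule join_assoc)
    show "pverts HA \<inter> pverts HB = {m}" using V s(6-8) by blast
    show "pverts HA \<inter> pverts H2 = {n}" using V A2 assms(3,4) by blast
    show "pverts HB \<inter> pverts H2 = {}" using V B2 by blast
  qed (use decomposesD(2) s(4,5) assms(2) in blast)+
  ultimately show ?thesis
    using s B2 assms(5) unfolding edge_split_def by auto
qed

text \<open>If the last glueing separates \<open>X\<close> from \<open>Y\<close>, its marker must be
  their common vertex \<open>m\<close>. Otherwise both lie on one side, where the induction
  hypothesis cuts at \<open>m\<close>, and the other side is glued to one of the two parts.\<close>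

lemma edge_split_exists:
  assumes "decomposes D H" "X \<in> D" "Y \<in> D" "X \<noteq> Y" "m \<in> pverts X" "m \<in> pverts Y"
  shows "\<exists>D1 D2 H1 H2. edge_split D H m X Y D1 D2 H1 H2"
  using assms
proof (induction arbitrary: X Y)
  case (single H)
  then show ?case by auto
next
  case (glue D1 H1 D2 H2 n)
  have extend: "\<exists>D1 D2 H1 H2. edge_split (Da \<union> Db) (join n Ha Hb) m X Y D1 D2 H1 H2"
    if es: "edge_split Da Ha m X Y A B HA HB" and db: "decomposes Db Hb" and n: "n \<in> pverts Ha"
      "n \<in> pverts Hb" "all_verts Da \<inter> all_verts Db = {n}" for X Y Da Ha Db Hb A B HA HB
  proof -
    have n': "n \<noteq> m" "n \<in> pverts HA \<or> n \<in> pverts HB" using es n by (auto simp: edge_split_def)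
    show ?thesis
    proof (cases "n \<in> pverts HA")
      case True
      show ?thesis using edge_split_glue[OF es db True n(2) n'(1) n(3) glue.hyps(6)] by blast
    next
      case False
      then have t: "n \<in> pverts HB" using n' by blast
      show ?thesis
        using edge_split_sym[OF edge_split_glue[OF edge_split_sym[OF es] db t n(2) n'(1) n(3) glue.hyps(6)]]
        by blast
    qed
  qed
  have e: "edge_split (D1 \<union> D2) (join n H1 H2) n U W D1 D2 H1 H2"
    if "U \<in> D1" "W \<in> D2" for U W
    unfolding edge_split_def using glue.hyps that by blast
  consider "X \<in> D1" "Y \<in> D1" | "X \<in> D2" "Y \<in> D2" | "X \<in> D1" "Y \<in> D2" | "X \<in> D2" "Y \<in> D1"
    using glue.prems by blast
  then show ?case
  proof cases
    case 1
    then obtain A B HA HB where "edge_split D1 H1 m X Y A B HA HB"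
      using glue.IH(1) glue.prems by metis
    then show ?thesis using extend glue.hyps by metis
  next
    case 2
    then obtain A B HA HB where es: "edge_split D2 H2 m X Y A B HA HB"
      using glue.IH(2) glue.prems by metis
    have "all_verts D2 \<inter> all_verts D1 = {n}" using glue.hyps by blast
    from extend[OF es glue.hyps(1,4,3) this] show ?thesis
      by (simp add: Un_commute join_commute)
  next
    case 3
    then have "m \<in> all_verts D1 \<inter> all_verts D2" using glue.prems by blast
    then show ?thesis using e[OF 3] glue.hyps(5) by auto
  next
    case 4
    then have "m \<in> all_verts D1 \<inter> all_verts D2" using glue.prems by blast
    then show ?thesis using edge_split_sym[OF e[OF 4(2,1)]] glue.hyps(5) by auto
  qed
qed

section \<open>Refining and coarsening a decomposition\<close>

text \<open>The condition on \<open>D'\<close> keeps the inner markers of \<open>Z\<close> apart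
  from the rest of \<open>D\<close>. Glueing then proceeds as before, with the nodes of
  \<open>D'\<close> in the place of \<open>Z\<close>.\<close>

lemma decomposes_substitute:
  assumes "decomposes D H" "Z \<in> D" "decomposes D' Z" "all_verts D' \<inter> all_verts (D - {Z}) \<subseteq> pverts Z"
  shows "decomposes (D - {Z} \<union> D') H"
  using assms
proof induction
  case (single H)
  then show ?case by simp
next
  case (glue D1 H1 D2 H2 m)
  have step: "decomposes (Da \<union> Db - {Z} \<union> D') (join m Ha Hb)"
    if d: "decomposes Db Hb" "decomposes (Da - {Z} \<union> D') Ha" and m: "m \<in> pverts Ha" "m \<in> pverts Hb"
      and i: "all_verts Da \<inter> all_verts Db = {m}" and Z: "Z \<in> Da" "Z \<notin> Db"
      and sub: "all_verts D' \<inter> all_verts Db \<subseteq> pverts Z" for Da Db Ha Hb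
  proof -
    have "m \<in> all_verts (Da - {Z} \<union> D')" "m \<in> all_verts Db" using decomposesD(3) d m by blast+
    moreover have "pverts Z \<subseteq> all_verts Da" using Z(1) by blast
    then have "all_verts D' \<inter> all_verts Db \<subseteq> {m}" using sub i by blast
    moreover have "all_verts (Da - {Z} \<union> D') \<subseteq> all_verts Da \<union> all_verts D'" by auto
    ultimately have "all_verts (Da - {Z} \<union> D') \<inter> all_verts Db = {m}"
      by (rule Int_singletonI[OF i])
    then have "decomposes ((Da - {Z} \<union> D') \<union> Db) (join m Ha Hb)"
      using decomposes.glue d m glue.hyps(6) by blast
    moreover have "(Da - {Z} \<union> D') \<union> Db = Da \<union> Db - {Z} \<union> D'" using Z by blast
    ultimately show ?thesis by simp
  qed
  have not2: "Z \<notin> D2" if "Z \<in> D1"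
    using node_graph_not_in[of Z D2 m] decomposesD(6)[OF glue.hyps(1) that] that glue.hyps(5) by blast
  have i': "all_verts D2 \<inter> all_verts D1 = {m}" using glue.hyps(5) by blast
  show ?case
  proof (cases "Z \<in> D1")
    case True
    have "all_verts D' \<inter> all_verts (D1 - {Z}) \<subseteq> pverts Z"
      "all_verts D' \<inter> all_verts D2 \<subseteq> pverts Z"
      using glue.prems(3) not2[OF True] all_verts_mono[of "D1 - {Z}" "D1 \<union> D2 - {Z}"]
        all_verts_mono[of D2 "D1 \<union> D2 - {Z}"] by blast+
    then show ?thesis
      using step[OF glue.hyps(2) _ glue.hyps(3-5) True not2[OF True]] glue.IH(1)[OF True glue.prems(2)]
      by blast
  next
    case False
    then have t: "Z \<in> D2" using glue.prems by blast
    have "all_verts D' \<inter> all_verts (D2 - {Z}) \<subseteq> pverts Z"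
      "all_verts D' \<inter> all_verts D1 \<subseteq> pverts Z"
      using glue.prems(3) False all_verts_mono[of "D2 - {Z}" "D1 \<union> D2 - {Z}"]
        all_verts_mono[of D1 "D1 \<union> D2 - {Z}"] by blast+
    then have "decomposes (D2 \<union> D1 - {Z} \<union> D') (join m H2 H1)"
      using step[OF glue.hyps(1) _ glue.hyps(4,3) i' t False] glue.IH(2)[OF t glue.prems(2)]
      by blast
    then show ?thesis by (simp add: Un_commute join_commute)
  qed
qed

text \<open>Glueing \<open>Z\<close> to the whole of \<open>H\<close> at the unglued vertex
  \<open>m\<close> amounts to glueing it to the node that contains \<open>m\<close>;
  \<open>join_assoc\<close> moves \<open>Z\<close> past every other marker.\<close>

lemma decomposes_plug:
  assumes "decomposes D H" "X \<in> D" "m \<in> pverts X" "m \<in> pverts H"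
    and "node_graph Z" "pverts Z \<inter> all_verts D = {m}"
  shows "decomposes (D - {X} \<union> {join m X Z}) (join m H Z)"
  using assms
proof induction
  case (single H)
  then show ?case using node_graph_join[of H Z m] decomposes.single by auto
next
  case (glue D1 H1 D2 H2 n)
  have step: "decomposes (Da \<union> Db - {X} \<union> {join m X Z}) (join m (join n Ha Hb) Z)"
    if d: "decomposes Da Ha" "decomposes Db Hb" and n: "n \<in> pverts Ha" "n \<in> pverts Hb"
      and i: "all_verts Da \<inter> all_verts Db = {n}" and X: "X \<in> Da"
      and mn: "m \<in> pverts Ha \<or> m \<in> pverts Hb" "m \<noteq> n"
      and Zi: "pverts Z \<inter> (all_verts Da \<union> all_verts Db) = {m}"
      and IH: "m \<in> pverts Ha \<Longrightarrow> pverts Z \<inter> all_verts Da = {m} \<Longrightarrow>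
        decomposes (Da - {X} \<union> {join m X Z}) (join m Ha Z)"
      for Da Db Ha Hb
  proof -
    have V: "pverts Ha \<subseteq> all_verts Da" "pverts Hb \<subseteq> all_verts Db" using d decomposesD(3) by blast+
    have m: "m \<in> all_verts Da" "m \<notin> all_verts Db" using X glue.prems(2) i mn by blast+
    then have mHa: "m \<in> pverts Ha" using V mn by blast
    have Zi': "pverts Z \<inter> all_verts Da = {m}" "pverts Z \<inter> all_verts Db = {}" using Zi m by auto
    have 1: "decomposes (Da - {X} \<union> {join m X Z}) (join m Ha Z)" using IH mHa Zi' by blast
    have n': "n \<in> pverts (join m Ha Z)" using n mn by auto
    have "all_verts (Da - {X} \<union> {join m X Z}) \<subseteq> all_verts Da \<union> pverts Z" using X by auto
    moreover have "n \<in> all_verts (Da - {X} \<union> {join m X Z})" using decomposesD(3)[OF 1] n' by blast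
    moreover have "n \<in> all_verts Db" using i by blast
    ultimately have "all_verts (Da - {X} \<union> {join m X Z}) \<inter> all_verts Db = {n}"
      using i Zi'(2) by blast
    note 2 = decomposes.glue[OF 1 d(2) n' n(2) this glue.hyps(6)]
    have "X \<notin> Db" using node_graph_not_in[of X Db n] decomposesD(6)[OF d(1) X] X i by blast
    then have "Da - {X} \<union> {join m X Z} \<union> Db = Da \<union> Db - {X} \<union> {join m X Z}" by blast
    moreover have "join n (join m Ha Z) Hb = join m (join n Ha Hb) Z"
    proof (rule join_assoc)
      show "pverts Ha \<inter> pverts Z = {m}" using V mHa Zi' by blast
      show "pverts Ha \<inter> pverts Hb = {n}" using V n i by blast
      show "pverts Z \<inter> pverts Hb = {}" using V Zi' by blast
    qed (use decomposesD(2) d glue.prems(4) in \<open>auto simp: node_graph_def\<close>)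
    ultimately show ?thesis using 2 by metis
  qed
  have mn: "m \<in> pverts H1 \<or> m \<in> pverts H2" "m \<noteq> n" using glue.prems(3) by auto
  have Zi: "pverts Z \<inter> (all_verts D1 \<union> all_verts D2) = {m}" using glue.prems(5) by (simp add: Un_commute)
  show ?case
  proof (cases "X \<in> D1")
    case True
    show ?thesis
      using step[OF glue.hyps(1-5) True mn Zi] glue.IH(1)[OF True glue.prems(2)] glue.prems(4) by blast
  next
    case False
    then have t: "X \<in> D2" using glue.prems by blast
    have "decomposes (D2 \<union> D1 - {X} \<union> {join m X Z}) (join m (join n H2 H1) Z)"
    proof (rule step[OF glue.hyps(2,1,4,3) _ t])
      show "all_verts D2 \<inter> all_verts D1 = {n}" using glue.hyps(5) by blast
      show "pverts Z \<inter> (all_verts D2 \<union> all_verts D1) = {m}" using Zi by blast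
      show "decomposes (D2 - {X} \<union> {join m X Z}) (join m H2 Z)"
        if "m \<in> pverts H2" "pverts Z \<inter> all_verts D2 = {m}"
        using glue.IH(2)[OF t glue.prems(2) that(1) glue.prems(4) that(2)] .
    qed (use mn in auto)
    then show ?thesis by (simp add: Un_commute join_commute[of n])
  qed
qed

text \<open>After the cut at \<open>m\<close>, the whole side \<open>H2\<close> is plugged into
  \<open>X\<close>, and \<open>X\<close> is plugged into \<open>Y\<close> on the other side; the
  enlarged first node is then decomposed by the second result. This undoes one split in the midst of
  a decomposition and yields the coarser ones with which a standard decomposition is
  compared.\<close>

lemma decomposes_merge:
  assumes "decomposes D H" "X \<in> D" "Y \<in> D" "X \<noteq> Y" "m \<in> pverts X" "m \<in> pverts Y"
  shows "decomposes (D - {X, Y} \<union> {join m X Y}) H"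
proof -
  obtain D1 D2 H1 H2 where "edge_split D H m X Y D1 D2 H1 H2"
    using edge_split_exists[OF assms] by blast
  then have s: "D = D1 \<union> D2" "X \<in> D1" "Y \<in> D2" "decomposes D1 H1" "decomposes D2 H2" "m \<in> pverts H1"
    "m \<in> pverts H2" "all_verts D1 \<inter> all_verts D2 = {m}" "H = join m H1 H2"
    by (auto simp: edge_split_def)
  have V: "pverts H1 \<subseteq> all_verts D1" "pverts H2 \<subseteq> all_verts D2" using s decomposesD(3) by blast+
  have X: "node_graph X" "pverts X \<inter> all_verts D2 = {m}"
    using decomposesD(6)[OF s(4,2)] s(2,7,8) V assms(5) by blast+
  have H2: "node_graph H2" "pverts H2 \<inter> all_verts D1 = {m}"
    using decomposesD(1)[OF s(5)] s(7,8) V by blast+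
  define Z where "Z = join m X H2"
  define D' where "D' = D2 - {Y} \<union> {join m X Y}"
  have 1: "decomposes D' Z"
    using decomposes_plug[OF s(5,3) assms(6) s(7) X]
    by (simp add: D'_def Z_def join_commute)
  have 2: "decomposes (D1 - {X} \<union> {Z}) H"
    using decomposes_plug[OF s(4,2) assms(5) s(6) H2] by (simp add: s(9) Z_def)
  have "all_verts D' \<inter> all_verts (D1 - {X}) \<subseteq> pverts Z"
  proof
    fix v assume v: "v \<in> all_verts D' \<inter> all_verts (D1 - {X})"
    then obtain W where W: "W \<in> D1" "W \<noteq> X" "v \<in> pverts W" by (auto elim: all_vertsE)
    have "v \<noteq> m" using decomposes_unique[OF s(4,6) W(1) s(2) _ assms(5)] W by blast
    then have "v \<notin> all_verts D2" using s(8) W by blast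
    then have "v \<in> pverts X" using v s(3) by (auto simp: D'_def)
    then show "v \<in> pverts Z" using \<open>v \<noteq> m\<close> by (simp add: Z_def)
  qed
  then have "all_verts D' \<inter> all_verts (D1 - {X} \<union> {Z} - {Z}) \<subseteq> pverts Z"
    using all_verts_mono[of "D1 - {X} \<union> {Z} - {Z}" "D1 - {X}"] by blast
  note 3 = decomposes_substitute[OF 2 _ 1 this]
  \<comment> \<open>A neighbour of \<open>m\<close> in \<open>H2\<close> belongs to \<open>Z\<close>
    but to no node of \<open>D1\<close>; so \<open>Z\<close> is new, and removing it from the set
    restores \<open>D1 - {X}\<close>.\<close>
  obtain w where "(m, w) \<in> parcs H2" using H2(1) s(7) by (auto simp: node_graph_def)
  then have w: "w \<in> pverts H2" "w \<noteq> m" using simple_graphD[OF decomposesD(2)[OF s(5)]] by auto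
  then have "w \<in> pverts Z" "w \<notin> all_verts D1" using H2(2) by (auto simp: Z_def)
  then have "Z \<notin> D1" by blast
  have "X \<notin> D2" using node_graph_not_in[OF X(1), of D2 m] X(2) by simp
  have "pverts Y \<subseteq> all_verts D2" using s(3) by blast
  then have "Y \<notin> D1"
    using node_graph_not_in[of Y D1 m] decomposesD(6)[OF s(5,3)] s(8) by blast
  have "D1 - {X} \<union> {Z} - {Z} = D1 - {X}" using \<open>Z \<notin> D1\<close> by auto
  moreover have "D1 - {X} \<union> (D2 - {Y}) = D - {X, Y}"
    unfolding s(1) using \<open>X \<notin> D2\<close> \<open>Y \<notin> D1\<close> by auto
  ultimately have "D1 - {X} \<union> {Z} - {Z} \<union> D' = D - {X, Y} \<union> {join m X Y}"
    unfolding D'_def by (simp add: Un_assoc[symmetric])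
  then show ?thesis using 3 by simp
qed

section \<open>Glueings versus sequences of splits\<close>

text \<open>Connectedness is carried along because a split piece of a disconnected graph may have an
  isolated marker, which \<open>node_graph\<close> excludes.\<close>

lemma decomposes_split_step:
  assumes "decomposes D H" "\<forall>X\<in>D. graph_connected X" "simple_split_step D D'"
  shows "decomposes D' H \<and> (\<forall>X\<in>D'. graph_connected X)"
proof -
  obtain Z V1 V2 n where Z: "Z \<in> D" "is_split Z V1 V2" "\<forall>K\<in>D. Inr n \<notin> pverts K"
    and D': "D' = (D - {Z}) \<union> {split_piece Z V1 (Inr n), split_piece Z V2 (Inr n)}"
    using assms(3) unfolding simple_split_step_def by blast
  define K1 where "K1 = split_piece Z V1 (Inr n)"
  define K2 where "K2 = split_piece Z V2 (Inr n)"
  have Zs: "simple_graph Z" "graph_connected Z" "Inr n \<notin> pverts Z"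
    using decomposesD(7)[OF assms(1)] Z(1,3) assms(2) by blast+
  note Z' = is_split_commute[OF Z(2) Zs(1)]
  have K: "node_graph K1" "node_graph K2" "graph_connected K1" "graph_connected K2" "join (Inr n) K1 K2 = Z"
    using node_graph_split_piece[OF Z(2) Zs(1,3,2)] node_graph_split_piece[OF Z' Zs(1,3,2)]
      graph_connected_split_piece[OF Z(2) Zs(1,3,2)] graph_connected_split_piece[OF Z' Zs(1,3,2)]
      join_split_pieces[OF Z(2) Zs(1,3)]
    unfolding K1_def K2_def by blast+
  have V: "V1 \<union> V2 = pverts Z" "V1 \<inter> V2 = {}" using Z(2) by (auto simp: is_split_def)
  have VK: "pverts K1 = insert (Inr n) V1" "pverts K2 = insert (Inr n) V2" by (simp_all add: K1_def K2_def)
  have "decomposes ({K1} \<union> {K2}) (join (Inr n) K1 K2)"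
  proof (rule decomposes.glue)
    show "all_verts {K1} \<inter> all_verts {K2} = {Inr n}" using VK V Zs(3) by auto
  qed (use K VK in \<open>auto intro: decomposes.single\<close>)
  then have "decomposes {K1, K2} Z" using K(5) by (simp add: insert_commute)
  moreover have "all_verts {K1, K2} \<inter> all_verts (D - {Z}) \<subseteq> pverts Z"
    using VK V Z(3) by (auto elim: all_vertsE)
  ultimately have "decomposes (D - {Z} \<union> {K1, K2}) H"
    using decomposes_substitute[OF assms(1) Z(1)] by blast
  then show ?thesis using D' K assms(2) unfolding K1_def K2_def by blast
qed

lemma all_verts_split_step:
  assumes "simple_split_step D D'" shows "all_verts D \<subseteq> all_verts D'"
proof -
  obtain Z V1 V2 n where Z: "is_split Z V1 V2"
    and D': "D' = (D - {Z}) \<union> {split_piece Z V1 (Inr n), split_piece Z V2 (Inr n)}"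
    using assms unfolding simple_split_step_def by blast
  have "pverts Z = V1 \<union> V2" using Z by (simp add: is_split_def)
  then have "pverts Z \<subseteq> all_verts D'" using D' by auto
  moreover have "all_verts (D - {Z}) \<subseteq> all_verts D'" using D' by (auto intro: all_verts_mono)
  moreover have "all_verts D \<subseteq> pverts Z \<union> all_verts (D - {Z})" by (auto elim: all_vertsE)
  ultimately show ?thesis by blast
qed

text \<open>The new marker differs from \<open>m\<close>, since \<open>m\<close> already occurs in
  \<open>D\<close>; hence it does not occur in \<open>C\<close> and is fresh for the larger set as
  well.\<close>

lemma split_step_context:
  assumes "simple_split_step D D'" "m \<in> all_verts D" "all_verts D' \<inter> all_verts C \<subseteq> {m}"
  shows "simple_split_step (D \<union> C) (D' \<union> C)"
proof -
  obtain Z V1 V2 n where Z: "Z \<in> D" "is_split Z V1 V2" "\<forall>K\<in>D. Inr n \<notin> pverts K"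
    and D': "D' = (D - {Z}) \<union> {split_piece Z V1 (Inr n), split_piece Z V2 (Inr n)}"
    using assms(1) unfolding simple_split_step_def by blast
  have "Inr n \<in> all_verts D'" "Inr n \<notin> all_verts D" using D' Z(3) by (auto elim: all_vertsE)
  then have n: "\<forall>K\<in>D \<union> C. Inr n \<notin> pverts K" using assms(2,3) Z(3) by blast
  have "Z \<notin> C"
  proof
    assume "Z \<in> C"
    then have "pverts Z \<subseteq> {m}" using all_verts_split_step[OF assms(1)] assms(3) Z(1) by blast
    then have "card V1 \<le> 1" using Z(2) card_mono[of "{m}" V1] by (auto simp: is_split_def)
    then show False using Z(2) by (simp add: is_split_def)
  qed
  then have "D' \<union> C = (D \<union> C - {Z}) \<union> {split_piece Z V1 (Inr n), split_piece Z V2 (Inr n)}"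
    using D' by blast
  then show ?thesis using Z n unfolding simple_split_step_def by blast
qed

lemma split_steps_context:
  assumes "simple_split_step\<^sup>*\<^sup>* D D'" "m \<in> all_verts D" "all_verts D' \<inter> all_verts C \<subseteq> {m}"
  shows "simple_split_step\<^sup>*\<^sup>* (D \<union> C) (D' \<union> C)"
proof -
  \<comment> \<open>Only the final set is assumed to meet \<open>C\<close> in at most
    \<open>m\<close>; as vertices never disappear, the intermediate sets then do so too.\<close>
  have "m \<in> all_verts D' \<and> (all_verts D' \<inter> all_verts C \<subseteq> {m} \<longrightarrow>
      simple_split_step\<^sup>*\<^sup>* (D \<union> C) (D' \<union> C))"
    using assms(1)
  proof induction
    case base
    then show ?case using assms(2) by simp
  next
    case (step D1 D2)
    have sub: "all_verts D1 \<subseteq> all_verts D2" using all_verts_split_step[OF step.hyps(2)] .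
    have "simple_split_step\<^sup>*\<^sup>* (D \<union> C) (D2 \<union> C)" if "all_verts D2 \<inter> all_verts C \<subseteq> {m}"
    proof -
      have "all_verts D1 \<inter> all_verts C \<subseteq> {m}" using sub that by blast
      then have "simple_split_step\<^sup>*\<^sup>* (D \<union> C) (D1 \<union> C)" using step.IH by blast
      moreover have "simple_split_step (D1 \<union> C) (D2 \<union> C)"
        using split_step_context[OF step.hyps(2) _ that] step.IH by blast
      ultimately show ?thesis by simp
    qed
    then show ?case using step.IH sub by blast
  qed
  then show ?thesis using assms(3) by blast
qed

text \<open>The last glueing becomes the first split; then each side is refined while the other is
  carried along as context. With \<open>decomposes_split_step\<close>, both descriptions of a
  decomposition agree for connected graphs.\<close>

lemma decomposes_split_steps: "decomposes D H \<Longrightarrow> simple_split_step\<^sup>*\<^sup>* {H} D"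
proof (induction rule: decomposes.induct)
  case (glue D1 H1 D2 H2 m)
  have V: "pverts H1 \<subseteq> all_verts D1" "pverts H2 \<subseteq> all_verts D2" using glue.hyps decomposesD(3) by blast+
  have i: "pverts H1 \<inter> pverts H2 = {m}" using V glue.hyps(3-5) by blast
  have H: "node_graph H1" "node_graph H2" using glue.hyps decomposesD(1) by blast+
  obtain n where n: "m = Inr n" using glue.hyps by blast
  have "{H1, H2} = {join m H1 H2} - {join m H1 H2} \<union>
      {split_piece (join m H1 H2) (pverts H1 - {m}) (Inr n),
       split_piece (join m H1 H2) (pverts H2 - {m}) (Inr n)}"
    using is_split_join(2,3)[OF H i] n by auto
  then have "simple_split_step {join m H1 H2} {H1, H2}"
    unfolding simple_split_step_def using is_split_join(1)[OF H i] n by auto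
  moreover have "simple_split_step\<^sup>*\<^sup>* ({H1} \<union> {H2}) (D1 \<union> {H2})"
    by (rule split_steps_context[OF glue.IH(1)]) (use glue.hyps V in auto)
  moreover have "simple_split_step\<^sup>*\<^sup>* ({H2} \<union> D1) (D2 \<union> D1)"
    by (rule split_steps_context[OF glue.IH(2)]) (use glue.hyps V in auto)
  moreover have "{H1} \<union> {H2} = {H1, H2}" by blast
  ultimately show ?case by (simp add: Un_commute)
qed simp

text \<open>The two pieces contain a fresh marker and share no other vertex, so they are new and
  distinct. Refinement thus strictly increases the number of nodes.\<close>

lemma split_step_card:
  assumes "simple_split_step D D'" "finite D"
  shows "finite D' \<and> card D' = card D + 1"
proof -
  obtain Z V1 V2 n where Z: "Z \<in> D" "is_split Z V1 V2" "\<forall>K\<in>D. Inr n \<notin> pverts K"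
    and D': "D' = (D - {Z}) \<union> {split_piece Z V1 (Inr n), split_piece Z V2 (Inr n)}"
    using assms(1) unfolding simple_split_step_def by blast
  define K1 where "K1 = split_piece Z V1 (Inr n)"
  define K2 where "K2 = split_piece Z V2 (Inr n)"
  have VK: "pverts K1 = insert (Inr n) V1" "pverts K2 = insert (Inr n) V2" by (simp_all add: K1_def K2_def)
  have "K1 \<notin> D" "K2 \<notin> D" using Z(3) VK by auto
  moreover have "K1 \<noteq> K2"
  proof
    assume "K1 = K2"
    then have "V1 \<subseteq> {Inr n}" using VK Z(2) by (auto simp: is_split_def)
    then have "card V1 \<le> 1" using card_mono[of "{Inr n}" V1] by auto
    then show False using Z(2) by (simp add: is_split_def)
  qed
  moreover have "D' = insert K1 (insert K2 (D - {Z}))" using D' by (auto simp: K1_def K2_def)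
  moreover have "card D = Suc (card (D - {Z}))" using card_Suc_Diff1[OF assms(2) Z(1)] by simp
  ultimately show ?thesis using assms(2) by simp
qed


section \<open>Distance hereditary nodes\<close>

text \<open>Induced subgraphs up to renaming. Shortness of induced paths passes down along
  embeddings, asteroidal triples pass up.\<close>

definition embedding :: "('v \<Rightarrow> 'w) \<Rightarrow> 'v pair_pre_digraph \<Rightarrow> 'w pair_pre_digraph \<Rightarrow> bool" where
  "embedding f A B \<longleftrightarrow> inj_on f (pverts A) \<and> f ` pverts A \<subseteq> pverts B \<and>
     (\<forall>u\<in>pverts A. \<forall>v\<in>pverts A. (f u, f v) \<in> parcs B \<longleftrightarrow> (u, v) \<in> parcs A)"

lemma embeddingD:
  assumes "embedding f A B" "u \<in> pverts A"
  shows "f u \<in> pverts B"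
    and "v \<in> pverts A \<Longrightarrow> (f u, f v) \<in> parcs B \<longleftrightarrow> (u, v) \<in> parcs A"
    and "v \<in> pverts A \<Longrightarrow> f u = f v \<longleftrightarrow> u = v"
  using assms by (auto simp: embedding_def inj_on_def)

lemma embedding_comp:
  assumes "embedding f A B" "embedding g B C"
  shows "embedding (g \<circ> f) A C"
proof -
  have "inj_on (g \<circ> f) (pverts A)"
    using assms by (auto simp: embedding_def intro: comp_inj_on inj_on_subset)
  then show ?thesis
    using embeddingD[OF assms(1)] embeddingD[OF assms(2)] unfolding embedding_def by auto
qed

text \<open>A neighbour \<open>w\<close> of \<open>m\<close> in \<open>B\<close> is adjacent in the
  glued graph to precisely the former neighbours of \<open>m\<close> in \<open>A\<close>, so it can
  represent the marker.\<close>

lemma embedding_join: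
  assumes "simple_graph A" "simple_graph B" "pverts A \<inter> pverts B = {m}" "(m, w) \<in> parcs B"
  shows "embedding (\<lambda>v. if v = m then w else v) A (join m A B)"
proof -
  note a = simple_graphD[OF assms(1)] and b = simple_graphD[OF assms(2)]
  have m: "m \<in> pverts A" using assms(3) by auto
  have w: "w \<in> pverts B" "w \<noteq> m" using assms(4) b(3,5) by auto
  then have wA: "w \<notin> pverts A" using assms(3) by auto
  have e: "(if u = m then w else u, if v = m then w else v) \<in> parcs (join m A B) \<longleftrightarrow> (u, v) \<in> parcs A"
    if uv: "u \<in> pverts A" "v \<in> pverts A" for u v
  proof -
    consider "u = m" "v = m" | "u = m" "v \<noteq> m" | "u \<noteq> m" "v = m" | "u \<noteq> m" "v \<noteq> m" by blast
    then show ?thesis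
    proof cases
      case 1
      then show ?thesis
        using a(5) simple_graphD(5)[OF simple_graph_join[OF assms(1-3)]] by auto
    next
      case 2
      then show ?thesis
        using parcs_join_cross(2)[OF assms(1-3) uv(2) w(1) 2(2) w(2)] assms(4) a(4) by auto
    next
      case 3
      then show ?thesis
        using parcs_join_cross(1)[OF assms(1-3) uv(1) w(1) 3(1) w(2)] assms(4) by auto
    next
      case 4
      then show ?thesis using parcs_join_left[OF assms(1-3) uv] by auto
    qed
  qed
  have "inj_on (\<lambda>v. if v = m then w else v) (pverts A)"
    using wA by (auto simp: inj_on_def)
  then show ?thesis
    using e w unfolding embedding_def by auto
qed

text \<open>Every glueing replaces its marker by a representative on the other side. That unglued
  vertices stay fixed lets adjacencies between remaining markers be read off in their node
  later.\<close>

lemma decomposes_node_embedding: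
  assumes "decomposes D H" "X \<in> D"
  shows "\<exists>f. embedding f X H \<and> (\<forall>v\<in>pverts X \<inter> pverts H. f v = v)"
  using assms
proof (induction arbitrary: X)
  case (single H)
  then show ?case by (intro exI[of _ id]) (auto simp: embedding_def)
next
  case (glue D1 H1 D2 H2 m)
  have step: "\<exists>f. embedding f X (join m Ha Hb) \<and> (\<forall>v\<in>pverts X \<inter> pverts (join m Ha Hb). f v = v)"
    if d: "decomposes Da Ha" "decomposes Db Hb" and m: "m \<in> pverts Ha" "m \<in> pverts Hb"
      and i: "all_verts Da \<inter> all_verts Db = {m}" and X: "X \<in> Da"
      and f: "embedding f X Ha" "\<forall>v\<in>pverts X \<inter> pverts Ha. f v = v" for Da Ha Db Hb X f
  proof -
    have V: "pverts Ha \<subseteq> all_verts Da" "pverts Hb \<subseteq> all_verts Db" using decomposesD(3) d by blast+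
    have i': "pverts Ha \<inter> pverts Hb = {m}" using V m i by blast
    obtain w where w: "(m, w) \<in> parcs Hb" using decomposesD(1)[OF d(2)] m by (auto simp: node_graph_def)
    note g = embedding_join[OF decomposesD(2)[OF d(1)] decomposesD(2)[OF d(2)] i' w]
    have "((\<lambda>v. if v = m then w else v) \<circ> f) v = v" if v: "v \<in> pverts X \<inter> pverts (join m Ha Hb)" for v
    proof -
      have "v \<noteq> m" "v \<in> all_verts Da" using v X by auto
      then have "v \<notin> pverts Hb" using V i by blast
      then have "f v = v" using v f(2) by auto
      then show ?thesis using \<open>v \<noteq> m\<close> by simp
    qed
    then show ?thesis using embedding_comp[OF f(1) g] by blast
  qed
  show ?case
  proof (cases "X \<in> D1")
    case True
    then show ?thesis using step[OF glue.hyps(1-5) True] glue.IH(1)[OF True] by blast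
  next
    case False
    then have t: "X \<in> D2" using glue.prems by blast
    have "all_verts D2 \<inter> all_verts D1 = {m}" using glue.hyps(5) by blast
    then show ?thesis
      using step[OF glue.hyps(2,1,4,3) _ t] glue.IH(2)[OF t] by (metis join_commute)
  qed
qed

section \<open>Induced paths as shortest paths\<close>

definition induced_path :: "'v rel \<Rightarrow> (nat \<Rightarrow> 'v) \<Rightarrow> nat \<Rightarrow> bool" where
  "induced_path E p k \<longleftrightarrow> inj_on p {..k} \<and>
     (\<forall>i\<le>k. \<forall>j\<le>k. (p i, p j) \<in> E \<longleftrightarrow> i = Suc j \<or> j = Suc i)"

text \<open>The characterisation of distance hereditary graphs by induced paths, with walks of
  length \<open>n\<close> as powers of the arc relation. It speaks of adjacency alone and so
  transfers easily to nodes.\<close>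

definition induced_paths_shortest :: "'v rel \<Rightarrow> bool" where
  "induced_paths_shortest E \<longleftrightarrow> (\<forall>p k n. induced_path E p k \<longrightarrow> (p 0, p k) \<in> E ^^ n \<longrightarrow> k \<le> n)"

lemma relpow_map:
  assumes "(x, y) \<in> E ^^ n" "\<And>a b. (a, b) \<in> E \<Longrightarrow> (f a, f b) \<in> F"
  shows "(f x, f y) \<in> F ^^ n"
  using assms(1)
proof (induction n arbitrary: y)
  case (Suc n)
  then show ?case using assms(2) by (auto intro: relpow_Suc_I)
qed simp

lemma induced_paths_shortest_embedding:
  assumes "embedding f A B" "simple_graph A" "induced_paths_shortest (parcs B)"
  shows "induced_paths_shortest (parcs A)"
  unfolding induced_paths_shortest_def
proof (intro allI impI)
  fix p k n
  assume p: "induced_path (parcs A) p k" and w: "(p 0, p k) \<in> parcs A ^^ n"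
  show "k \<le> n"
  proof (cases "k = 0")
    case False
    note a = simple_graphD[OF assms(2)] and f = embeddingD[OF assms(1)]
    \<comment> \<open>\<open>induced_path\<close> does not ask its vertices to lie in the graph; for
      \<open>k > 0\<close> they do, as ends of arcs.\<close>
    have pV: "p i \<in> pverts A" if "i \<le> k" for i
    proof (cases i)
      case 0
      then have "(p i, p (Suc i)) \<in> parcs A" using p False by (auto simp: induced_path_def)
      then show ?thesis using a(2) by blast
    next
      case (Suc j)
      then have "(p i, p j) \<in> parcs A" using p that by (auto simp: induced_path_def)
      then show ?thesis using a(2) by blast
    qed
    have "induced_path (parcs B) (f \<circ> p) k"
      using p pV f(2,3) unfolding induced_path_def inj_on_def by auto
    moreover have "(f (p 0), f (p k)) \<in> parcs B ^^ n"
      using relpow_map[OF w, of f "parcs B"] a(2,3) f(2) by blast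
    ultimately show ?thesis
      using assms(3) unfolding induced_paths_shortest_def by (metis comp_apply)
  qed simp
qed

lemma induced_paths_shortestD:
  assumes "induced_paths_shortest E" "sym E" "irrefl E" "distinct p" "p \<noteq> []"
    and "\<And>i. Suc i < length p \<Longrightarrow> (p ! i, p ! Suc i) \<in> E"
    and "\<And>i j. Suc i < j \<Longrightarrow> j < length p \<Longrightarrow> (p ! i, p ! j) \<notin> E"
    and "(hd p, last p) \<in> E ^^ n"
  shows "length p \<le> Suc n"
proof -
  have "(p ! i, p ! j) \<in> E \<longleftrightarrow> i = Suc j \<or> j = Suc i" if "i < length p" "j < length p" for i j
  proof -
    have s: "(a, b) \<in> E \<longleftrightarrow> (b, a) \<in> E" for a b using assms(2) by (auto simp: sym_def)
    consider "i = j" | "Suc i < j" | "Suc j < i" | "i = Suc j" | "j = Suc i" by linarith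
    then show ?thesis
    proof cases
      case 1
      then show ?thesis using assms(3) by (auto simp: irrefl_def)
    next
      case 3
      then show ?thesis using assms(7)[OF 3] that s by auto
    qed (use assms(6,7) that s in auto)
  qed
  then have "induced_path E ((!) p) (length p - 1)"
    using assms(4,5) unfolding induced_path_def
    by (auto simp: inj_on_nth le_less_trans less_Suc_eq_le[symmetric])
  moreover have "hd p = p ! 0" "last p = p ! (length p - 1)"
    using assms(5) by (simp_all add: hd_conv_nth last_conv_nth)
  ultimately have "length p - 1 \<le> n"
    using assms(1,8) unfolding induced_paths_shortest_def by metis
  then show ?thesis by linarith
qed

section \<open>Splits from modules, pendant vertices and layers\<close>

text \<open>All vertices of \<open>A\<close> have the same neighbours outside, so either none or all
  of them see a given outer vertex. Such a set is a module.\<close>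

lemma is_split_module:
  assumes "simple_graph X" "A \<subseteq> pverts X" "1 < card A" "1 < card (pverts X - A)"
    and "\<And>a a' b. a \<in> A \<Longrightarrow> a' \<in> A \<Longrightarrow> b \<in> pverts X - A \<Longrightarrow> (a, b) \<in> parcs X \<Longrightarrow> (a', b) \<in> parcs X"
  shows "is_split X A (pverts X - A)"
proof -
  note x = simple_graphD[OF assms(1)]
  have "parcs X \<inter> A \<times> (pverts X - A) = neighbours X (pverts X - A) \<times> neighbours X A"
  proof (intro set_eqI iffI)
    fix e assume "e \<in> parcs X \<inter> A \<times> (pverts X - A)"
    then show "e \<in> neighbours X (pverts X - A) \<times> neighbours X A"
      using assms(2) x(4) by (auto simp: neighbours_def)
  next
    fix e assume "e \<in> neighbours X (pverts X - A) \<times> neighbours X A"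
    then obtain a b c where "e = (a, b)" "a \<in> A" "b \<in> pverts X - A" "c \<in> A" "(c, b) \<in> parcs X"
      by (auto simp: neighbours_def)
    then show "e \<in> parcs X \<inter> A \<times> (pverts X - A)" using assms(5) by blast
  qed
  then show ?thesis using assms by (auto simp: is_split_def)
qed

text \<open>All edges leaving \<open>{x, w}\<close> start at \<open>w\<close>, and four vertices
  leave two for the other side.\<close>

lemma is_split_pendant:
  assumes "simple_graph X" "(x, w) \<in> parcs X" "\<And>y. (x, y) \<in> parcs X \<Longrightarrow> y = w" "4 \<le> card (pverts X)"
  shows "is_split X {x, w} (pverts X - {x, w})"
proof -
  note s = simple_graphD[OF assms(1)]
  have V: "x \<in> pverts X" "w \<in> pverts X" "x \<noteq> w" using assms(2) s(2,3,5) by auto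
  have "card (pverts X - {x, w}) = card (pverts X) - card {x, w}"
    using V s(1) by (intro card_Diff_subset) auto
  then have c: "1 < card {x, w}" "1 < card (pverts X - {x, w})" using assms(4) V(3) by auto
  have "parcs X \<inter> {x, w} \<times> (pverts X - {x, w}) =
      neighbours X (pverts X - {x, w}) \<times> neighbours X {x, w}"
  proof (intro set_eqI iffI)
    fix e assume "e \<in> parcs X \<inter> {x, w} \<times> (pverts X - {x, w})"
    then show "e \<in> neighbours X (pverts X - {x, w}) \<times> neighbours X {x, w}"
      using V s(4) by (auto simp: neighbours_def)
  next
    fix e assume "e \<in> neighbours X (pverts X - {x, w}) \<times> neighbours X {x, w}"
    then obtain a b c d where e: "e = (a, b)" "a = x \<or> a = w" "c \<in> pverts X" "c \<noteq> w" "c \<noteq> x"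
      "(c, a) \<in> parcs X" "d = x \<or> d = w" "(d, b) \<in> parcs X" "b \<in> pverts X" "b \<noteq> x" "b \<noteq> w"
      by (auto simp: neighbours_def)
    then have "a = w" "d = w" using assms(3) s(4) by metis+
    then show "e \<in> parcs X \<inter> {x, w} \<times> (pverts X - {x, w})" using e by auto
  qed
  then show ?thesis using V c by (auto simp: is_split_def)
qed

text \<open>
  The lemmas about the neighbourhoods of a vertex in the layer below are due to Bandelt and Mulder.
\<close>

locale rooted_graph =
  fixes X :: "'v pair_pre_digraph" and u :: 'v
  assumes simple: "simple_graph X" and conn: "graph_connected X"
    and ips: "induced_paths_shortest (parcs X)" and root: "u \<in> pverts X"
begin

lemmas sg = simple_graphD[OF simple]

lemma sym_parcs: "sym (parcs X)" and irrefl_parcs: "irrefl (parcs X)"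
  using simple by (auto simp: simple_graph_def)

definition layer :: "'v \<Rightarrow> nat" where
  "layer v = (LEAST n. (u, v) \<in> parcs X ^^ n)"

lemma layer_le: "(u, v) \<in> parcs X ^^ n \<Longrightarrow> layer v \<le> n"
  unfolding layer_def by (rule Least_le)

lemma layer_walk: assumes "v \<in> pverts X" shows "(u, v) \<in> parcs X ^^ layer v"
proof -
  have "\<exists>n. (u, v) \<in> parcs X ^^ n" using conn root assms by (auto simp: rtrancl_power)
  then show ?thesis unfolding layer_def by (rule LeastI_ex)
qed

lemma layer_root [simp]: "layer u = 0"
  using layer_le[of u 0] by simp

lemma layer_0: "v \<in> pverts X \<Longrightarrow> layer v = 0 \<Longrightarrow> v = u"
  using layer_walk[of v] by simp

lemma layer_edge: assumes "(a, b) \<in> parcs X" shows "layer b \<le> Suc (layer a)"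
  using layer_le relpow_Suc_I[OF layer_walk[OF sg(2)[OF assms]] assms] by blast

lemma layer_edge': assumes "(a, b) \<in> parcs X" shows "layer a \<le> Suc (layer b)"
  using layer_edge[OF sg(4)[OF assms]] .

lemma lower_neighbour:
  assumes "v \<in> pverts X" "layer v = Suc n"
  shows "\<exists>w. (w, v) \<in> parcs X \<and> layer w = n"
proof -
  obtain w where w: "(u, w) \<in> parcs X ^^ n" "(w, v) \<in> parcs X"
    using layer_walk[OF assms(1)] assms(2) by (auto elim: relpow_Suc_E)
  then show ?thesis using layer_le[OF w(1)] layer_edge[OF w(2)] assms(2) by force
qed

lemma layer_path:
  assumes "v \<in> pverts X"
  shows "\<exists>p. p (layer v) = v \<and> (\<forall>i<layer v. (p i, p (Suc i)) \<in> parcs X) \<and>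
    (\<forall>i\<le>layer v. layer (p i) = i) \<and> p 0 = u"
  using assms
proof (induction "layer v" arbitrary: v)
  case 0
  then show ?case using layer_0 by (intro exI[of _ "\<lambda>_. u"]) auto
next
  case (Suc n)
  obtain w where w: "(w, v) \<in> parcs X" "layer w = n" using lower_neighbour Suc by metis
  then obtain p where p: "p n = w" "\<forall>i<n. (p i, p (Suc i)) \<in> parcs X" "\<forall>i\<le>n. layer (p i) = i" "p 0 = u"
    using Suc.hyps(1)[of w] sg(2) by blast
  let ?q = "p(Suc n := v)"
  have lv: "layer v = Suc n" using Suc.hyps(2) by simp
  have "?q (layer v) = v \<and> (\<forall>i<layer v. (?q i, ?q (Suc i)) \<in> parcs X) \<and>
    (\<forall>i\<le>layer v. layer (?q i) = i) \<and> ?q 0 = u"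
    unfolding lv using p w lv by (auto simp: less_Suc_eq le_Suc_eq)
  then show ?case by blast
qed

text \<open>Prolonging a shortest path by \<open>x\<close> and \<open>y\<close> gives an induced path, hence a shortest one.\<close>

lemma layer_prolong:
  assumes p: "p l = w" "\<forall>i<l. (p i, p (Suc i)) \<in> parcs X" "\<forall>i\<le>l. layer (p i) = i" "p 0 = u"
    and x: "(w, x) \<in> parcs X" "layer x = Suc l" and y: "(x, y) \<in> parcs X"
    and far: "\<And>i. i \<le> l \<Longrightarrow> (p i, y) \<notin> parcs X \<and> p i \<noteq> y"
  shows "layer y = Suc (Suc l)"
proof -
  define q where "q i = (if i \<le> l then p i else if i = Suc l then x else y)" for i
  have adj: "(q i, q j) \<in> parcs X \<longleftrightarrow> j = Suc i" if "i < j" "j \<le> Suc (Suc l)" for i j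
  proof -
    have "j \<le> l \<or> j = Suc l \<or> j = Suc (Suc l) \<and> i \<le> l \<or> j = Suc (Suc l) \<and> i = Suc l"
      using that by arith
    then consider "j \<le> l" | "j = Suc l" | "j = Suc (Suc l)" "i \<le> l" | "j = Suc (Suc l)" "i = Suc l"
      by blast
    then show ?thesis
    proof cases
      case 1
      have "(p i, p j) \<in> parcs X \<Longrightarrow> j = Suc i" using layer_edge[of "p i" "p j"] p(3) 1 that by auto
      then show ?thesis using 1 that p(2) by (auto simp: q_def)
    next
      case 2
      have "(p i, x) \<in> parcs X \<Longrightarrow> i = l" using layer_edge[of "p i" x] p(3) x 2 that by auto
      then show ?thesis using 2 that p(1) x(1) by (auto simp: q_def)
    qed (use far y in \<open>auto simp: q_def\<close>)
  qed
  have "x \<noteq> y" using y sg(5) by auto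
  moreover have "p i \<noteq> x" if "i \<le> l" for i using p(3) x(2) that by auto
  moreover have "inj_on p {..l}" using p(3) by (metis atMost_iff inj_onI)
  ultimately have "inj_on q {..Suc (Suc l)}"
    using far unfolding inj_on_def q_def by (auto simp: le_Suc_eq)
  moreover have "(q i, q j) \<in> parcs X \<longleftrightarrow> i = Suc j \<or> j = Suc i"
    if "i \<le> Suc (Suc l)" "j \<le> Suc (Suc l)" for i j
  proof -
    consider "i < j" | "i = j" | "j < i" by linarith
    then show ?thesis
    proof cases
      case 3
      have "(q i, q j) \<in> parcs X \<longleftrightarrow> (q j, q i) \<in> parcs X" using sg(4) by blast
      then show ?thesis using adj[OF 3 that(1)] 3 by auto
    qed (use adj[of i j] sg(5) that in auto)
  qed
  ultimately have "induced_path (parcs X) q (Suc (Suc l))" by (simp add: induced_path_def)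
  moreover have "q 0 = u" "q (Suc (Suc l)) = y" using p(4) by (simp_all add: q_def)
  moreover have "(u, y) \<in> parcs X ^^ layer y" using layer_walk sg(3)[OF y] by blast
  ultimately have "Suc (Suc l) \<le> layer y" using ips unfolding induced_paths_shortest_def by metis
  then show ?thesis using layer_edge[OF y] x(2) by linarith
qed

text \<open>Otherwise a shortest path to \<open>w\<close> prolonged by \<open>x\<close> and
  \<open>y\<close> would be induced, and \<open>y\<close> would lie one layer above
  \<open>x\<close>. Used in both directions, adjacent vertices of a layer have the same lower
  neighbours.\<close>

lemma same_layer_edge:
  assumes "(x, y) \<in> parcs X" "layer x = layer y" "(w, x) \<in> parcs X" "layer x = Suc (layer w)"
  shows "(w, y) \<in> parcs X"
proof (rule ccontr)
  assume n: "(w, y) \<notin> parcs X"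
  obtain p where p: "p (layer w) = w" "\<forall>i<layer w. (p i, p (Suc i)) \<in> parcs X"
    "\<forall>i\<le>layer w. layer (p i) = i" "p 0 = u"
    using layer_path[OF sg(2)[OF assms(3)]] by blast
  have "layer y = Suc (Suc (layer w))"
  proof (rule layer_prolong[OF p assms(3,4,1)])
    fix i assume i: "i \<le> layer w"
    have "i = layer w" if "(p i, y) \<in> parcs X" using layer_edge[OF that] p(3) i assms(2,4) by auto
    then show "(p i, y) \<notin> parcs X \<and> p i \<noteq> y" using n p(1,3) i assms(2,4) by auto
  qed
  then show False using assms by simp
qed

text \<open>If \<open>z\<close> is not adjacent to \<open>w'\<close>, neither is \<open>w\<close>,
  by \<open>same_layer_edge\<close>; so the path from the root through \<open>z\<close>,
  \<open>w\<close> and \<open>x\<close> to \<open>w'\<close> is induced and too long for the layer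
  of \<open>w'\<close>.\<close>

lemma lower_twins_below:
  assumes "(w, x) \<in> parcs X" "(w', x) \<in> parcs X" "layer x = Suc (Suc n)"
    "layer w = Suc n" "layer w' = Suc n" "(z, w) \<in> parcs X" "layer z = n"
  shows "(z, w') \<in> parcs X"
proof (rule ccontr)
  assume n: "(z, w') \<notin> parcs X"
  then have ne: "w \<noteq> w'" using assms(6) by auto
  have na: "(w, w') \<notin> parcs X" using same_layer_edge[of w w' z] n assms by auto
  obtain p where p: "p n = z" "\<forall>i<n. (p i, p (Suc i)) \<in> parcs X" "\<forall>i\<le>n. layer (p i) = i" "p 0 = u"
    using layer_path[OF sg(2)[OF assms(6)]] assms(7) by blast
  let ?q = "p(Suc n := w)"
  have "layer w' = Suc (Suc (Suc n))"
  proof (rule layer_prolong[where p = ?q and l = "Suc n", OF _ _ _ _ assms(1,3)])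
    show "?q (Suc n) = w" by simp
    show "\<forall>i<Suc n. (?q i, ?q (Suc i)) \<in> parcs X" using p assms(6) by (auto simp: less_Suc_eq)
    show "\<forall>i\<le>Suc n. layer (?q i) = i" using p assms(4) by (auto simp: le_Suc_eq)
    show "?q 0 = u" using p by simp
    show "(x, w') \<in> parcs X" using assms(2) sg(4) by blast
    fix i assume i: "i \<le> Suc n"
    have "i = n" if "i \<le> n" "(p i, w') \<in> parcs X" using layer_edge[OF that(2)] p(3) that assms(5) by auto
    moreover have "p i \<noteq> w'" if "i \<le> n" using p(3) that assms(5) by auto
    ultimately show "(?q i, w') \<notin> parcs X \<and> ?q i \<noteq> w'" using n na ne p(1) i by (auto simp: le_Suc_eq)
  qed
  then show False using assms(5) by simp
qed

text \<open>A lower neighbour \<open>z\<close> of \<open>t\<close> is also adjacent to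
  \<open>w\<close> and hence to \<open>w'\<close>. Without the claimed edge, \<open>t\<close>,
  \<open>z\<close>, \<open>w'\<close>, \<open>x\<close> is an induced path of length three, whereas
  \<open>t\<close> and \<open>x\<close> have the common neighbour \<open>w\<close>.\<close>

lemma lower_twins_beside:
  assumes "(w, x) \<in> parcs X" "(w', x) \<in> parcs X" "layer x = Suc (Suc n)"
    "layer w = Suc n" "layer w' = Suc n" "(t, w) \<in> parcs X" "layer t = Suc n" "(t, x) \<notin> parcs X"
  shows "(t, w') \<in> parcs X"
proof (rule ccontr)
  assume n: "(t, w') \<notin> parcs X"
  obtain z where z: "(z, t) \<in> parcs X" "layer z = n"
    using lower_neighbour[OF sg(2)[OF assms(6)] assms(7)] by blast
  have zw: "(z, w) \<in> parcs X" using same_layer_edge[OF assms(6) _ z(1)] z(2) assms by simp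
  have zw': "(z, w') \<in> parcs X" by (rule lower_twins_below[OF assms(1-5) zw z(2)])
  have zx: "(z, x) \<notin> parcs X" using layer_edge[of z x] z(2) assms(3) by auto
  have ne: "t \<noteq> w'" using assms(2,8) by auto
  have d: "distinct [t, z, w', x]" using ne assms z(2) by auto
  have "length [t, z, w', x] \<le> Suc 2"
  proof (rule induced_paths_shortestD[OF ips sym_parcs irrefl_parcs d])
    show "(hd [t, z, w', x], last [t, z, w', x]) \<in> parcs X ^^ 2"
      using assms(1,6) by (auto simp: numeral_2_eq_2)
    show "([t, z, w', x] ! i, [t, z, w', x] ! Suc i) \<in> parcs X" if "Suc i < length [t, z, w', x]" for i
      using that z(1) zw' assms(2) sg(4) by (auto simp: less_Suc_eq)
    show "([t, z, w', x] ! i, [t, z, w', x] ! j) \<notin> parcs X"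
      if "Suc i < j" "j < length [t, z, w', x]" for i j
      using that n assms(8) zx by (auto simp: less_Suc_eq)
  qed simp
  then show False by simp
qed

text \<open>If neither lower neighbourhood contained the other, private neighbours \<open>a\<close>
  of \<open>x\<close> and \<open>b\<close> of \<open>y\<close> would give an induced path
  \<open>x\<close>, \<open>a\<close>, \<open>b\<close>, \<open>y\<close>, or one through a common
  lower neighbour \<open>z\<close> of \<open>a\<close> and \<open>b\<close>, although
  \<open>x\<close> and \<open>y\<close> have the common neighbour \<open>w\<close>. The
  cardinalities decide the direction of the inclusion.\<close>

lemma lower_twins_above:
  assumes x: "layer x = Suc (Suc n)" "x \<in> pverts X" and y: "layer y = Suc (Suc n)" "y \<in> pverts X"
    and xy: "(x, y) \<notin> parcs X"
    and w: "(w, x) \<in> parcs X" "(w, y) \<in> parcs X" "layer w = Suc n"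
    and c: "card {a. (a, x) \<in> parcs X \<and> layer a = Suc n} \<le> card {a. (a, y) \<in> parcs X \<and> layer a = Suc n}"
    and a: "(a, x) \<in> parcs X" "layer a = Suc n"
  shows "(a, y) \<in> parcs X"
proof (rule ccontr)
  assume n: "(a, y) \<notin> parcs X"
  let ?W = "\<lambda>x. {a. (a, x) \<in> parcs X \<and> layer a = Suc n}"
  have "finite (?W x)" by (rule finite_subset[OF _ sg(1)]) (auto dest: sg(2))
  then have "\<not> ?W y \<subset> ?W x" using c psubset_card_mono[of "?W x" "?W y"] by linarith
  then obtain b where b: "(b, y) \<in> parcs X" "layer b = Suc n" "(b, x) \<notin> parcs X" using a n by blast
  obtain z where z: "(z, w) \<in> parcs X" "layer z = n"
    using lower_neighbour[OF sg(2)[OF w(1)] w(3)] by blast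
  have za: "(z, a) \<in> parcs X" by (rule lower_twins_below[OF w(1) a(1) x(1) w(3) a(2) z])
  have zb: "(z, b) \<in> parcs X" by (rule lower_twins_below[OF w(2) b(1) y(1) w(3) b(2) z])
  have zx: "(z, x) \<notin> parcs X" "(z, y) \<notin> parcs X"
    using layer_edge[of z x] layer_edge[of z y] z(2) x y by auto
  have ne: "x \<noteq> y" "a \<noteq> b" using a n b by auto
  have walk: "(x, y) \<in> parcs X ^^ 2" using w(1,2) sg(4) by (auto simp: numeral_2_eq_2)
  show False
  proof (cases "(a, b) \<in> parcs X")
    case True
    have d: "distinct [x, a, b, y]" using ne a b x y by auto
    have "length [x, a, b, y] \<le> Suc 2"
    proof (rule induced_paths_shortestD[OF ips sym_parcs irrefl_parcs d])
      show "([x, a, b, y] ! i, [x, a, b, y] ! Suc i) \<in> parcs X" if "Suc i < length [x, a, b, y]" for i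
        using that a(1) True b(1) sg(4) by (auto simp: less_Suc_eq)
      show "([x, a, b, y] ! i, [x, a, b, y] ! j) \<notin> parcs X"
        if "Suc i < j" "j < length [x, a, b, y]" for i j
        using that n b(3) xy sg(4) by (auto simp: less_Suc_eq)
    qed (use walk in auto)
    then show False by simp
  next
    case False
    have d: "distinct [x, a, z, b, y]" using ne a b x y z(2) by auto
    have "length [x, a, z, b, y] \<le> Suc 2"
    proof (rule induced_paths_shortestD[OF ips sym_parcs irrefl_parcs d])
      show "([x, a, z, b, y] ! i, [x, a, z, b, y] ! Suc i) \<in> parcs X" if "Suc i < length [x, a, z, b, y]" for i
        using that a(1) za zb b(1) sg(4) by (auto simp: less_Suc_eq)
      show "([x, a, z, b, y] ! i, [x, a, z, b, y] ! j) \<notin> parcs X"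
        if "Suc i < j" "j < length [x, a, z, b, y]" for i j
        using that n b(3) xy False zx sg(4) by (auto simp: less_Suc_eq)
    qed (use walk in auto)
    then show False by simp
  qed
qed

end

text \<open>
  Let \<open>L\<close> be the last layer around a non-universal vertex. If \<open>L\<close> is not independent, then a
  component of \<open>L\<close> is a module. Otherwise let \<open>W\<close> be a smallest neighbourhood of a vertex of \<open>L\<close>;
  either that vertex is pendant or \<open>W\<close> is a module.
\<close>

lemma induced_paths_shortest_not_prime:
  assumes "simple_graph X" "graph_connected X" "induced_paths_shortest (parcs X)"
    and "4 \<le> card (pverts X)" "\<not> clique_graph X"
  shows "\<not> prime_graph X"
proof -
  obtain u v where uv: "u \<in> pverts X" "v \<in> pverts X" "u \<noteq> v" "(u, v) \<notin> parcs X"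
    using assms(5) by (auto simp: clique_graph_def)
  interpret rooted_graph X u using assms uv by unfold_locales
  define k where "k = Max (layer ` pverts X)"
  have k: "layer x \<le> k" if "x \<in> pverts X" for x
    unfolding k_def using sg(1) that by (intro Max_ge) auto
  \<comment> \<open>A non-neighbour of the root lies in layer 2 or beyond, so the root is not in the
    last layer, nor in the one below it.\<close>
  have "layer v \<noteq> 0" using layer_0 uv by auto
  moreover have "layer v \<noteq> 1" using layer_walk[OF uv(2)] uv(4) by auto
  ultimately have "2 \<le> k" using k[OF uv(2)] by linarith
  then obtain n where kn: "k = Suc (Suc n)" by (metis add_2_eq_Suc le_Suc_ex)
  define L where "L = {x \<in> pverts X. layer x = k}"
  have "k \<in> layer ` pverts X" unfolding k_def using sg(1) uv by (intro Max_in) auto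
  then obtain x0 where x0: "x0 \<in> L" by (auto simp: L_def)
  have "\<exists>V1 V2. is_split X V1 V2"
  proof (cases "\<exists>x\<in>L. \<exists>y\<in>L. (x, y) \<in> parcs X")
    case True
    then obtain x y where xy: "x \<in> L" "y \<in> L" "(x, y) \<in> parcs X" by blast
    \<comment> \<open>The component of \<open>x\<close> in the last layer; by
      \<open>same_layer_edge\<close> all its vertices have the same lower neighbours.\<close>
    define C where "C = {c. (x, c) \<in> (Restr (parcs X) L)\<^sup>*}"
    have C: "c \<in> L \<and> (\<forall>w. layer w = Suc n \<longrightarrow> (w, c) \<in> parcs X \<longleftrightarrow> (w, x) \<in> parcs X)" if "c \<in> C" for c
    proof -
      have "(x, c) \<in> (Restr (parcs X) L)\<^sup>*" using that by (simp add: C_def)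
      then show ?thesis
      proof induction
        case (step b c)
        then have bc: "b \<in> L" "c \<in> L" "(b, c) \<in> parcs X" "(c, b) \<in> parcs X" using sg(4) by auto
        then have "(w, b) \<in> parcs X \<longleftrightarrow> (w, c) \<in> parcs X" if "layer w = Suc n" for w
          using same_layer_edge[of b c w] same_layer_edge[of c b w] kn that by (auto simp: L_def)
        then show ?case using step.IH bc by blast
      qed (use xy in auto)
    qed
    have CV: "C \<subseteq> pverts X" using C by (auto simp: L_def)
    then have fC: "finite C" using sg(1) finite_subset by blast
    have xyC: "x \<in> C" "y \<in> C" using xy by (auto simp: C_def)
    have "x \<noteq> y" using xy sg(5) by auto
    then have c1: "1 < card C" using card_mono[OF fC, of "{x, y}"] xyC by auto
    obtain w where w: "(w, x) \<in> parcs X" "layer w = Suc n"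
      using lower_neighbour[of x] xy kn by (auto simp: L_def)
    have "u \<notin> L" "w \<notin> L" "w \<noteq> u" using w kn by (auto simp: L_def)
    then have "{u, w} \<subseteq> pverts X - C" using C uv(1) sg(2)[OF w(1)] by auto
    then have c2: "1 < card (pverts X - C)"
      using card_mono[of "pverts X - C" "{u, w}"] sg(1) \<open>w \<noteq> u\<close> by auto
    have "is_split X C (pverts X - C)"
    proof (rule is_split_module[OF simple CV c1 c2])
      fix a a' b assume ab: "a \<in> C" "a' \<in> C" "b \<in> pverts X - C" "(a, b) \<in> parcs X"
      have "b \<notin> L"
      proof
        assume "b \<in> L"
        then have "(a, b) \<in> Restr (parcs X) L" using ab C by auto
        then have "b \<in> C" using ab(1) by (auto simp: C_def intro: rtrancl_into_rtrancl)
        then show False using ab by auto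
      qed
      moreover have "layer b \<le> k" using k ab by auto
      moreover have "k \<le> Suc (layer b)" using layer_edge'[OF ab(4)] C[OF ab(1)] by (auto simp: L_def)
      ultimately have "layer b = Suc n" using kn ab(3) by (auto simp: L_def)
      then show "(a', b) \<in> parcs X" using C[OF ab(1)] C[OF ab(2)] ab(4) sg(4) by blast
    qed
    then show ?thesis by blast
  next
    case False
    define W where "W x = {a. (a, x) \<in> parcs X \<and> layer a = Suc n}" for x
    obtain x where x: "x \<in> L" and min: "\<And>y. y \<in> L \<Longrightarrow> card (W x) \<le> card (W y)"
      using ex_has_least_nat[of "\<lambda>x. x \<in> L" x0 "\<lambda>x. card (W x)"] x0 by blast
    have xV: "x \<in> pverts X" "layer x = Suc (Suc n)" using x kn by (auto simp: L_def)
    \<comment> \<open>As the last layer is independent, \<open>W x\<close> is the whole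
      neighbourhood of \<open>x\<close>.\<close>
    have Nx: "(a, x) \<in> parcs X \<longleftrightarrow> a \<in> W x" for a
    proof
      assume a: "(a, x) \<in> parcs X"
      have "a \<notin> L" using False a x by blast
      then have "layer a \<noteq> k" using sg(2)[OF a] by (simp add: L_def)
      then show "a \<in> W x"
        using a k[OF sg(2)[OF a]] layer_edge[OF a] xV kn by (auto simp: W_def)
    qed (simp add: W_def)
    have WV: "W x \<subseteq> pverts X" using sg(2) by (auto simp: W_def)
    then have fW: "finite (W x)" using sg(1) finite_subset by blast
    obtain w where w: "w \<in> W x" using lower_neighbour[OF xV] by (auto simp: W_def)
    show ?thesis
    proof (cases "card (W x) = 1")
      case True
      then have Ww: "W x = {w}" using w by (auto simp: card_1_singleton_iff)
      have "is_split X {x, w} (pverts X - {x, w})"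
        by (rule is_split_pendant[OF simple _ _ assms(4)]) (use Nx Ww sg(4) in auto)
      then show ?thesis by blast
    next
      case False2: False
      have "card (W x) \<noteq> 0" using fW w by auto
      then have c1: "1 < card (W x)" using False2 by linarith
      have "x \<noteq> u" using xV by auto
      moreover have "x \<notin> W x" "u \<notin> W x" using xV by (auto simp: W_def)
      ultimately have c2: "1 < card (pverts X - W x)"
        using card_mono[of "pverts X - W x" "{u, x}"] sg(1) uv(1) xV by auto
      have "is_split X (W x) (pverts X - W x)"
      proof (rule is_split_module[OF simple WV c1 c2])
        fix a a' b assume ab: "a \<in> W x" "a' \<in> W x" "b \<in> pverts X - W x" "(a, b) \<in> parcs X"
        have a: "(a, x) \<in> parcs X" "layer a = Suc n" and a': "(a', x) \<in> parcs X" "layer a' = Suc n"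
          using ab by (auto simp: W_def)
        have ba: "(b, a) \<in> parcs X" using ab(4) sg(4) by blast
        have bx: "(b, x) \<notin> parcs X" using Nx ab(3) by blast
        have "layer b \<le> Suc (Suc n)" "n \<le> layer b"
          using k[of b] ab(3) kn layer_edge[OF ba] a by auto
        then consider "layer b = n" | "layer b = Suc n" | "layer b = Suc (Suc n)" by linarith
        then have "(b, a') \<in> parcs X"
        proof cases
          case 1
          show ?thesis by (rule lower_twins_below[OF a(1) a'(1) xV(2) a(2) a'(2) ba 1])
        next
          case 2
          show ?thesis by (rule lower_twins_beside[OF a(1) a'(1) xV(2) a(2) a'(2) ba 2 bx])
        next
          case 3
          then have bL: "b \<in> L" using ab(3) kn by (simp add: L_def)
          have "(x, b) \<notin> parcs X" using False x bL by blast
          moreover have "b \<in> pverts X" using ab(3) by blast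
          ultimately have "(a', b) \<in> parcs X"
            using lower_twins_above[OF xV(2,1) 3 _ _ a(1) ab(4) a(2) _ a'] min[OF bL]
            by (simp add: W_def)
          then show ?thesis using sg(4) by blast
        qed
        then show "(a', b) \<in> parcs X" using sg(4) by blast
      qed
      then show ?thesis by blast
    qed
  qed
  then show ?thesis by (simp add: prime_graph_def)
qed

text \<open>An incomplete prime graph has at most three vertices by the preceding lemma, and a
  connected incomplete graph on at most three vertices is a star with two leaves.\<close>

lemma node_clique_or_star:
  assumes "simple_graph X" "graph_connected X" "induced_paths_shortest (parcs X)"
    and "prime_graph X \<or> clique_graph X \<or> star_graph X"
  shows "clique_graph X \<or> star_graph X"
proof (rule ccontr)
  assume n: "\<not> ?thesis"
  note s = simple_graphD[OF assms(1)]
  have c: "card (pverts X) \<le> 3"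
    using induced_paths_shortest_not_prime[OF assms(1-3)] n assms(4) by linarith
  obtain a b where ab: "a \<in> pverts X" "b \<in> pverts X" "a \<noteq> b" "(a, b) \<notin> parcs X"
    using n by (auto simp: clique_graph_def)
  have "(a, b) \<in> (parcs X)\<^sup>*" using assms(2) ab by blast
  then obtain w where w: "(a, w) \<in> parcs X" using ab(3) by (auto elim: converse_rtranclE)
  have wV: "w \<in> pverts X" "w \<noteq> a" "w \<noteq> b" using w s(3,5) ab by auto
  have V: "pverts X = {a, b, w}"
    using card_seteq[of "pverts X" "{a, b, w}"] s(1) ab wV c by auto
  have "(b, a) \<in> (parcs X)\<^sup>*" using assms(2) ab by blast
  then obtain w' where w': "(b, w') \<in> parcs X" using ab(3) by (auto elim: converse_rtranclE)
  have "w' \<in> pverts X" "w' \<noteq> b" "w' \<noteq> a" using w' s(3,4,5) ab(4) by metis+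
  then have "w' = w" using V by blast
  then have "parcs X = {w} \<times> (pverts X - {w}) \<union> (pverts X - {w}) \<times> {w}"
  proof (intro equalityI subrelI)
    fix x y assume e: "(x, y) \<in> parcs X"
    then have "x \<in> {a, b, w}" "y \<in> {a, b, w}" "x \<noteq> y" using V s(2,3,5) by blast+
    moreover have "(b, a) \<notin> parcs X" using ab(4) s(4) by blast
    ultimately show "(x, y) \<in> {w} \<times> (pverts X - {w}) \<union> (pverts X - {w}) \<times> {w}"
      unfolding V using e ab(4) by blast
  next
    fix x y assume "(x, y) \<in> {w} \<times> (pverts X - {w}) \<union> (pverts X - {w}) \<times> {w}"
    then have "(x, y) \<in> {(w, a), (w, b), (a, w), (b, w)}" unfolding V by blast
    then show "(x, y) \<in> parcs X" using w w' s(4) \<open>w' = w\<close> by blast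
  qed
  then show False using n wV by (auto simp: star_graph_def)
qed


section \<open>Asteroidal triples from three branches\<close>

text \<open>The tree is connected: if there were a last glueing, its marker would lie in the part of
  \<open>X\<close>, which is \<open>X\<close> itself by induction, and also in a node of the other
  part.\<close>

lemma decomposes_isolated:
  assumes "decomposes D H" "X \<in> D" "\<And>Y. Y \<in> D \<Longrightarrow> Y \<noteq> X \<Longrightarrow> pverts X \<inter> pverts Y = {}"
  shows "D = {X} \<and> H = X"
  using assms
proof (induction rule: decomposes.induct)
  case (glue D1 H1 D2 H2 m)
  have False if d: "decomposes Da Ha" "decomposes Db Hb" "m \<in> pverts Ha" "m \<in> pverts Hb"
    and i: "all_verts Da \<inter> all_verts Db = {m}"
    and X: "X \<in> Da" and IH: "Da = {X} \<and> Ha = X" and iso: "\<And>Y. Y \<in> Db \<Longrightarrow> Y \<noteq> X \<Longrightarrow> pverts X \<inter> pverts Y = {}"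
    for Da Ha Db Hb
  proof -
    have "m \<in> pverts X" using d IH by simp
    moreover obtain Y where Y: "Y \<in> Db" "m \<in> pverts Y"
      using decomposesD(3)[OF d(2)] d(4) by (auto elim: all_vertsE)
    moreover have "X \<notin> Db"
      using node_graph_not_in[of X Db m] decomposesD(6)[OF d(1) X] i IH by auto
    ultimately show False using iso[OF Y(1)] by auto
  qed
  note F = this
  show ?case
  proof (cases "X \<in> D1")
    case True
    then show ?thesis
      using F[OF glue.hyps(1-5) True] glue.IH(1)[OF True] glue.prems(2) by blast
  next
    case False
    then have t: "X \<in> D2" using glue.prems by blast
    have "all_verts D2 \<inter> all_verts D1 = {m}" using glue.hyps(5) by blast
    then show ?thesis
      using F[OF glue.hyps(2,1,4,3) _ t] glue.IH(2)[OF t] glue.prems(2) by blast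
  qed
qed simp

lemma edge_splitD:
  assumes "edge_split D H m X Y D1 D2 H1 H2"
  shows "D = D1 \<union> D2" "X \<in> D1" "Y \<in> D2" "decomposes D1 H1" "decomposes D2 H2"
    "m \<in> pverts H1" "m \<in> pverts H2" "all_verts D1 \<inter> all_verts D2 = {m}" "m \<in> range Inr"
    "H = join m H1 H2" "pverts H1 \<inter> pverts H2 = {m}" "D1 \<inter> D2 = {}"
proof -
  show s: "D = D1 \<union> D2" "X \<in> D1" "Y \<in> D2" "decomposes D1 H1" "decomposes D2 H2"
    "m \<in> pverts H1" "m \<in> pverts H2" "all_verts D1 \<inter> all_verts D2 = {m}" "m \<in> range Inr"
    "H = join m H1 H2"
    using assms by (auto simp: edge_split_def)
  show "pverts H1 \<inter> pverts H2 = {m}"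
    using decomposesD(3)[OF s(4)] decomposesD(3)[OF s(5)] s(6-8) by blast
  have "Z \<notin> D2" if "Z \<in> D1" for Z
  proof (rule node_graph_not_in[of _ _ m])
    show "node_graph Z" using decomposesD(6)[OF s(4) that] .
    have "pverts Z \<subseteq> all_verts D1" using that by auto
    then show "pverts Z \<inter> all_verts D2 \<subseteq> {m}" using s(8) by blast
  qed
  then show "D1 \<inter> D2 = {}" by blast
qed

definition star_at :: "'v \<Rightarrow> 'v pair_pre_digraph \<Rightarrow> bool" where
  "star_at c X \<longleftrightarrow> c \<in> pverts X \<and> parcs X = {c} \<times> (pverts X - {c}) \<union> (pverts X - {c}) \<times> {c}"

lemma star_graph_iff: "star_graph X \<longleftrightarrow> (\<exists>c. star_at c X)"
  by (auto simp: star_graph_def star_at_def)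

lemma clique_graph_universal:
  assumes "clique_graph X" "m \<in> pverts X" shows "universal_vertex X m"
  unfolding universal_vertex_def
proof (intro conjI ballI)
  fix u assume "u \<in> pverts X - {m}"
  then have "u \<in> pverts X" "m \<noteq> u" by auto
  then show "(m, u) \<in> parcs X" using assms by (simp add: clique_graph_def)
qed (rule assms(2))

text \<open>With a third vertex, two leaves are not adjacent; on two vertices both ends would be
  centres. So a star attached at a universal vertex is attached at its centre.\<close>

lemma star_at_universal:
  assumes "star_at c X" "3 \<le> card (pverts X)"
  shows "universal_vertex X m \<longleftrightarrow> m = c"
proof
  assume m: "universal_vertex X m"
  show "m = c"
  proof (rule ccontr)
    assume "m \<noteq> c"
    have "\<not> pverts X \<subseteq> {m, c}"
      using assms(2) card_mono[of "{m, c}" "pverts X"] by (auto simp: card_insert_if split: if_splits)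
    then obtain v where "v \<in> pverts X" "v \<noteq> m" "v \<noteq> c" by blast
    then show False
      using m assms(1) \<open>m \<noteq> c\<close> by (auto simp: universal_vertex_def star_at_def)
  qed
qed (use assms in \<open>auto simp: universal_vertex_def star_at_def\<close>)

lemma node_graph_third:
  assumes "node_graph X" shows "\<exists>v\<in>pverts X. v \<noteq> a \<and> v \<noteq> b"
proof (rule ccontr)
  assume "\<not> ?thesis"
  then have "pverts X \<subseteq> {a, b}" by blast
  then have "card (pverts X) \<le> card {a, b}" by (intro card_mono) auto
  also have "\<dots> \<le> 2" by (auto simp: card_insert_if)
  finally show False using assms by (simp add: node_graph_def)
qed

section \<open>Asteroidal triples via reachability\<close>

definition away_from :: "'v pair_pre_digraph \<Rightarrow> 'v \<Rightarrow> 'v set" where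
  "away_from G z = {v \<in> pverts G. v \<noteq> z \<and> (v, z) \<notin> parcs G}"

text \<open>Reachability replaces paths, since a walk shortened to a path stays in the same set. The
  condition on \<open>x\<close> covers the empty walk, which the reflexive closure admits
  everywhere.\<close>

definition linked_away :: "'v pair_pre_digraph \<Rightarrow> 'v \<Rightarrow> 'v \<Rightarrow> 'v \<Rightarrow> bool" where
  "linked_away G x y z \<longleftrightarrow> x \<in> away_from G z \<and> (x, y) \<in> (Restr (parcs G) (away_from G z))\<^sup>*"

definition has_AT :: "'v pair_pre_digraph \<Rightarrow> bool" where
  "has_AT G \<longleftrightarrow> (\<exists>x y z. linked_away G x y z \<and> linked_away G y z x \<and> linked_away G x z y)"

lemma has_AT_embedding:
  assumes "embedding f A B" "has_AT A"
  shows "has_AT B"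
proof -
  obtain x y z where xyz: "linked_away A x y z" "linked_away A y z x" "linked_away A x z y"
    using assms(2) by (auto simp: has_AT_def)
  have V: "x \<in> pverts A" "y \<in> pverts A" "z \<in> pverts A"
    using xyz by (auto simp: linked_away_def away_from_def elim: rtranclE)
  have away: "f v \<in> away_from B (f c)" if "v \<in> away_from A c" "c \<in> pverts A" for v c
    using that embeddingD[OF assms(1)] by (auto simp: away_from_def)
  have "linked_away B (f a) (f b) (f c)" if l: "linked_away A a b c" and c: "c \<in> pverts A" for a b c
  proof -
    have "(a, b) \<in> (Restr (parcs A) (away_from A c))\<^sup>*" using l by (simp add: linked_away_def)
    then have "(f a, f b) \<in> (Restr (parcs B) (away_from B (f c)))\<^sup>*"
    proof induction
      case (step b b')
      then have "(f b, f b') \<in> parcs B"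
        using embeddingD(2)[OF assms(1)] by (auto simp: away_from_def)
      then have "(f b, f b') \<in> Restr (parcs B) (away_from B (f c))"
        using step.hyps(2) away[OF _ c] by auto
      then show ?case using step.IH by (rule rtrancl_into_rtrancl[rotated])
    qed simp
    then show ?thesis using l away[OF _ c] by (auto simp: linked_away_def)
  qed
  then show ?thesis using xyz V unfolding has_AT_def by blast
qed

text \<open>Seen from \<open>A\<close>, a neighbour of \<open>m\<close> in \<open>L\<close> behaves
  like \<open>m\<close> itself, and every other vertex of \<open>L\<close> is invisible. In
  \<open>three_branches_AT\<close> these rules are composed over three nested cuts.\<close>

lemma branch_adjacency:
  assumes "simple_graph A" "simple_graph L" "pverts A \<inter> pverts L = {m}"
  defines "H \<equiv> join m A L"
  shows "v \<in> pverts A \<Longrightarrow> v \<noteq> m \<Longrightarrow> (m, y) \<in> parcs L \<Longrightarrow> (v, y) \<in> parcs H \<longleftrightarrow> (v, m) \<in> parcs A"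
    and "v \<in> pverts A \<Longrightarrow> v \<noteq> m \<Longrightarrow> z \<in> pverts L \<Longrightarrow> z \<noteq> m \<Longrightarrow> (m, z) \<notin> parcs L \<Longrightarrow> (v, z) \<notin> parcs H"
    and "u \<in> pverts A \<Longrightarrow> v \<in> pverts A \<Longrightarrow> u \<noteq> m \<Longrightarrow> v \<noteq> m \<Longrightarrow> (u, v) \<in> parcs H \<longleftrightarrow> (u, v) \<in> parcs A"
    and "y \<in> pverts L \<Longrightarrow> z \<in> pverts L \<Longrightarrow> y \<noteq> m \<Longrightarrow> z \<noteq> m \<Longrightarrow> (y, z) \<in> parcs H \<longleftrightarrow> (y, z) \<in> parcs L"
    and "y \<in> pverts L \<Longrightarrow> y \<noteq> m \<Longrightarrow> y \<in> pverts H \<and> y \<notin> pverts A"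
proof -
  note s = simple_graphD[OF assms(2)]
  show "v \<in> pverts A \<Longrightarrow> v \<noteq> m \<Longrightarrow> (m, y) \<in> parcs L \<Longrightarrow> (v, y) \<in> parcs H \<longleftrightarrow> (v, m) \<in> parcs A"
    using parcs_join_cross(1)[OF assms(1-3), of v y] s(3,5) by (metis H_def)
  show "v \<in> pverts A \<Longrightarrow> v \<noteq> m \<Longrightarrow> z \<in> pverts L \<Longrightarrow> z \<noteq> m \<Longrightarrow> (m, z) \<notin> parcs L \<Longrightarrow> (v, z) \<notin> parcs H"
    using parcs_join_cross(1)[OF assms(1-3), of v z] by (simp add: H_def)
  show "u \<in> pverts A \<Longrightarrow> v \<in> pverts A \<Longrightarrow> u \<noteq> m \<Longrightarrow> v \<noteq> m \<Longrightarrow> (u, v) \<in> parcs H \<longleftrightarrow> (u, v) \<in> parcs A"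
    using parcs_join_left[OF assms(1-3)] by (simp add: H_def)
  show "y \<in> pverts L \<Longrightarrow> z \<in> pverts L \<Longrightarrow> y \<noteq> m \<Longrightarrow> z \<noteq> m \<Longrightarrow> (y, z) \<in> parcs H \<longleftrightarrow> (y, z) \<in> parcs L"
    using parcs_join_right[OF assms(1-3)] by (simp add: H_def)
  show "y \<in> pverts L \<Longrightarrow> y \<noteq> m \<Longrightarrow> y \<in> pverts H \<and> y \<notin> pverts A"
    using assms(3) by (auto simp: H_def)
qed

section \<open>Branches of a pruned decomposition\<close>

text \<open>\<open>reduced\<close> is the trace of the coarseness of the standard decomposition.
  \<open>not_prunable\<close> says, without reference to the tree, that a node attached at a
  universal vertex is not a leaf.\<close>

locale pruned_nodes =
  fixes P :: "'a node set"
  assumes clique_or_star: "X \<in> P \<Longrightarrow> clique_graph X \<or> (\<exists>c. star_at c X)"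
    and reduced: "X \<in> P \<Longrightarrow> Y \<in> P \<Longrightarrow> X \<noteq> Y \<Longrightarrow> m \<in> pverts X \<Longrightarrow> m \<in> pverts Y \<Longrightarrow>
      star_at m X \<Longrightarrow> star_at c Y \<Longrightarrow> c = m"
    and not_prunable: "X \<in> P \<Longrightarrow> Y \<in> P \<Longrightarrow> X \<noteq> Y \<Longrightarrow> m \<in> pverts X \<Longrightarrow> m \<in> pverts Y \<Longrightarrow>
      universal_vertex X m \<Longrightarrow> \<exists>a\<in>pverts X. a \<noteq> m \<and> (\<exists>Z\<in>P. Z \<noteq> X \<and> a \<in> pverts Z)"
begin

text \<open>\<open>S\<close> collects the markers of \<open>X\<close> at which branches have been
  cut off already. The cut at \<open>m\<close> adds \<open>m\<close> to it on the side of
  \<open>X\<close>, while the branch behind \<open>m\<close> is attached to the rest at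
  \<open>m\<close> alone.\<close>

lemma cut_branch:
  assumes D: "decomposes D K" "D \<subseteq> P" "X \<in> D" and S: "all_verts D \<inter> all_verts (P - D) \<subseteq> S" "S \<subseteq> pverts X"
    and m: "m \<in> pverts X" "m \<notin> S" "Y \<in> P" "Y \<noteq> X" "m \<in> pverts Y"
  shows "\<exists>D1 D2 K1 K2. edge_split D K m X Y D1 D2 K1 K2 \<and> D1 \<subseteq> P \<and> D2 \<subseteq> P \<and>
    all_verts D1 \<inter> all_verts (P - D1) \<subseteq> insert m S \<and> all_verts D2 \<inter> all_verts (P - D2) \<subseteq> {m} \<and>
    (\<forall>v \<in> pverts X \<inter> pverts K. v \<noteq> m \<longrightarrow> v \<in> pverts K1)"
proof -
  have "Y \<in> D"
  proof (rule ccontr)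
    assume "Y \<notin> D"
    then have "m \<in> all_verts (P - D)" using m(3,5) by (intro all_vertsI) auto
    moreover have "m \<in> all_verts D" using D(3) m(1) by auto
    ultimately show False using S m(2) by blast
  qed
  then obtain D1 D2 K1 K2 where e: "edge_split D K m X Y D1 D2 K1 K2"
    using edge_split_exists[OF D(1,3)] m by metis
  note e' = edge_splitD[OF e]
  have X1: "pverts X \<subseteq> all_verts D1" using e'(2) by auto
  have out: "v \<in> S \<or> v \<in> all_verts (D - D')" if v: "v \<in> all_verts (P - D')" "v \<in> all_verts D'" "D' \<subseteq> D" for v D'
  proof -
    obtain Z where Z: "Z \<in> P" "Z \<notin> D'" "v \<in> pverts Z" using v(1) by (auto elim: all_vertsE)
    show ?thesis
    proof (cases "Z \<in> D")
      case True
      then show ?thesis using Z by auto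
    next
      case False
      then have "v \<in> all_verts (P - D)" using Z by auto
      moreover have "v \<in> all_verts D" using v(2,3) all_verts_mono by blast
      ultimately show ?thesis using S(1) by blast
    qed
  qed
  have d: "D - D1 = D2" "D - D2 = D1" using e'(1,12) by auto
  have "all_verts D1 \<inter> all_verts (P - D1) \<subseteq> insert m S"
    using out[of _ D1] d e'(1,8) by auto
  moreover have "all_verts D2 \<inter> all_verts (P - D2) \<subseteq> {m}"
  proof
    fix v assume v: "v \<in> all_verts D2 \<inter> all_verts (P - D2)"
    then have "v \<in> S \<or> v \<in> all_verts D1" using out[of v D2] d e'(1) by auto
    then have "v \<in> all_verts D1" using S(2) X1 by blast
    then show "v \<in> {m}" using e'(8) v by blast
  qed
  moreover have "\<forall>v \<in> pverts X \<inter> pverts K. v \<noteq> m \<longrightarrow> v \<in> pverts K1"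
  proof (intro ballI impI)
    fix v assume v: "v \<in> pverts X \<inter> pverts K" "v \<noteq> m"
    then have "v \<in> all_verts D1" using X1 by blast
    then have "v \<notin> pverts K2" using e'(8) v(2) decomposesD(3)[OF e'(5)] by blast
    then show "v \<in> pverts K1" using v e'(10) by auto
  qed
  moreover have "D1 \<subseteq> P" "D2 \<subseteq> P" using e'(1) D(2) by auto
  ultimately show ?thesis using e by blast
qed

text \<open>If the node at \<open>m\<close> has no other marker, it is not prunable and so a star
  with \<open>m\<close> as a leaf; another leaf is at distance two. Otherwise the induction
  hypothesis applies behind a second marker \<open>a\<close>: a neighbour \<open>y\<close> of
  \<open>a\<close> there stands for \<open>a\<close>, and \<open>z\<close> or, if \<open>m\<close>
  and \<open>a\<close> are two leaves of a star, \<open>y\<close> itself is at distance two from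
  \<open>m\<close>.\<close>

lemma branch_not_universal:
  assumes "decomposes D K" "D \<subseteq> P" "all_verts D \<inter> all_verts (P - D) \<subseteq> {m}" "m \<in> pverts K"
    and "m \<in> all_verts (P - D)"
  shows "\<exists>y z. (m, y) \<in> parcs K \<and> (y, z) \<in> parcs K \<and> z \<noteq> m \<and> (m, z) \<notin> parcs K"
  using assms
proof (induction "card D" arbitrary: D K m rule: less_induct)
  case less
  obtain X where X: "X \<in> D" "m \<in> pverts X"
    using decomposesD(3)[OF less.prems(1)] less.prems(4) by (auto elim: all_vertsE)
  obtain X' where X': "X' \<in> P" "X' \<notin> D" "m \<in> pverts X'" using less.prems(5) by (auto elim: all_vertsE)
  have XP: "X \<in> P" "X \<noteq> X'" using X X' less.prems(2) by auto
  note nX = decomposesD(6)[OF less.prems(1) X(1)]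
  have sX: "simple_graph X" using nX by (simp add: node_graph_def)
  show ?case
  proof (cases "\<exists>a\<in>pverts X. a \<noteq> m \<and> (\<exists>Z\<in>P. Z \<noteq> X \<and> a \<in> pverts Z)")
    case False
    have "D = {X} \<and> K = X"
    proof (rule decomposes_isolated[OF less.prems(1) X(1)])
      fix Y assume Y: "Y \<in> D" "Y \<noteq> X"
      have "m \<notin> pverts Y" using decomposes_unique[OF less.prems(1,4) Y(1) X(1) _ X(2)] Y(2) by blast
      show "pverts X \<inter> pverts Y = {}"
      proof (rule equals0I)
        fix v assume "v \<in> pverts X \<inter> pverts Y"
        moreover from this have "v \<noteq> m" using \<open>m \<notin> pverts Y\<close> by blast
        ultimately show False using False Y less.prems(2) by blast
      qed
    qed
    then have K: "K = X" by simp
    have nu: "\<not> universal_vertex X m" using not_prunable[OF XP(1) X'(1) XP(2) X(2) X'(3)] False by blast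
    then have "\<not> clique_graph X" using clique_graph_universal X(2) by metis
    then obtain c where c: "star_at c X" using clique_or_star[OF XP(1)] by auto
    have "c \<noteq> m" using nu star_at_universal[OF c] nX by (auto simp: node_graph_def)
    obtain z where z: "z \<in> pverts X" "z \<noteq> c" "z \<noteq> m" using node_graph_third[OF nX] by metis
    have "(m, c) \<in> parcs X" "(c, z) \<in> parcs X" "(m, z) \<notin> parcs X"
      using c \<open>c \<noteq> m\<close> z X(2) by (auto simp: star_at_def)
    then show ?thesis using K z by blast
  next
    case True
    then obtain a Y where a: "a \<in> pverts X" "a \<noteq> m" and Y: "Y \<in> P" "Y \<noteq> X" "a \<in> pverts Y" by blast
    obtain D1 D2 K1 K2 where e: "edge_split D K a X Y D1 D2 K1 K2" and D2: "D2 \<subseteq> P"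
      "all_verts D2 \<inter> all_verts (P - D2) \<subseteq> {a}"
      and keep: "\<forall>v \<in> pverts X \<inter> pverts K. v \<noteq> a \<longrightarrow> v \<in> pverts K1"
      using cut_branch[OF less.prems(1,2) X(1) less.prems(3) _ a(1) _ Y] X(2) a(2) by auto
    note e' = edge_splitD[OF e]
    have "D2 \<subset> D" using e'(1,2,12) by blast
    then have "card D2 < card D" using decomposesD(4)[OF less.prems(1)] by (simp add: psubset_card_mono)
    moreover have "a \<in> all_verts (P - D2)"
      by (rule all_vertsI[of X]) (use e'(2,12) XP(1) a(1) in auto)
    ultimately obtain y z where yz: "(a, y) \<in> parcs K2" "(y, z) \<in> parcs K2" "z \<noteq> a" "(a, z) \<notin> parcs K2"
      using less.hyps e'(5,7) D2 by metis
    note s1 = decomposesD(2)[OF e'(4)] and s2 = decomposesD(2)[OF e'(5)]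
    note s1' = simple_graphD[OF s1] and s2' = simple_graphD[OF s2]
    have yzV: "y \<in> pverts K2" "z \<in> pverts K2" "y \<noteq> a" using yz s2' by auto
    have m1: "m \<in> pverts K1" using keep X(2) less.prems(4) a(2) by auto
    obtain f where f: "embedding f X K1" "\<forall>v\<in>pverts X \<inter> pverts K1. f v = v"
      using decomposes_node_embedding[OF e'(4,2)] by blast
    have fm: "f m = m" "f a = a" using f(2) m1 X(2) a(1) e'(6) by auto
    have ma: "(m, a) \<in> parcs K1 \<longleftrightarrow> (m, a) \<in> parcs X"
      using embeddingD(2)[OF f(1) X(2) a(1)] fm by simp
    note br = branch_adjacency[OF s1 s2 e'(11), folded e'(10)]
    show ?thesis
    proof (cases "(m, a) \<in> parcs X")
      case True
      have "(m, y) \<in> parcs K" using br(1)[OF m1 a(2)[symmetric] yz(1)] ma True by simp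
      moreover have "(m, z) \<notin> parcs K" using br(2)[OF m1 a(2)[symmetric] yzV(2) yz(3,4)] .
      moreover have "(y, z) \<in> parcs K" using br(4)[OF yzV(1,2,3) yz(3)] yz(2) by simp
      moreover have "z \<noteq> m" using br(5)[OF yzV(2) yz(3)] m1 by auto
      ultimately show ?thesis by blast
    next
      case False
      then have "\<not> clique_graph X" using X(2) a unfolding clique_graph_def by metis
      then obtain c where c: "star_at c X" using clique_or_star[OF XP(1)] by auto
      have cc: "c \<noteq> m" "c \<noteq> a" "c \<in> pverts X" "(m, c) \<in> parcs X" "(c, a) \<in> parcs X"
        using c False X(2) a by (auto simp: star_at_def)
      have fc: "(m, f c) \<in> parcs K1" "(f c, a) \<in> parcs K1" "f c \<noteq> a" "f c \<in> pverts K1"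
        using embeddingD[OF f(1)] cc X(2) a(1) fm by metis+
      have "(m, f c) \<in> parcs K" using br(3)[OF m1 fc(4) a(2)[symmetric] fc(3)] fc(1) by simp
      moreover have "(f c, y) \<in> parcs K" using br(1)[OF fc(4,3) yz(1)] fc(2) by simp
      moreover have "(m, y) \<notin> parcs K" using br(1)[OF m1 a(2)[symmetric] yz(1)] ma False by simp
      moreover have "y \<noteq> m" using br(5)[OF yzV(1,3)] m1 by auto
      ultimately show ?thesis by blast
    qed
  qed
qed

text \<open>Here the other branches at \<open>X\<close> can be connected only through neighbours of
  \<open>m\<close> in this one, so a neighbour \<open>y'\<close> of \<open>m\<close> away from
  \<open>z\<close> is wanted. By \<open>reduced\<close>, \<open>m\<close> is universal in
  \<open>Y\<close>; so \<open>Y\<close> is no leaf of the tree, \<open>z\<close> is found behind a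
  second marker \<open>a\<close>, and \<open>y'\<close> comes from a third vertex of
  \<open>Y\<close>.\<close>

lemma branch_below_centre:
  assumes "decomposes D K" "D \<subseteq> P" "all_verts D \<inter> all_verts (P - D) \<subseteq> {m}" "m \<in> pverts K"
    and X: "X \<in> P" "X \<notin> D" "m \<in> pverts X" "star_at m X" and Y: "Y \<in> D" "m \<in> pverts Y"
  shows "\<exists>y z y'. (m, y) \<in> parcs K \<and> (y, z) \<in> parcs K \<and> z \<noteq> m \<and> (m, z) \<notin> parcs K \<and>
    (m, y') \<in> parcs K \<and> (y', z) \<notin> parcs K \<and> y' \<noteq> z"
proof -
  have YP: "Y \<in> P" "X \<noteq> Y" using Y X assms(2) by auto
  note nY = decomposesD(6)[OF assms(1) Y(1)]
  have u: "(m, v) \<in> parcs Y" if "v \<in> pverts Y" "v \<noteq> m" for v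
    using clique_or_star[OF YP(1)]
  proof
    assume "clique_graph Y"
    then show ?thesis using that Y(2) by (simp add: clique_graph_def)
  next
    assume "\<exists>c. star_at c Y"
    then obtain c where c: "star_at c Y" by auto
    then have "c = m" using reduced[OF X(1) YP(1,2) X(3) Y(2) X(4)] by blast
    then show ?thesis using c that by (simp add: star_at_def)
  qed
  then have "universal_vertex Y m" using Y(2) by (auto simp: universal_vertex_def)
  then obtain a Z where a: "a \<in> pverts Y" "a \<noteq> m" and Z: "Z \<in> P" "Z \<noteq> Y" "a \<in> pverts Z"
    using not_prunable[OF YP(1) X(1) YP(2)[symmetric] Y(2) X(3)] by blast
  obtain D1 D2 K1 K2 where e: "edge_split D K a Y Z D1 D2 K1 K2" and D2: "D2 \<subseteq> P"
    "all_verts D2 \<inter> all_verts (P - D2) \<subseteq> {a}"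
    and keep: "\<forall>v \<in> pverts Y \<inter> pverts K. v \<noteq> a \<longrightarrow> v \<in> pverts K1"
    using cut_branch[OF assms(1,2) Y(1) assms(3) _ a(1) _ Z] Y(2) a(2) by auto
  note e' = edge_splitD[OF e]
  have "a \<in> all_verts (P - D2)"
    by (rule all_vertsI[of Y]) (use e'(2,12) YP(1) a(1) in auto)
  then obtain y z where yz: "(a, y) \<in> parcs K2" "(y, z) \<in> parcs K2" "z \<noteq> a" "(a, z) \<notin> parcs K2"
    using branch_not_universal[OF e'(5) D2 e'(7)] by blast
  note s1 = decomposesD(2)[OF e'(4)] and s2 = decomposesD(2)[OF e'(5)]
  have yzV: "y \<in> pverts K2" "z \<in> pverts K2" "y \<noteq> a" using yz simple_graphD[OF s2] by auto
  have m1: "m \<in> pverts K1" using keep Y(2) assms(4) a(2) by auto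
  obtain f where f: "embedding f Y K1" "\<forall>v\<in>pverts Y \<inter> pverts K1. f v = v"
    using decomposes_node_embedding[OF e'(4,2)] by blast
  have fm: "f m = m" "f a = a" using f(2) m1 Y(2) a(1) e'(6) by auto
  obtain b where b: "b \<in> pverts Y" "b \<noteq> m" "b \<noteq> a" using node_graph_third[OF nY] by metis
  note br = branch_adjacency[OF s1 s2 e'(11), folded e'(10)]
  have fb: "(m, f b) \<in> parcs K1" "f b \<noteq> a" "f b \<in> pverts K1"
    using embeddingD[OF f(1)] b u Y(2) a(1) fm by metis+
  have ma: "(m, a) \<in> parcs K1" using embeddingD(2)[OF f(1) Y(2) a(1)] fm u a by simp
  note am = a(2)[symmetric]
  have "(m, y) \<in> parcs K" using br(1)[OF m1 am yz(1)] ma by simp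
  moreover have "(m, z) \<notin> parcs K" using br(2)[OF m1 am yzV(2) yz(3,4)] .
  moreover have "(y, z) \<in> parcs K" using br(4)[OF yzV(1,2,3) yz(3)] yz(2) by simp
  moreover have "z \<noteq> m" using br(5)[OF yzV(2) yz(3)] m1 by auto
  moreover have "(m, f b) \<in> parcs K" using br(3)[OF m1 fb(3) am fb(2)] fb(1) by simp
  moreover have "(f b, z) \<notin> parcs K" using br(2)[OF fb(3,2) yzV(2) yz(3,4)] .
  moreover have "f b \<noteq> z" using br(5)[OF yzV(2) yz(3)] fb(3) by auto
  ultimately show ?thesis by blast
qed

text \<open>
  Three branches at \<open>X\<close> give an asteroidal triple: in each branch choose a vertex \<open>z\<^sub>i\<close> at
  distance two from its marker. Only if \<open>m1\<close> is the centre of the star \<open>X\<close>, the second vertex \<open>y'\<close>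
  is needed to connect the other two branches.
\<close>

lemma three_branches_AT:
  assumes D: "decomposes P H" and X: "X \<in> P"
    and m: "m1 \<in> pverts X" "m2 \<in> pverts X" "m3 \<in> pverts X" "m1 \<noteq> m2" "m1 \<noteq> m3" "m2 \<noteq> m3"
    and Y1: "Y1 \<in> P" "Y1 \<noteq> X" "m1 \<in> pverts Y1"
    and Y2: "Y2 \<in> P" "Y2 \<noteq> X" "m2 \<in> pverts Y2"
    and Y3: "Y3 \<in> P" "Y3 \<noteq> X" "m3 \<in> pverts Y3"
    and centre: "\<And>c. star_at c X \<Longrightarrow> c \<noteq> m2 \<and> c \<noteq> m3"
  shows "has_AT H"
proof -
  have c1: "all_verts P \<inter> all_verts (P - P) \<subseteq> {}" by simp
  \<comment> \<open>Three nested cuts: \<open>L1\<close>, \<open>L2\<close> and \<open>L3\<close>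
    are the branches, and \<open>C\<close> is what remains around \<open>X\<close>.\<close>
  obtain DA E1 A L1 where e1: "edge_split P H m1 X Y1 DA E1 A L1" "DA \<subseteq> P" "E1 \<subseteq> P"
    "all_verts DA \<inter> all_verts (P - DA) \<subseteq> {m1}" "all_verts E1 \<inter> all_verts (P - E1) \<subseteq> {m1}"
    "\<forall>v\<in>pverts X \<inter> pverts H. v \<noteq> m1 \<longrightarrow> v \<in> pverts A"
    using cut_branch[OF D _ X c1 _ m(1) _ Y1] by auto
  note s1 = edge_splitD[OF e1(1)]
  have "m2 \<notin> {m1}" using m by auto
  then obtain DB E2 B L2 where e2: "edge_split DA A m2 X Y2 DB E2 B L2" "DB \<subseteq> P" "E2 \<subseteq> P"
    "all_verts DB \<inter> all_verts (P - DB) \<subseteq> {m2, m1}" "all_verts E2 \<inter> all_verts (P - E2) \<subseteq> {m2}"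
    "\<forall>v\<in>pverts X \<inter> pverts A. v \<noteq> m2 \<longrightarrow> v \<in> pverts B"
    using cut_branch[OF s1(4) e1(2) s1(2) e1(4) _ m(2) _ Y2] m(1) by auto
  note s2 = edge_splitD[OF e2(1)]
  have "m3 \<notin> {m2, m1}" using m by auto
  then obtain DC E3 C L3 where e3: "edge_split DB B m3 X Y3 DC E3 C L3" "E3 \<subseteq> P"
    "all_verts E3 \<inter> all_verts (P - E3) \<subseteq> {m3}"
    "\<forall>v\<in>pverts X \<inter> pverts B. v \<noteq> m3 \<longrightarrow> v \<in> pverts C"
    using cut_branch[OF s2(4) e2(2) s2(2) e2(4) _ m(3) _ Y3] m(1,2) by auto
  note s3 = edge_splitD[OF e3(1)]
  have mA: "m1 \<in> pverts A" "m1 \<in> pverts B" "m1 \<in> pverts C" "m2 \<in> pverts B" "m2 \<in> pverts C"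
    "m3 \<in> pverts C"
    using s1(6) s2(6) s3(6) e2(6) e3(4) m by auto
  note sA = decomposesD(2)[OF s1(4)] and sB = decomposesD(2)[OF s2(4)] and sC = decomposesD(2)[OF s3(4)]
  note sL1 = decomposesD(2)[OF s1(5)] and sL2 = decomposesD(2)[OF s2(5)] and sL3 = decomposesD(2)[OF s3(5)]
  note bH = branch_adjacency[OF sA sL1 s1(11), folded s1(10)]
  note bA = branch_adjacency[OF sB sL2 s2(11), folded s2(10)]
  note bB = branch_adjacency[OF sC sL3 s3(11), folded s3(10)]
  have XE: "m1 \<in> all_verts (P - E1)" "m2 \<in> all_verts (P - E2)" "m3 \<in> all_verts (P - E3)" "X \<notin> E1"
    using X s1(2,12) s2(2,12) s3(2,12) m by auto
  obtain y2 z2 where 2: "(m2, y2) \<in> parcs L2" "(y2, z2) \<in> parcs L2" "z2 \<noteq> m2" "(m2, z2) \<notin> parcs L2"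
    using branch_not_universal[OF s2(5) e2(3,5) s2(7) XE(2)] by blast
  obtain y3 z3 where 3: "(m3, y3) \<in> parcs L3" "(y3, z3) \<in> parcs L3" "z3 \<noteq> m3" "(m3, z3) \<notin> parcs L3"
    using branch_not_universal[OF s3(5) e3(2,3) s3(7) XE(3)] by blast
  have "\<exists>y z y'. (m1, y) \<in> parcs L1 \<and> (y, z) \<in> parcs L1 \<and> z \<noteq> m1 \<and> (m1, z) \<notin> parcs L1 \<and>
    (m1, y') \<in> parcs L1 \<and> (star_at m1 X \<longrightarrow> (y', z) \<notin> parcs L1 \<and> y' \<noteq> z)"
  proof (cases "star_at m1 X")
    case True
    show ?thesis using branch_below_centre[OF s1(5) e1(3,5) s1(7) X XE(4) m(1) True s1(3) Y1(3)] by blast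
  next
    case False
    then show ?thesis using branch_not_universal[OF s1(5) e1(3,5) s1(7) XE(1)] by blast
  qed
  then obtain y1 z1 y' where 1: "(m1, y1) \<in> parcs L1" "(y1, z1) \<in> parcs L1" "z1 \<noteq> m1"
    "(m1, z1) \<notin> parcs L1" "(m1, y') \<in> parcs L1"
    and y'z: "star_at m1 X \<Longrightarrow> (y', z1) \<notin> parcs L1 \<and> y' \<noteq> z1"
    by blast
  have V1: "y1 \<in> pverts L1" "z1 \<in> pverts L1" "y1 \<noteq> m1" "y' \<in> pverts L1" "y' \<noteq> m1"
    using 1 simple_graphD(3,5)[OF sL1] by metis+
  have V2: "y2 \<in> pverts L2" "z2 \<in> pverts L2" "y2 \<noteq> m2"
    using 2 simple_graphD(3,5)[OF sL2] by metis+
  have V3: "y3 \<in> pverts L3" "z3 \<in> pverts L3" "y3 \<noteq> m3"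
    using 3 simple_graphD(3,5)[OF sL3] by metis+
  have W1: "y1 \<in> pverts H" "z1 \<in> pverts H" "y' \<in> pverts H" "y1 \<notin> pverts A" "z1 \<notin> pverts A" "y' \<notin> pverts A"
    using bH(5) V1 1(3) by auto
  have W2: "y2 \<in> pverts A" "z2 \<in> pverts A" "y2 \<notin> pverts B" "z2 \<notin> pverts B"
    using bA(5) V2 2(3) by auto
  have W3: "y3 \<in> pverts B" "z3 \<in> pverts B" "y3 \<notin> pverts C" "z3 \<notin> pverts C"
    using bB(5) V3 3(3) by auto
  have n: "y2 \<noteq> m1" "z2 \<noteq> m1" "y3 \<noteq> m1" "z3 \<noteq> m1" "y3 \<noteq> m2" "z3 \<noteq> m2"
    using W2 W3 mA by auto
  have W3A: "y3 \<in> pverts A" "z3 \<in> pverts A" using W3 n s2(10) by auto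
  have inH: "v \<in> pverts H" if "v \<in> pverts A" "v \<noteq> m1" for v using that s1(10) by auto
  note symA = simple_graphD(4)[OF sA] and symB = simple_graphD(4)[OF sB]
    and symH = simple_graphD(4)[OF decomposesD(2)[OF D]]
  obtain f where f: "embedding f X C" "\<forall>v\<in>pverts X \<inter> pverts C. f v = v"
    using decomposes_node_embedding[OF s3(4,2)] by blast
  have fm: "f m1 = m1" "f m2 = m2" "f m3 = m3" using f(2) mA m by auto
  have CX: "(m1, m2) \<in> parcs C \<longleftrightarrow> (m1, m2) \<in> parcs X" "(m1, m3) \<in> parcs C \<longleftrightarrow> (m1, m3) \<in> parcs X"
    "(m2, m3) \<in> parcs C \<longleftrightarrow> (m2, m3) \<in> parcs X"
    using embeddingD(2)[OF f(1)] m(1-3) fm by metis+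

  have yz: "(y1, z1) \<in> parcs H" "(y2, z2) \<in> parcs H" "(y3, z3) \<in> parcs H"
  proof -
    show "(y1, z1) \<in> parcs H" using bH(4) V1 1 by auto
    have "(y2, z2) \<in> parcs A" using bA(4) V2 2 by auto
    then show "(y2, z2) \<in> parcs H" using bH(3) W2 n by auto
    have "(y3, z3) \<in> parcs B" using bB(4) V3 3 by auto
    then have "(y3, z3) \<in> parcs A" using bA(3) W3 n by auto
    then show "(y3, z3) \<in> parcs H" using bH(3) W3A n by auto
  qed
  have far1: "(v, z1) \<notin> parcs H" if "v \<in> pverts A" "v \<noteq> m1" for v
    using bH(2)[OF that V1(2) 1(3,4)] .
  have far2: "(v, z2) \<notin> parcs H" if "v \<in> pverts B" "v \<noteq> m2" "v \<noteq> m1" for v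
  proof -
    have "v \<in> pverts A" using that s2(10) by auto
    then show ?thesis using bA(2)[OF that(1,2) V2(2) 2(3,4)] bH(3)[OF _ W2(2) that(3) n(2)] by blast
  qed
  have far3: "(v, z3) \<notin> parcs H" if "v \<in> pverts C" "v \<noteq> m3" "v \<noteq> m2" "v \<noteq> m1" for v
  proof -
    have v: "v \<in> pverts B" "v \<in> pverts A" using that s2(10) s3(10) by auto
    have "(v, z3) \<notin> parcs B" using bB(2)[OF that(1,2) V3(2) 3(3,4)] .
    then show ?thesis
      using bA(3)[OF v(1) W3(2) that(3) n(6)] bH(3)[OF v(2) W3A(2) that(4) n(4)] by blast
  qed
  have f12: "(y1, z2) \<notin> parcs H"
    using bH(1)[OF W2(2) n(2) 1(1)] bA(2)[OF mA(2) m(4) V2(2) 2(3,4)] symA symH by blast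
  have f13: "(y1, z3) \<notin> parcs H"
    using bH(1)[OF W3A(2) n(4) 1(1)] bA(3)[OF W3(2) mA(2) n(6) m(4)]
      bB(2)[OF mA(3) m(5) V3(2) 3(3,4)] symB symH by blast
  have f23: "(y2, z3) \<notin> parcs A"
    using bA(1)[OF W3(2) n(6) 2(1)] bB(2)[OF mA(5) m(6) V3(2) 3(3,4)] symB symA by blast
  then have f23: "(y2, z3) \<notin> parcs H" using bH(3)[OF W2(1) W3A(2) n(1,4)] by blast
  have z12: "(z1, z2) \<notin> parcs H" using far1[OF W2(2) n(2)] symH by blast
  have z13: "(z1, z3) \<notin> parcs H" using far1[OF W3A(2) n(4)] symH by blast
  have z23: "(z2, z3) \<notin> parcs H" using far2[OF W3(2) n(6,4)] symH by blast
  have adj1: "(v, y1) \<in> parcs H \<longleftrightarrow> (v, m1) \<in> parcs A" "(v, y') \<in> parcs H \<longleftrightarrow> (v, m1) \<in> parcs A"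
    if "v \<in> pverts A" "v \<noteq> m1" for v
    using bH(1)[OF that] 1 by blast+
  have y2m: "(y2, m1) \<in> parcs A \<longleftrightarrow> (m1, m2) \<in> parcs X"
    using bA(1)[OF mA(2) m(4) 2(1)] bB(3)[OF mA(3) mA(5) m(5,6)] CX symA by blast
  have y3m: "(y3, m1) \<in> parcs A \<longleftrightarrow> (m1, m3) \<in> parcs X"
    using bA(3)[OF W3(1) mA(2) n(5) m(4)] bB(1)[OF mA(3) m(5) 3(1)] CX symB by blast
  have "(y3, y2) \<in> parcs A \<longleftrightarrow> (m2, m3) \<in> parcs X"
    using bA(1)[OF W3(1) n(5) 2(1)] bB(1)[OF mA(5) m(6) 3(1)] CX symB by blast
  then have y23: "(y2, y3) \<in> parcs H \<longleftrightarrow> (m2, m3) \<in> parcs X"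
    using bH(3)[OF W2(1) W3A(1) n(1,3)] symA by blast
  have y12: "(y1, y2) \<in> parcs H \<longleftrightarrow> (m1, m2) \<in> parcs X"
    using adj1(1)[OF W2(1) n(1)] y2m symH by blast
  have y13: "(y1, y3) \<in> parcs H \<longleftrightarrow> (m1, m3) \<in> parcs X"
    using adj1(1)[OF W3A(1) n(3)] y3m symH by blast
  define F where "F = away_from H"
  have F1: "y2 \<in> F z1" "z2 \<in> F z1" "y3 \<in> F z1" "z3 \<in> F z1"
    using far1[OF W2(1) n(1)] far1[OF W2(2) n(2)] far1[OF W3A(1) n(3)] far1[OF W3A(2) n(4)]
      W2 W3A n inH W1 unfolding F_def away_from_def by auto
  have F2: "y1 \<in> F z2" "z1 \<in> F z2" "y3 \<in> F z2" "z3 \<in> F z2"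
    using f12 z12 far2[OF W3(1) n(5,3)] far2[OF W3(2) n(6,4)] W1 W2 W3 W3A n inH
    unfolding F_def away_from_def by auto
  have "z2 \<noteq> z3" "y2 \<noteq> z3" using W2 W3 by auto
  then have F3: "y1 \<in> F z3" "z1 \<in> F z3" "y2 \<in> F z3" "z2 \<in> F z3"
    using f13 f23 z13 z23 W1 W2 W3A n inH unfolding F_def away_from_def by auto
  \<comment> \<open>All connecting paths have the form \<open>z\<close>, \<open>y\<close>,
    \<open>y'\<close>, \<open>z'\<close> with at most one vertex \<open>w\<close> between
    \<open>y\<close> and \<open>y'\<close>.\<close>
  have path: "linked_away H z z' t"
    if "(y, z) \<in> parcs H" "(y', z') \<in> parcs H" "y \<in> F t" "z \<in> F t" "y' \<in> F t" "z' \<in> F t"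
      and mid: "(y, y') \<in> parcs H \<or> (\<exists>w. w \<in> F t \<and> (y, w) \<in> parcs H \<and> (w, y') \<in> parcs H)"
    for y z y' z' t
  proof -
    let ?R = "Restr (parcs H) (away_from H t)"
    have "(z, y) \<in> ?R" "(y', z') \<in> ?R" using that symH by (auto simp: F_def)
    moreover have "(y, y') \<in> ?R\<^sup>*"
      using mid
    proof
      assume "\<exists>w. w \<in> F t \<and> (y, w) \<in> parcs H \<and> (w, y') \<in> parcs H"
      then obtain w where "w \<in> F t" "(y, w) \<in> parcs H" "(w, y') \<in> parcs H" by blast
      then have "(y, w) \<in> ?R" "(w, y') \<in> ?R" using that(3,5) by (auto simp: F_def)
      then show ?thesis by (meson r_into_rtrancl rtrancl_trans)
    qed (use that in \<open>auto simp: F_def\<close>)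
    ultimately have "(z, z') \<in> ?R\<^sup>*" by (meson converse_rtrancl_into_rtrancl rtrancl_into_rtrancl)
    then show ?thesis using that by (simp add: linked_away_def F_def)
  qed
  \<comment> \<open>If \<open>X\<close> is a star whose centre is none of the three markers, a
    representative of the centre is adjacent to \<open>y1\<close>, \<open>y2\<close>,
    \<open>y3\<close> and away from \<open>z1\<close>, \<open>z2\<close>, \<open>z3\<close>.\<close>
  have via: "w \<in> F z1 \<and> w \<in> F z2 \<and> w \<in> F z3 \<and> (y1, w) \<in> parcs H \<and> (w, y2) \<in> parcs H \<and>
      (y2, w) \<in> parcs H \<and> (w, y3) \<in> parcs H"
    if c: "star_at c X" "c \<noteq> m1" and w: "w = f c" for c w
  proof -
    have cX: "c \<in> pverts X" "c \<noteq> m2" "c \<noteq> m3" using c centre by (auto simp: star_at_def)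
    have "(c, m1) \<in> parcs X" "(c, m2) \<in> parcs X" "(c, m3) \<in> parcs X"
      using c cX m by (auto simp: star_at_def)
    then have wm: "(w, m1) \<in> parcs C" "(w, m2) \<in> parcs C" "(w, m3) \<in> parcs C"
      using embeddingD(2)[OF f(1) cX(1)] m(1-3) fm w by metis+
    have wC: "w \<in> pverts C" "w \<noteq> m1" "w \<noteq> m2" "w \<noteq> m3"
      using wm simple_graphD[OF sC] by auto
    have wB: "w \<in> pverts B" using wC s3(10) by auto
    have wA: "w \<in> pverts A" using wB wC s2(10) by auto
    have "(w, m1) \<in> parcs A"
      using wm(1) bB(3)[OF wC(1) mA(3) wC(4) m(5)] bA(3)[OF wB mA(2) wC(3) m(4)] by blast
    then have 1: "(w, y1) \<in> parcs H" using adj1(1)[OF wA wC(2)] by blast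
    have "(w, m2) \<in> parcs B" using wm(2) bB(3)[OF wC(1) mA(5) wC(4) m(6)] by blast
    then have "(w, y2) \<in> parcs A" using bA(1)[OF wB wC(3) 2(1)] by blast
    then have 2: "(w, y2) \<in> parcs H" using bH(3)[OF wA W2(1) wC(2) n(1)] by blast
    have "(w, y3) \<in> parcs B" using wm(3) bB(1)[OF wC(1,4) 3(1)] by blast
    then have "(w, y3) \<in> parcs A" using bA(3)[OF wB W3(1) wC(3) n(5)] by blast
    then have 3: "(w, y3) \<in> parcs H" using bH(3)[OF wA W3A(1) wC(2) n(3)] by blast
    have "w \<noteq> z1" "w \<noteq> z2" "w \<noteq> z3" using wA wB wC W1 W2 W3 by auto
    then have "w \<in> F z1 \<and> w \<in> F z2 \<and> w \<in> F z3"
      using far1[OF wA wC(2)] far2[OF wB wC(3,2)] far3[OF wC(1,4,3,2)] inH[OF wA wC(2)]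
      unfolding F_def away_from_def by blast
    then show ?thesis using 1 2 3 symH by blast
  qed
  \<comment> \<open>Otherwise \<open>X\<close> is a clique or a star with centre
    \<open>m1\<close>.\<close>
  have edge: "(a, b) \<in> parcs X" if "\<not> (\<exists>c. star_at c X \<and> c \<noteq> m1)" "a = m1 \<or> \<not> star_at m1 X"
    "a \<in> pverts X" "b \<in> pverts X" "a \<noteq> b" for a b
  proof (cases "star_at m1 X")
    case True
    then show ?thesis using that by (auto simp: star_at_def)
  next
    case False
    then have "clique_graph X" using clique_or_star[OF X] that(1) by blast
    then show ?thesis using that by (simp add: clique_graph_def)
  qed
  have mid12: "(y1, y2) \<in> parcs H \<or> (\<exists>w. w \<in> F z3 \<and> (y1, w) \<in> parcs H \<and> (w, y2) \<in> parcs H)"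
  proof (cases "\<exists>c. star_at c X \<and> c \<noteq> m1")
    case True
    then show ?thesis using via by blast
  next
    case False
    then show ?thesis using edge[OF False _ m(1,2,4)] y12 by blast
  qed
  have mid13: "(y1, y3) \<in> parcs H \<or> (\<exists>w. w \<in> F z2 \<and> (y1, w) \<in> parcs H \<and> (w, y3) \<in> parcs H)"
  proof (cases "\<exists>c. star_at c X \<and> c \<noteq> m1")
    case True
    then show ?thesis using via by blast
  next
    case False
    then show ?thesis using edge[OF False _ m(1,3,5)] y13 by blast
  qed
  have mid23: "(y2, y3) \<in> parcs H \<or> (\<exists>w. w \<in> F z1 \<and> (y2, w) \<in> parcs H \<and> (w, y3) \<in> parcs H)"
  proof (cases "\<exists>c. star_at c X \<and> c \<noteq> m1")
    case True
    then show ?thesis using via by blast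
  next
    case False
    note no = False
    show ?thesis
    proof (cases "star_at m1 X")
      case True
      \<comment> \<open>The leaves \<open>m2\<close> and \<open>m3\<close> of \<open>X\<close> are
        not adjacent, so the path takes a detour through \<open>y'\<close> in the first
        branch.\<close>
      have "(m1, m2) \<in> parcs X" "(m1, m3) \<in> parcs X" using True m by (auto simp: star_at_def)
      then have "(y2, y') \<in> parcs H" "(y', y3) \<in> parcs H"
        using adj1(2)[OF W2(1) n(1)] adj1(2)[OF W3A(1) n(3)] y2m y3m symH by blast+
      moreover have "(y', z1) \<notin> parcs H" using bH(4)[OF V1(4,2,5) 1(3)] y'z[OF True] by blast
      then have "y' \<in> F z1" using W1(3) y'z[OF True] by (simp add: F_def away_from_def)
      ultimately show ?thesis by blast
    next
      case False
      then show ?thesis using edge[OF no _ m(2,3,6)] y23 by blast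
    qed
  qed
  have "linked_away H z1 z2 z3" by (rule path[OF yz(1,2) F3 mid12])
  moreover have "linked_away H z2 z3 z1" by (rule path[OF yz(2,3) F1 mid23])
  moreover have "linked_away H z1 z3 z2" by (rule path[OF yz(1,3) F2 mid13])
  ultimately show ?thesis unfolding has_AT_def by blast
qed

end


section \<open>Permutation models along a path of nodes\<close>

text \<open>The two ranks are the orders of the end points on the two lines, and the edges are the
  inverted pairs. Integers allow models to be shifted and stretched.\<close>

definition perm_model :: "'v pair_pre_digraph \<Rightarrow> ('v \<Rightarrow> int) \<Rightarrow> ('v \<Rightarrow> int) \<Rightarrow> bool" where
  "perm_model G s t \<longleftrightarrow> inj_on s (pverts G) \<and> inj_on t (pverts G) \<and>
     (\<forall>u\<in>pverts G. \<forall>v\<in>pverts G. u \<noteq> v \<longrightarrow> ((u, v) \<in> parcs G \<longleftrightarrow> (s u < s v) \<noteq> (t u < t v)))"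

lemma perm_modelD:
  assumes "perm_model G s t" "u \<in> pverts G" "v \<in> pverts G" "u \<noteq> v"
  shows "(u, v) \<in> parcs G \<longleftrightarrow> (s u < s v) \<noteq> (t u < t v)" "s u \<noteq> s v" "t u \<noteq> t v"
  using assms by (auto simp: perm_model_def inj_on_def)

lemma perm_model_swap: "perm_model G s t \<Longrightarrow> perm_model G t s"
  unfolding perm_model_def by blast

lemma perm_modelI:
  assumes "\<And>u v. u \<in> pverts G \<Longrightarrow> v \<in> pverts G \<Longrightarrow> u \<noteq> v \<Longrightarrow>
    s u \<noteq> s v \<and> t u \<noteq> t v \<and> ((u, v) \<in> parcs G \<longleftrightarrow> (s u < s v) \<noteq> (t u < t v))"
  shows "perm_model G s t"
  using assms unfolding perm_model_def inj_on_def by blast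

text \<open>The strict bounds keep the positions 0 and \<open>n\<close> free for extremal
  vertices.\<close>

lemma finite_ranking:
  assumes "finite V"
  shows "\<exists>(g :: 'v \<Rightarrow> int) n. inj_on g V \<and> (\<forall>v\<in>V. 0 < g v \<and> g v < n)"
proof -
  obtain n :: nat and f where f: "f ` V = {i. i < n}" "inj_on f V"
    using finite_imp_inj_to_nat_seg[OF assms] by blast
  have "inj_on (\<lambda>v. int (f v) + 1) V" using f(2) by (auto simp: inj_on_def)
  moreover have "\<forall>v\<in>V. 0 < int (f v) + 1 \<and> int (f v) + 1 < int n + 1"
  proof
    fix v assume "v \<in> V"
    then have "f v < n" using f(1) by blast
    then show "0 < int (f v) + 1 \<and> int (f v) + 1 < int n + 1" by simp
  qed
  ultimately show ?thesis by blast
qed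

lemma finite_bound:
  fixes f :: "'v \<Rightarrow> int"
  assumes "finite V"
  shows "\<exists>c. \<forall>v\<in>V. \<bar>f v\<bar> < c"
proof -
  have "\<bar>f v\<bar> \<le> Max ((\<lambda>v. \<bar>f v\<bar>) ` V)" if "v \<in> V" for v
    using assms that by (intro Max_ge) auto
  then have "\<forall>v\<in>V. \<bar>f v\<bar> < Max ((\<lambda>v. \<bar>f v\<bar>) ` V) + 1" by force
  then show ?thesis by blast
qed

text \<open>
  As a star centre crosses all leaves, it may have to precede \<open>m\<close> in the first order; then \<open>m\<close> comes
  first in the second one.
\<close>

lemma perm_model_node:
  assumes "simple_graph X" "clique_graph X \<or> (\<exists>c. star_at c X)" "m \<in> pverts X" "a \<in> pverts X" "m \<noteq> a"
  shows "\<exists>s t. perm_model X s t \<and> (\<forall>v\<in>pverts X - {a}. s v < s a) \<and>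
    ((\<forall>v\<in>pverts X - {m}. s m < s v) \<or> (\<forall>v\<in>pverts X - {m}. t m < t v))"
proof -
  obtain g :: "'a \<Rightarrow> int" and n where g: "inj_on g (pverts X)" "\<And>v. v \<in> pverts X \<Longrightarrow> 0 < g v \<and> g v < n"
    using finite_ranking[OF simple_graphD(1)[OF assms(1)]] by metis
  have n: "0 < n" using g(2)[OF assms(3)] by linarith
  define r where "r v = (if v = m then 0 else if v = a then n else g v)" for v
  have ne: "r u \<noteq> r v" if "u \<in> pverts X" "v \<in> pverts X" "u \<noteq> v" for u v
    using that g(2)[OF that(1)] g(2)[OF that(2)] inj_onD[OF g(1) _ that(1,2)] n by (auto simp: r_def)
  have r: "0 \<le> r v \<and> r v \<le> n" if "v \<in> pverts X" for v
    using g(2)[OF that] n by (auto simp: r_def)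
  have rm: "0 < r v" if "v \<in> pverts X" "v \<noteq> m" for v
    using g(2)[OF that(1)] that n by (auto simp: r_def)
  have ra: "r v < n" if "v \<in> pverts X" "v \<noteq> a" for v
    using g(2)[OF that(1)] that n by (auto simp: r_def)
  have rma: "r m = 0" "r a = n" using assms(5) by (auto simp: r_def)
  show ?thesis
    using assms(2)
  proof
    assume c: "clique_graph X"
    have "perm_model X r (\<lambda>v. - r v)"
    proof (rule perm_modelI)
      fix u v assume uv: "u \<in> pverts X" "v \<in> pverts X" "u \<noteq> v"
      then have "(u, v) \<in> parcs X" using c by (simp add: clique_graph_def)
      then show "r u \<noteq> r v \<and> - r u \<noteq> - r v \<and> ((u, v) \<in> parcs X \<longleftrightarrow> (r u < r v) \<noteq> (- r u < - r v))"
        using ne[OF uv] by auto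
    qed
    then show ?thesis using rm ra rma by fastforce
  next
    assume "\<exists>c. star_at c X"
    then obtain c where c: "star_at c X" by blast
    have cX: "c \<in> pverts X" using c by (simp add: star_at_def)
    have arc: "(u, v) \<in> parcs X \<longleftrightarrow> u = c \<or> v = c" if "u \<in> pverts X" "v \<in> pverts X" "u \<noteq> v" for u v
      using c that unfolding star_at_def by auto
    \<comment> \<open>The centre sits at one end of the first order and at the opposite end of the
      second, and so is inverted with all leaves. It takes the upper end of the first order iff it
      is \<open>a\<close>, which must be last there.\<close>
    define b where "b = (if c = a then n + 1 else - 1)"
    define s where "s = r(c := b)"
    define t where "t = r(c := n - b)"
    have "perm_model X s t"
    proof (rule perm_modelI)
      fix u v assume uv: "u \<in> pverts X" "v \<in> pverts X" "u \<noteq> v"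
      show "s u \<noteq> s v \<and> t u \<noteq> t v \<and> ((u, v) \<in> parcs X \<longleftrightarrow> (s u < s v) \<noteq> (t u < t v))"
        using ne[OF uv] r[OF uv(1)] r[OF uv(2)] uv(3) unfolding arc[OF uv] s_def t_def b_def
        by (cases "u = c"; cases "v = c") auto
    qed
    moreover have "s v < s a" if "v \<in> pverts X - {a}" for v
      using that ra[of v] rma(2) n by (auto simp: s_def b_def)
    moreover have "s m < s v" if "v \<in> pverts X - {m}" "c = a \<or> c = m" for v
      using that rm[of v] rma n assms(5) by (auto simp: s_def b_def)
    moreover have "t m < t v" if "v \<in> pverts X - {m}" "c \<noteq> a" "c \<noteq> m" for v
      using that rm[of v] rma n by (auto simp: t_def b_def)
    ultimately show ?thesis by blast
  qed
qed

text \<open>The marker \<open>a\<close> is last in the first order of \<open>A\<close> and first in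
  that of \<open>B\<close>, so \<open>B\<close> can follow \<open>A\<close> there. Its neighbours
  are then the vertices above it in the second order of \<open>A\<close> and those below it in the
  second order of \<open>B\<close>; these are the pairs to be inverted. If \<open>m\<close> is first
  in the second order only, the two orders are exchanged at the end.\<close>

lemma perm_model_join:
  assumes A: "simple_graph A" and B: "simple_graph B" and i: "pverts A \<inter> pverts B = {a}"
    and sA: "perm_model A s t" "\<forall>v\<in>pverts A - {a}. s v < s a"
    and sB: "perm_model B s' t'" "\<forall>v\<in>pverts B - {a}. s' a < s' v"
    and m: "m \<in> pverts A" "m \<noteq> a"
    and first: "(\<forall>v\<in>pverts A - {m}. s m < s v) \<or> (\<forall>v\<in>pverts A - {m}. t m < t v)"
  shows "\<exists>s t. perm_model (join a A B) s t \<and> (\<forall>v\<in>pverts (join a A B) - {m}. s m < s v)"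
proof -
  note fA = simple_graphD(1)[OF A] and fB = simple_graphD(1)[OF B]
  have aAB: "a \<in> pverts A" "a \<in> pverts B" using i by auto
  obtain c1 c2 c3 c4 where "\<forall>v\<in>pverts A. \<bar>s v\<bar> < c1" "\<forall>v\<in>pverts A. \<bar>t v\<bar> < c2"
    "\<forall>v\<in>pverts B. \<bar>s' v\<bar> < c3" "\<forall>v\<in>pverts B. \<bar>t' v\<bar> < c4"
    using finite_bound[OF fA] finite_bound[OF fB] by metis
  then obtain C where C: "\<And>v. v \<in> pverts A \<Longrightarrow> \<bar>s v\<bar> < C \<and> \<bar>t v\<bar> < C"
    "\<And>v. v \<in> pverts B \<Longrightarrow> \<bar>s' v\<bar> < C \<and> \<bar>t' v\<bar> < C"
    by (metis add_mono_thms_linordered_field(5) less_max_iff_disj max.strict_coboundedI1 max.strict_coboundedI2)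
  define S where "S v = (if v \<in> pverts A then s v else s' v + 2 * C)" for v
  \<comment> \<open>All ranks are below \<open>C\<close> in absolute value, so the offsets make four
    disjoint blocks: non-neighbours of \<open>a\<close> in \<open>A\<close>, neighbours in
    \<open>B\<close>, neighbours in \<open>A\<close>, non-neighbours in \<open>B\<close>. Only the
    two middle blocks are inverted against the first order.\<close>
  define T where "T v = (if v \<in> pverts A then if t a < t v then t v + 4 * C else t v
    else if t' v < t' a then t' v + 2 * C else t' v + 6 * C)" for v
  have Na: "(v, a) \<in> parcs A \<longleftrightarrow> t a < t v" if "v \<in> pverts A" "v \<noteq> a" for v
    using perm_modelD[OF sA(1) that(1) aAB(1) that(2)] sA(2) that by auto
  have Nb: "(a, v) \<in> parcs B \<longleftrightarrow> t' v < t' a" if "v \<in> pverts B" "v \<noteq> a" for v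
    using perm_modelD[OF sB(1) aAB(2) that(1) that(2)[symmetric]] sB(2) that by auto
  have notA: "v \<notin> pverts A" if "v \<in> pverts B" "v \<noteq> a" for v using that i by auto
  have AA: "S u \<noteq> S v \<and> T u \<noteq> T v \<and> ((u, v) \<in> parcs (join a A B) \<longleftrightarrow> (S u < S v) \<noteq> (T u < T v))"
    if uv: "u \<in> pverts A" "v \<in> pverts A" "u \<noteq> a" "v \<noteq> a" "u \<noteq> v" for u v
  proof -
    have "S u = s u" "S v = s v" using uv by (auto simp: S_def)
    moreover have "T u < T v \<longleftrightarrow> t u < t v" "T u \<noteq> T v"
      using uv C(1)[OF uv(1)] C(1)[OF uv(2)] perm_modelD(3)[OF sA(1) uv(1,2,5)] by (auto simp: T_def)
    ultimately show ?thesis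
      using perm_modelD[OF sA(1) uv(1,2,5)] parcs_join_left[OF A B i uv(1-4)] by auto
  qed
  have BB: "S u \<noteq> S v \<and> T u \<noteq> T v \<and> ((u, v) \<in> parcs (join a A B) \<longleftrightarrow> (S u < S v) \<noteq> (T u < T v))"
    if uv: "u \<in> pverts B" "v \<in> pverts B" "u \<noteq> a" "v \<noteq> a" "u \<noteq> v" for u v
  proof -
    note nA = notA[OF uv(1,3)] notA[OF uv(2,4)]
    have "S u < S v \<longleftrightarrow> s' u < s' v" "S u = S v \<longleftrightarrow> s' u = s' v" using nA by (auto simp: S_def)
    moreover have "T u < T v \<longleftrightarrow> t' u < t' v" "T u \<noteq> T v"
      using nA C(2)[OF uv(1)] C(2)[OF uv(2)] perm_modelD(3)[OF sB(1) uv(1,2,5)] by (auto simp: T_def)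
    ultimately show ?thesis
      using perm_modelD[OF sB(1) uv(1,2,5)] parcs_join_right[OF A B i uv(1-4)] by auto
  qed
  have AB: "S u < S v \<and> T u \<noteq> T v \<and> ((u, v) \<in> parcs (join a A B) \<longleftrightarrow> T v < T u) \<and>
      ((v, u) \<in> parcs (join a A B) \<longleftrightarrow> T v < T u)"
    if uv: "u \<in> pverts A" "v \<in> pverts B" "u \<noteq> a" "v \<noteq> a" for u v
  proof -
    note nA = notA[OF uv(2,4)]
    have "S u < S v" using C(1)[OF uv(1)] C(2)[OF uv(2)] nA uv by (auto simp: S_def)
    moreover have "T v < T u \<longleftrightarrow> t a < t u \<and> t' v < t' a" "T u \<noteq> T v"
      using C(1)[OF uv(1)] C(2)[OF uv(2)] nA uv by (auto simp: T_def)
    ultimately show ?thesis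
      using parcs_join_cross[OF A B i uv] Na[OF uv(1,3)] Nb[OF uv(2,4)] by auto
  qed
  have pm: "perm_model (join a A B) S T"
  proof (rule perm_modelI)
    fix u v assume "u \<in> pverts (join a A B)" "v \<in> pverts (join a A B)" "u \<noteq> v"
    then consider "u \<in> pverts A" "v \<in> pverts A" "u \<noteq> a" "v \<noteq> a" "u \<noteq> v"
      | "u \<in> pverts B" "v \<in> pverts B" "u \<noteq> a" "v \<noteq> a" "u \<noteq> v"
      | "u \<in> pverts A" "v \<in> pverts B" "u \<noteq> a" "v \<noteq> a"
      | "v \<in> pverts A" "u \<in> pverts B" "v \<noteq> a" "u \<noteq> a" by auto
    then show "S u \<noteq> S v \<and> T u \<noteq> T v \<and> ((u, v) \<in> parcs (join a A B) \<longleftrightarrow> (S u < S v) \<noteq> (T u < T v))"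
    proof cases
      case 1
      then show ?thesis by (rule AA)
    next
      case 2
      then show ?thesis by (rule BB)
    next
      case 3
      show ?thesis using AB[OF 3] by auto
    next
      case 4
      show ?thesis using AB[OF 4] by auto
    qed
  qed
  show ?thesis
    using first
  proof
    assume f: "\<forall>v\<in>pverts A - {m}. s m < s v"
    have "S m < S v" if v: "v \<in> pverts (join a A B) - {m}" for v
    proof (cases "v \<in> pverts A")
      case True
      then show ?thesis using f v m by (auto simp: S_def)
    next
      case False
      then show ?thesis using AB[OF m(1) _ m(2)] v by auto
    qed
    then show ?thesis using pm by blast
  next
    assume f: "\<forall>v\<in>pverts A - {m}. t m < t v"
    \<comment> \<open>Being below \<open>a\<close>, the vertex \<open>m\<close> is not shifted and
      remains first.\<close>
    have ta: "t m < t a" using f aAB m by auto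
    have "T m < T v" if v: "v \<in> pverts (join a A B) - {m}" for v
    proof (cases "v \<in> pverts A")
      case True
      then have "t m < t v" using f v by auto
      then show ?thesis using True ta m C(1)[OF m(1)] C(1)[OF True] by (auto simp: T_def)
    next
      case False
      then have vB: "v \<in> pverts B" using v by auto
      then show ?thesis using False ta m C(1)[OF m(1)] C(2)[OF vB] by (auto simp: T_def)
    qed
    then show ?thesis using perm_model_swap[OF pm] by blast
  qed
qed

text \<open>Glueing \<open>L\<close> along a universal vertex substitutes a clique or an independent set for \<open>m\<close>.\<close>

lemma perm_model_substitute:
  assumes A: "simple_graph A" and L: "simple_graph L" and i: "pverts A \<inter> pverts L = {m}"
    and sA: "perm_model A s t" and u: "universal_vertex L m" and L': "clique_graph L \<or> star_at m L"
  shows "\<exists>s t. perm_model (join m A L) s t"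
proof -
  obtain g :: "'a \<Rightarrow> int" and n where g: "inj_on g (pverts L)" "\<And>v. v \<in> pverts L \<Longrightarrow> 0 < g v \<and> g v < n"
    using finite_ranking[OF simple_graphD(1)[OF L]] by metis
  have mAL: "m \<in> pverts A" "m \<in> pverts L" using i by auto
  have n: "0 < n" using g(2)[OF mAL(2)] by linarith
  \<comment> \<open>The sign reverses the second order for a clique and keeps it for an independent
    set. The factor \<open>n\<close> below makes room for all ranks \<open>g\<close> next to the
    position of \<open>m\<close>.\<close>
  define \<sigma> where "\<sigma> = (if clique_graph L then - 1 else 1 :: int)"
  define S where "S v = (if v \<in> pverts A then n * s v else n * s m + g v)" for v
  define T where "T v = (if v \<in> pverts A then n * t v else n * t m + \<sigma> * g v)" for v
  have scale: "n * x < n * y + d \<longleftrightarrow> x < y" "n * y + d < n * x \<longleftrightarrow> y < x"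
    if "x \<noteq> y" "\<bar>d\<bar> < n" for x y d :: int
  proof -
    have "n * x + n \<le> n * y" if "x < y" for x y
      using mult_left_mono[of "x + 1" y n] that n by (simp add: algebra_simps)
    note le = this
    show "n * x < n * y + d \<longleftrightarrow> x < y" "n * y + d < n * x \<longleftrightarrow> y < x"
      using le[of x y] le[of y x] that by (cases "x < y"; simp)+
  qed
  have notA: "v \<notin> pverts A" if "v \<in> pverts L" "v \<noteq> m" for v using that i by auto
  have um: "(m, v) \<in> parcs L" if "v \<in> pverts L" "v \<noteq> m" for v
    using u that by (simp add: universal_vertex_def)
  have AA: "S u \<noteq> S v \<and> T u \<noteq> T v \<and> ((u, v) \<in> parcs (join m A L) \<longleftrightarrow> (S u < S v) \<noteq> (T u < T v))"
    if uv: "u \<in> pverts A" "v \<in> pverts A" "u \<noteq> m" "v \<noteq> m" "u \<noteq> v" for u v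
    using perm_modelD[OF sA uv(1,2,5)] parcs_join_left[OF A L i uv(1-4)] n uv(1,2)
    by (auto simp: S_def T_def)
  have LL: "S u \<noteq> S v \<and> T u \<noteq> T v \<and> ((u, v) \<in> parcs (join m A L) \<longleftrightarrow> (S u < S v) \<noteq> (T u < T v))"
    if uv: "u \<in> pverts L" "v \<in> pverts L" "u \<noteq> m" "v \<noteq> m" "u \<noteq> v" for u v
  proof -
    have "(u, v) \<in> parcs L \<longleftrightarrow> clique_graph L"
      using L' uv unfolding clique_graph_def star_at_def by auto
    moreover have "g u \<noteq> g v" using inj_onD[OF g(1) _ uv(1,2)] uv(5) by blast
    ultimately show ?thesis
      using parcs_join_right[OF A L i uv(1-4)] notA[OF uv(1,3)] notA[OF uv(2,4)]
      by (auto simp: S_def T_def \<sigma>_def)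
  qed
  have AL: "S u \<noteq> S v \<and> T u \<noteq> T v \<and> ((u, v) \<in> parcs (join m A L) \<longleftrightarrow> (S u < S v) \<noteq> (T u < T v)) \<and>
      ((v, u) \<in> parcs (join m A L) \<longleftrightarrow> (S v < S u) \<noteq> (T v < T u))"
    if uv: "u \<in> pverts A" "v \<in> pverts L" "u \<noteq> m" "v \<noteq> m" for u v
  proof -
    note d = perm_modelD[OF sA uv(1) mAL(1) uv(3)]
    have "\<bar>g v\<bar> < n" "\<bar>\<sigma> * g v\<bar> < n" using g(2)[OF uv(2)] by (auto simp: \<sigma>_def)
    then have "S u < S v \<longleftrightarrow> s u < s m" "S v < S u \<longleftrightarrow> s m < s u" "T u < T v \<longleftrightarrow> t u < t m" "T v < T u \<longleftrightarrow> t m < t u"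
      using scale[OF d(2)] scale[OF d(3)] uv(1) notA[OF uv(2,4)] by (simp_all add: S_def T_def)
    then show ?thesis
      using d um[OF uv(2,4)] parcs_join_cross[OF A L i uv]
      by (cases "s u < s m"; cases "t u < t m") auto
  qed
  have "perm_model (join m A L) S T"
  proof (rule perm_modelI)
    fix u v assume "u \<in> pverts (join m A L)" "v \<in> pverts (join m A L)" "u \<noteq> v"
    then consider "u \<in> pverts A" "v \<in> pverts A" "u \<noteq> m" "v \<noteq> m" "u \<noteq> v"
      | "u \<in> pverts L" "v \<in> pverts L" "u \<noteq> m" "v \<noteq> m" "u \<noteq> v"
      | "u \<in> pverts A" "v \<in> pverts L" "u \<noteq> m" "v \<noteq> m"
      | "v \<in> pverts A" "u \<in> pverts L" "v \<noteq> m" "u \<noteq> m" by auto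
    then show "S u \<noteq> S v \<and> T u \<noteq> T v \<and> ((u, v) \<in> parcs (join m A L) \<longleftrightarrow> (S u < S v) \<noteq> (T u < T v))"
    proof cases
      case 1
      then show ?thesis by (rule AA)
    next
      case 2
      then show ?thesis by (rule LL)
    next
      case 3
      show ?thesis using AL[OF 3] by blast
    next
      case 4
      show ?thesis using AL[OF 4] by metis
    qed
  qed
  then show ?thesis by blast
qed

section \<open>Decomposition trees that are paths\<close>

text \<open>Independent of the decomposition, so the tree of any set of nodes is a restriction of
  this one relation.\<close>

definition node_adjacency :: "'a node rel" where
  "node_adjacency = {(X, Y). X \<noteq> Y \<and> (\<exists>m. shared_marker X Y m)}"

definition path_arcs :: "'v list \<Rightarrow> 'v rel" where
  "path_arcs p = set (vwalk_arcs p) \<union> (set (vwalk_arcs p))\<inverse>"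

lemma node_adjacency_irrefl: "(X, X) \<notin> node_adjacency"
  by (simp add: node_adjacency_def)

lemma sym_node_adjacency: "sym node_adjacency"
  by (auto simp: sym_def node_adjacency_def shared_marker_def)

lemma pverts_decomposition_tree [simp]: "pverts (decomposition_tree D) = D"
  by (simp add: decomposition_tree_def)

lemma parcs_decomposition_tree: "parcs (decomposition_tree D) = Restr node_adjacency D"
  by (auto simp: decomposition_tree_def node_adjacency_def)

lemma vwalk_arcs_subset: "set (vwalk_arcs p) \<subseteq> set p \<times> set p"
  by (induction p rule: vwalk_arcs.induct) auto

lemma path_graph_decomposition_tree:
  "path_graph (decomposition_tree D) \<longleftrightarrow>
    (\<exists>p. p \<noteq> [] \<and> distinct p \<and> set p = D \<and> Restr node_adjacency D = path_arcs p)"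
proof -
  have "set (vwalk_arcs p) \<subseteq> Restr node_adjacency D" if "Restr node_adjacency D = path_arcs p" for p
    using that by (auto simp: path_arcs_def)
  then show ?thesis
    unfolding path_graph_def parcs_decomposition_tree pverts_decomposition_tree path_arcs_def
      vpath_def vwalk_def with_proj_simps by auto
qed

text \<open>Equality with the path excludes further edges; so the first vertex of the list is a
  leaf, and removing it leaves a path again. Inductions along a path of nodes use this.\<close>

lemma path_arcs_Cons:
  assumes "sym R" "distinct (x # y # q)" "(x, x) \<notin> R"
  shows "Restr R (set (x # y # q)) = path_arcs (x # y # q) \<longleftrightarrow>
    (x, y) \<in> R \<and> (\<forall>z\<in>set q. (x, z) \<notin> R) \<and> Restr R (set (y # q)) = path_arcs (y # q)"
    (is "?L \<longleftrightarrow> ?R")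
proof -
  have A: "path_arcs (x # y # q) = {(x, y), (y, x)} \<union> path_arcs (y # q)"
    by (auto simp: path_arcs_def)
  have sub: "path_arcs (y # q) \<subseteq> set (y # q) \<times> set (y # q)"
    using vwalk_arcs_subset[of "y # q"] unfolding path_arcs_def by blast
  have x: "x \<notin> set (y # q)" "y \<notin> set q" using assms(2) by auto
  have xsub: "(x, z) \<notin> path_arcs (y # q)" "(z, x) \<notin> path_arcs (y # q)" for z using sub x by blast+
  show ?thesis
  proof
    assume L: ?L
    have "(x, z) \<in> R \<longleftrightarrow> z = y" if z: "z \<in> set (y # q)" for z
    proof -
      have "(x, z) \<in> R \<longleftrightarrow> (x, z) \<in> Restr R (set (x # y # q))" using z by auto
      also have "\<dots> \<longleftrightarrow> z = y" unfolding L A using xsub x z by auto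
      finally show ?thesis .
    qed
    moreover have "Restr R (set (y # q)) = path_arcs (y # q)"
    proof -
      have "Restr R (set (y # q)) = Restr R (set (x # y # q)) \<inter> set (y # q) \<times> set (y # q)" by auto
      also have "\<dots> = path_arcs (y # q)" unfolding L A using sub x by blast
      finally show ?thesis .
    qed
    ultimately show ?R using x by auto
  next
    assume R: ?R
    have "(x, z) \<in> R \<longleftrightarrow> z = y" "(z, x) \<in> R \<longleftrightarrow> z = y" if "z \<in> set (x # y # q)" for z
      using R assms(3) symD[OF assms(1), of x z] symD[OF assms(1), of z x] that by auto
    then have "Restr R (set (x # y # q)) = {(x, y), (y, x)} \<union> Restr R (set (y # q))" by auto
    then show ?L using R A by simp
  qed
qed

text \<open>The two sides of the cut at \<open>m\<close> meet in \<open>m\<close> only, and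
  \<open>m\<close> is unglued on each side. So the edges of the tree correspond to the shared
  markers.\<close>

lemma shared_vertex_marker:
  assumes "decomposes D H" "X \<in> D" "Y \<in> D" "X \<noteq> Y" "m \<in> pverts X" "m \<in> pverts Y"
  shows "shared_marker X Y m" "m \<notin> pverts H" "Z \<in> D \<Longrightarrow> m \<in> pverts Z \<Longrightarrow> Z = X \<or> Z = Y"
    "m' \<in> pverts X \<Longrightarrow> m' \<in> pverts Y \<Longrightarrow> m' = m"
proof -
  obtain D1 D2 H1 H2 where e: "edge_split D H m X Y D1 D2 H1 H2"
    using edge_split_exists[OF assms] by blast
  note e' = edge_splitD[OF e]
  show "shared_marker X Y m" using e'(9) assms(5,6) by (simp add: shared_marker_def)
  show "m \<notin> pverts H" using e'(10) by simp
  show "Z = X \<or> Z = Y" if Z: "Z \<in> D" "m \<in> pverts Z"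
    using decomposes_unique[OF e'(4,6) _ e'(2) Z(2) assms(5)]
      decomposes_unique[OF e'(5,7) _ e'(3) Z(2) assms(6)] Z(1) e'(1) by blast
  show "m' = m" if "m' \<in> pverts X" "m' \<in> pverts Y"
  proof -
    have "m' \<in> all_verts D1" "m' \<in> all_verts D2" using that e'(2,3) by auto
    then show ?thesis using e'(8) by blast
  qed
qed

lemma node_adjacency_iff:
  assumes "decomposes D H" "X \<in> D" "Y \<in> D"
  shows "(X, Y) \<in> node_adjacency \<longleftrightarrow> X \<noteq> Y \<and> pverts X \<inter> pverts Y \<noteq> {}"
  using shared_vertex_marker(1)[OF assms] by (auto simp: node_adjacency_def shared_marker_def)

text \<open>The side of the leaf \<open>X\<close> has no other node, because one sharing a vertex
  with \<open>X\<close> would be a second neighbour.\<close>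

lemma leaf_cut:
  assumes "decomposes D H" "X \<in> D" "Y \<in> D" "(X, Y) \<in> node_adjacency"
    and only: "\<And>Z. Z \<in> D \<Longrightarrow> (X, Z) \<in> node_adjacency \<Longrightarrow> Z = Y"
  obtains a D2 H2 where "D = insert X D2" "X \<notin> D2" "Y \<in> D2" "decomposes D2 H2" "a \<in> pverts X"
    "a \<in> pverts Y" "a \<in> pverts H2" "pverts X \<inter> pverts H2 = {a}" "H = join a X H2"
proof -
  obtain a where a: "X \<noteq> Y" "a \<in> pverts X" "a \<in> pverts Y"
    using assms(4) node_adjacency_iff[OF assms(1-3)] by blast
  obtain D1 D2 H1 H2 where e: "edge_split D H a X Y D1 D2 H1 H2"
    using edge_split_exists[OF assms(1-3) a] by blast
  note e' = edge_splitD[OF e]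
  have "D1 = {X} \<and> H1 = X"
  proof (rule decomposes_isolated[OF e'(4,2)])
    fix Z assume Z: "Z \<in> D1" "Z \<noteq> X"
    then have ZD: "Z \<in> D" "Z \<noteq> Y" using e'(1,3,12) by auto
    then show "pverts X \<inter> pverts Z = {}"
      using only[OF ZD(1)] node_adjacency_iff[OF assms(1,2) ZD(1)] Z(2) by blast
  qed
  then show thesis using that[of D2 H2 a] e' a by simp
qed

text \<open>The induction needs an unglued vertex \<open>m\<close> of the first node at the start of
  the first order, so that a further node can be glued there in front. The marker \<open>a\<close>
  to the rest of the path goes last in the model of the first node.\<close>

lemma path_perm_model:
  assumes "decomposes D H" "\<forall>X\<in>D. clique_graph X \<or> (\<exists>c. star_at c X)"
    and "distinct (X # q)" "set (X # q) = D" "Restr node_adjacency D = path_arcs (X # q)"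
    and "m \<in> pverts X" "m \<in> pverts H"
  shows "\<exists>s t. perm_model H s t \<and> (\<forall>v\<in>pverts H - {m}. s m < s v)"
  using assms
proof (induction q arbitrary: D H X m)
  case Nil
  then have "D = {X}" by auto
  then have X: "H = X" using decomposes_isolated[OF Nil.prems(1), of X] by auto
  have nX: "node_graph X" "simple_graph X" using decomposesD(1,2)[OF Nil.prems(1)] X by auto
  \<comment> \<open>A single node has no marker to a rest of the path; any vertex other than
    \<open>m\<close> may play the part of \<open>a\<close>.\<close>
  obtain a where a: "a \<in> pverts X" "a \<noteq> m" using node_graph_third[OF nX(1)] by blast
  have "clique_graph X \<or> (\<exists>c. star_at c X)" using Nil.prems(2) \<open>D = {X}\<close> by auto
  then show ?case
    using perm_model_node[OF nX(2) _ Nil.prems(6) a(1)] a(2) perm_model_swap X by metis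
next
  case (Cons Y q)
  have D: "X \<in> D" "Y \<in> D" "X \<noteq> Y" "set (X # Y # q) = D" using Cons.prems(3,4) by auto
  have "Restr node_adjacency (set (X # Y # q)) = path_arcs (X # Y # q)"
    unfolding Cons.prems(4) by (rule Cons.prems(5))
  then have path: "(X, Y) \<in> node_adjacency" "\<forall>z\<in>set q. (X, z) \<notin> node_adjacency"
    "Restr node_adjacency (set (Y # q)) = path_arcs (Y # q)"
    unfolding path_arcs_Cons[OF sym_node_adjacency Cons.prems(3) node_adjacency_irrefl] by blast+
  obtain a D2 H2 where e: "D = insert X D2" "X \<notin> D2" "Y \<in> D2" "decomposes D2 H2" "a \<in> pverts X"
    "a \<in> pverts Y" "a \<in> pverts H2" "pverts X \<inter> pverts H2 = {a}" "H = join a X H2"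
    using leaf_cut[OF Cons.prems(1) D(1,2) path(1)] path(2) D(4) by (metis node_adjacency_irrefl set_ConsD)
  have D2: "set (Y # q) = D2"
  proof -
    have "set (Y # q) = D - {X}" using D(4) Cons.prems(3) by (metis Diff_insert_absorb distinct.simps(2) list.simps(15))
    then show ?thesis using e(1,2) by simp
  qed
  have "\<exists>s t. perm_model H2 s t \<and> (\<forall>v\<in>pverts H2 - {a}. s a < s v)"
  proof (rule Cons.IH[OF e(4) _ _ D2 _ e(6,7)])
    show "\<forall>X\<in>D2. clique_graph X \<or> (\<exists>c. star_at c X)" using Cons.prems(2) e(1) by blast
    show "distinct (Y # q)" using Cons.prems(3) by auto
    show "Restr node_adjacency D2 = path_arcs (Y # q)" using path(3) unfolding D2 .
  qed
  then obtain s' t' where st': "perm_model H2 s' t'" "\<forall>v\<in>pverts H2 - {a}. s' a < s' v" by blast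
  have ma: "m \<noteq> a" using Cons.prems(7) e(9) by auto
  have sX: "simple_graph X" using decomposesD(7)[OF Cons.prems(1) D(1)] .
  obtain s t where st: "perm_model X s t" "\<forall>v\<in>pverts X - {a}. s v < s a"
    "(\<forall>v\<in>pverts X - {m}. s m < s v) \<or> (\<forall>v\<in>pverts X - {m}. t m < t v)"
    using perm_model_node[OF sX _ Cons.prems(6) e(5) ma] Cons.prems(2) D(1) by blast
  show ?case
    using perm_model_join[OF sX decomposesD(2)[OF e(4)] e(8) st(1,2) st' Cons.prems(6) ma st(3)]
      e(9) by simp
qed

lemma path_tree_perm_model:
  assumes "decomposes P H" "\<forall>X\<in>P. clique_graph X \<or> (\<exists>c. star_at c X)"
    and "path_graph (decomposition_tree P)"
  shows "\<exists>s t. perm_model H s t"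
proof -
  obtain p where p: "p \<noteq> []" "distinct p" "set p = P" "Restr node_adjacency P = path_arcs p"
    using assms(3) path_graph_decomposition_tree by blast
  obtain X q where X: "p = X # q" using p(1) by (cases p) auto
  have XP: "X \<in> P" using X p(3) by auto
  \<comment> \<open>The first node of the path has at most one marker, so a vertex is left with
    which to start the induction.\<close>
  have "\<exists>m\<in>pverts X. m \<in> pverts H"
  proof (cases q)
    case Nil
    then have "P = {X}" using X p(3) by auto
    then have "H = X" using decomposes_isolated[OF assms(1), of X] by auto
    then show ?thesis using node_graph_third[OF decomposesD(1)[OF assms(1)]] by blast
  next
    case (Cons Y q')
    have Y: "Y \<in> P" "X \<noteq> Y" using X Cons p(2,3) by auto
    have XYq: "p = X # Y # q'" using X Cons by simp
    note Cons_iff = path_arcs_Cons[OF sym_node_adjacency p(2)[unfolded XYq] node_adjacency_irrefl]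
    have "Restr node_adjacency (set (X # Y # q')) = path_arcs (X # Y # q')"
      using p(3,4) unfolding XYq by metis
    then have path: "(X, Y) \<in> node_adjacency" "\<forall>z\<in>set q'. (X, z) \<notin> node_adjacency"
      unfolding Cons_iff by blast+
    obtain a H2 where "H = join a X H2"
      using leaf_cut[OF assms(1) XP Y(1) path(1)] path(2) p(3) XYq
      by (metis node_adjacency_irrefl set_ConsD)
    moreover obtain m where "m \<in> pverts X" "m \<noteq> a"
      using node_graph_third[OF decomposesD(6)[OF assms(1) XP]] by blast
    ultimately show ?thesis by auto
  qed
  then obtain m where "m \<in> pverts X" "m \<in> pverts H" by blast
  then show ?thesis
    using path_perm_model[OF assms(1,2), of X q m] p X by blast
qed

text \<open>Following the branches away from \<open>m\<close>, one ends at a leaf of the tree.\<close>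

lemma leaf_exists:
  assumes "decomposes D H" "m \<in> pverts H"
  shows "\<exists>L\<in>D. \<forall>a\<in>pverts L. \<forall>b\<in>pverts L. (a = m \<or> (\<exists>Y\<in>D. Y \<noteq> L \<and> a \<in> pverts Y)) \<longrightarrow>
    (b = m \<or> (\<exists>Y\<in>D. Y \<noteq> L \<and> b \<in> pverts Y)) \<longrightarrow> a = b"
  using assms
proof (induction "card D" arbitrary: D H m rule: less_induct)
  case less
  obtain X where X: "X \<in> D" "m \<in> pverts X"
    using decomposesD(3)[OF less.prems(1)] less.prems(2) by (auto elim: all_vertsE)
  show ?case
  proof (cases "\<exists>c\<in>pverts X. \<exists>Y\<in>D. Y \<noteq> X \<and> c \<in> pverts Y")
    case False
    then show ?thesis using X by blast
  next
    case True
    then obtain c Y where c: "c \<in> pverts X" "Y \<in> D" "Y \<noteq> X" "c \<in> pverts Y" by blast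
    obtain D1 D2 H1 H2 where e: "edge_split D H c X Y D1 D2 H1 H2"
      using edge_split_exists[OF less.prems(1) X(1) c(2)] c by blast
    note e' = edge_splitD[OF e]
    have "D2 \<subset> D" using e'(1,2,12) by blast
    then have "card D2 < card D" using decomposesD(4)[OF less.prems(1)] by (simp add: psubset_card_mono)
    then obtain L where L: "L \<in> D2" "\<And>a b. a \<in> pverts L \<Longrightarrow> b \<in> pverts L \<Longrightarrow>
        a = c \<or> (\<exists>Y\<in>D2. Y \<noteq> L \<and> a \<in> pverts Y) \<Longrightarrow> b = c \<or> (\<exists>Y\<in>D2. Y \<noteq> L \<and> b \<in> pverts Y) \<Longrightarrow> a = b"
      using less.hyps[OF _ e'(5,7)] by blast
    have mc: "m \<noteq> c" using less.prems(2) e'(10) by auto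
    have live: "a = c \<or> (\<exists>Y\<in>D2. Y \<noteq> L \<and> a \<in> pverts Y)"
      if a: "a \<in> pverts L" "a = m \<or> (\<exists>Y\<in>D. Y \<noteq> L \<and> a \<in> pverts Y)" for a
    proof -
      have a2: "a \<in> all_verts D2" using a(1) L(1) by auto
      have "a \<noteq> m"
      proof
        assume "a = m"
        then have "m \<in> all_verts D1" "m \<in> all_verts D2" using a2 X(2) e'(2) by auto
        then show False using e'(8) mc by blast
      qed
      then obtain Z where Z: "Z \<in> D" "Z \<noteq> L" "a \<in> pverts Z" using a(2) by blast
      show ?thesis
      proof (cases "Z \<in> D2")
        case True
        then show ?thesis using Z by blast
      next
        case False
        then have "a \<in> all_verts D1" using Z e'(1) by auto
        then show ?thesis using a2 e'(8) by blast
      qed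
    qed
    show ?thesis
    proof (intro bexI[of _ L] ballI impI)
      fix a b assume "a \<in> pverts L" "b \<in> pverts L" "a = m \<or> (\<exists>Y\<in>D. Y \<noteq> L \<and> a \<in> pverts Y)"
        "b = m \<or> (\<exists>Y\<in>D. Y \<noteq> L \<and> b \<in> pverts Y)"
      then show "a = b" using L(2) live by blast
    qed (use L(1) e'(1) in auto)
  qed
qed

text \<open>Once the leaf \<open>X\<close> is cut off, its neighbour \<open>Y\<close> has lost one
  of at most two neighbours and is a leaf of what remains.\<close>

lemma degree_two_path:
  assumes "decomposes D H" "X \<in> D"
    and "\<And>Y Z. Y \<in> D \<Longrightarrow> Z \<in> D \<Longrightarrow> (X, Y) \<in> node_adjacency \<Longrightarrow> (X, Z) \<in> node_adjacency \<Longrightarrow> Y = Z"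
    and "\<And>U Y1 Y2 Y3. U \<in> D \<Longrightarrow> Y1 \<in> D \<Longrightarrow> Y2 \<in> D \<Longrightarrow> Y3 \<in> D \<Longrightarrow> (U, Y1) \<in> node_adjacency \<Longrightarrow>
      (U, Y2) \<in> node_adjacency \<Longrightarrow> (U, Y3) \<in> node_adjacency \<Longrightarrow> Y1 = Y2 \<or> Y1 = Y3 \<or> Y2 = Y3"
  shows "\<exists>q. distinct (X # q) \<and> set (X # q) = D \<and> Restr node_adjacency D = path_arcs (X # q)"
  using assms
proof (induction "card D" arbitrary: D H X rule: less_induct)
  case less
  show ?case
  proof (cases "\<exists>Y\<in>D. (X, Y) \<in> node_adjacency")
    case False
    have "D = {X} \<and> H = X"
      by (rule decomposes_isolated[OF less.prems(1,2)])
        (use False node_adjacency_iff[OF less.prems(1,2)] in blast)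
    then show ?thesis using node_adjacency_irrefl by (intro exI[of _ "[]"]) (auto simp: path_arcs_def)
  next
    case True
    then obtain Y where Y: "Y \<in> D" "(X, Y) \<in> node_adjacency" by blast
    obtain D2 H2 where D: "D = insert X D2" "X \<notin> D2" and e: "Y \<in> D2" "decomposes D2 H2"
      using leaf_cut[OF less.prems(1,2) Y] less.prems(3)[OF _ Y(1) _ Y(2)] by metis
    have sub: "D2 \<subseteq> D" using D by auto
    have YX: "(Y, X) \<in> node_adjacency" using Y(2) sym_node_adjacency by (auto simp: sym_def)
    have "\<exists>q. distinct (Y # q) \<and> set (Y # q) = D2 \<and> Restr node_adjacency D2 = path_arcs (Y # q)"
    proof (rule less.hyps[OF _ e(2,1)])
      show "card D2 < card D" using D decomposesD(4)[OF e(2)] by simp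
      fix U V assume UV: "U \<in> D2" "V \<in> D2" "(Y, U) \<in> node_adjacency" "(Y, V) \<in> node_adjacency"
      have "U \<noteq> X" "V \<noteq> X" using UV D by auto
      then show "U = V"
        using less.prems(4)[OF Y(1) less.prems(2) _ _ YX UV(3,4)] UV(1,2) sub by blast
    qed (use less.prems(4) sub in blast)
    then obtain q where q: "distinct (Y # q)" "set (Y # q) = D2" "Restr node_adjacency D2 = path_arcs (Y # q)"
      by blast
    have d: "distinct (X # Y # q)" using q D by auto
    have "(X, Z) \<notin> node_adjacency" if "Z \<in> set q" for Z
    proof
      assume Z: "(X, Z) \<in> node_adjacency"
      have "Z \<in> D" "Z \<noteq> Y" using that q D by auto
      then show False using less.prems(3)[OF Y(1) _ Y(2) Z] by blast
    qed
    then have r: "Restr node_adjacency (set (X # Y # q)) = path_arcs (X # Y # q)"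
      unfolding path_arcs_Cons[OF sym_node_adjacency d node_adjacency_irrefl] q(2) using Y(2) q(3) by blast
    have "set (X # Y # q) = D" unfolding D(1) using q(2) by simp
    then show ?thesis using d r by metis
  qed
qed

lemma (in pruned_nodes) path_or_AT:
  assumes "decomposes P H"
  shows "path_graph (decomposition_tree P) \<or> has_AT H"
proof (cases "\<exists>X\<in>P. \<exists>Y1\<in>P. \<exists>Y2\<in>P. \<exists>Y3\<in>P. (X, Y1) \<in> node_adjacency \<and> (X, Y2) \<in> node_adjacency \<and>
    (X, Y3) \<in> node_adjacency \<and> Y1 \<noteq> Y2 \<and> Y1 \<noteq> Y3 \<and> Y2 \<noteq> Y3")
  case True
  then obtain X Y1 Y2 Y3 where X: "X \<in> P" and Y: "Y1 \<in> P" "Y2 \<in> P" "Y3 \<in> P"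
    and adj: "(X, Y1) \<in> node_adjacency" "(X, Y2) \<in> node_adjacency" "(X, Y3) \<in> node_adjacency"
    and ne: "Y1 \<noteq> Y2" "Y1 \<noteq> Y3" "Y2 \<noteq> Y3" by blast
  obtain m1 where 1: "Y1 \<noteq> X" "m1 \<in> pverts X" "m1 \<in> pverts Y1"
    using adj(1) node_adjacency_iff[OF assms X Y(1)] by auto
  obtain m2 where 2: "Y2 \<noteq> X" "m2 \<in> pverts X" "m2 \<in> pverts Y2"
    using adj(2) node_adjacency_iff[OF assms X Y(2)] by auto
  obtain m3 where 3: "Y3 \<noteq> X" "m3 \<in> pverts X" "m3 \<in> pverts Y3"
    using adj(3) node_adjacency_iff[OF assms X Y(3)] by auto
  have m: "m1 \<noteq> m2" "m1 \<noteq> m3" "m2 \<noteq> m3"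
    using shared_vertex_marker(3)[OF assms X Y(1) 1(1)[symmetric] 1(2,3)]
      shared_vertex_marker(3)[OF assms X Y(2) 2(1)[symmetric] 2(2,3)] 1 2 3 Y ne by blast+
  note m' = m[symmetric]
  have star: "c = d" if "star_at c X" "star_at d X" for c d
    using star_at_universal[OF that(1), of d] star_at_universal[OF that(2), of d]
      decomposesD(6)[OF assms X] by (simp add: node_graph_def)
  have "has_AT H"
  \<comment> \<open>The three markers are permuted so that a star centre among them comes
    first.\<close>
  proof (cases "star_at m2 X")
    case True
    show ?thesis
      by (rule three_branches_AT[OF assms X 2(2) 1(2) 3(2) m'(1) m(3,2) Y(2) 2(1,3) Y(1) 1(1,3) Y(3) 3(1,3)])
        (use star[OF True] m in blast)
  next
    case n2: False
    show ?thesis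
    proof (cases "star_at m3 X")
      case True
      show ?thesis
        by (rule three_branches_AT[OF assms X 3(2) 1(2) 2(2) m'(2,3) m(1) Y(3) 3(1,3) Y(1) 1(1,3) Y(2) 2(1,3)])
          (use star[OF True] m in blast)
    next
      case False
      show ?thesis
        by (rule three_branches_AT[OF assms X 1(2) 2(2) 3(2) m Y(1) 1(1,3) Y(2) 2(1,3) Y(3) 3(1,3)])
          (use False n2 in blast)
    qed
  qed
  then show ?thesis by blast
next
  case False
  obtain m where m: "m \<in> pverts H" using node_graph_third[OF decomposesD(1)[OF assms]] by blast
  obtain L where L: "L \<in> P" and leaf: "\<forall>a\<in>pverts L. \<forall>b\<in>pverts L. (a = m \<or> (\<exists>Y\<in>P. Y \<noteq> L \<and> a \<in> pverts Y)) \<longrightarrow>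
    (b = m \<or> (\<exists>Y\<in>P. Y \<noteq> L \<and> b \<in> pverts Y)) \<longrightarrow> a = b"
    using leaf_exists[OF assms m] by blast
  have "Y = Z" if YZ: "Y \<in> P" "Z \<in> P" "(L, Y) \<in> node_adjacency" "(L, Z) \<in> node_adjacency" for Y Z
  proof -
    obtain a where a: "L \<noteq> Y" "a \<in> pverts L" "a \<in> pverts Y"
      using YZ(3) node_adjacency_iff[OF assms L YZ(1)] by blast
    obtain b where b: "L \<noteq> Z" "b \<in> pverts L" "b \<in> pverts Z"
      using YZ(4) node_adjacency_iff[OF assms L YZ(2)] by blast
    have "a = b" using leaf a b YZ(1,2) by metis
    then show ?thesis using shared_vertex_marker(3)[OF assms L YZ(1) a YZ(2)] b by auto
  qed
  moreover have "Y1 = Y2 \<or> Y1 = Y3 \<or> Y2 = Y3"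
    if "U \<in> P" "Y1 \<in> P" "Y2 \<in> P" "Y3 \<in> P" "(U, Y1) \<in> node_adjacency" "(U, Y2) \<in> node_adjacency"
      "(U, Y3) \<in> node_adjacency" for U Y1 Y2 Y3
  proof (rule ccontr)
    assume "\<not> ?thesis"
    then have "Y1 \<noteq> Y2 \<and> Y1 \<noteq> Y3 \<and> Y2 \<noteq> Y3" by simp
    then show False using False that by metis
  qed
  ultimately have "\<exists>q. distinct (L # q) \<and> set (L # q) = P \<and> Restr node_adjacency P = path_arcs (L # q)"
    by (rule degree_two_path[OF assms L])
  then obtain q where "distinct (L # q)" "set (L # q) = P" "Restr node_adjacency P = path_arcs (L # q)" by blast
  then show ?thesis unfolding path_graph_decomposition_tree by blast
qed


section \<open>Distances, asteroidal triples and permutation graphs\<close>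

lemma simple_graph_pair_graph: assumes "pair_graph G" shows "simple_graph G"
proof -
  interpret pair_graph G by (rule assms)
  have "parcs G \<subseteq> pverts G \<times> pverts G" using in_arcsD1 in_arcsD2 by auto
  moreover have "sym (parcs G)" using arcs_symmetric by (auto intro: symI)
  moreover have "irrefl (parcs G)" using no_loops' by (auto simp: irrefl_def)
  ultimately show ?thesis using pair_finite_verts by (simp add: simple_graph_def)
qed

lemma wf_digraph_with_proj: "parcs G \<subseteq> pverts G \<times> pverts G \<Longrightarrow> wf_digraph (with_proj G)"
  by unfold_locales auto

lemma connected_with_proj:
  assumes "simple_graph G"
  shows "Digraph_Component.connected (with_proj G) \<longleftrightarrow> pverts G \<noteq> {} \<and> graph_connected G"
proof -
  note s = simple_graphD[OF assms]
  have "parcs (mk_symmetric (with_proj G)) = parcs G" "pverts (mk_symmetric (with_proj G)) = pverts G"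
    using s(4) by (auto simp: mk_symmetric_def)
  moreover have "(u, v) \<in> rtrancl_on (pverts G) (parcs G) \<longleftrightarrow> (u, v) \<in> (parcs G)\<^sup>*"
    if "u \<in> pverts G" "v \<in> pverts G" for u v
    using rtrancl_on_rtranclI rtrancl_consistent_rtrancl_on[OF _ that] s(3) by metis
  ultimately show ?thesis
    by (simp add: Digraph_Component.connected_def strongly_connected_def reachable_def)
qed

lemma pcas_relpow:
  assumes "pcas u es v" "set es \<subseteq> E" shows "(u, v) \<in> E ^^ length es"
  using assms
proof (induction es arbitrary: u)
  case (Cons e es)
  then have "(u, snd e) \<in> E" "(snd e, v) \<in> E ^^ length es" by auto
  then show ?case by (simp add: relpow_Suc_I2 del: relpow.simps)
qed simp

lemma relpow_pcas:
  assumes "(u, v) \<in> E ^^ n" shows "\<exists>es. length es = n \<and> set es \<subseteq> E \<and> pcas u es v"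
  using assms
proof (induction n arbitrary: u)
  case (Suc n)
  then obtain w where w: "(u, w) \<in> E" "(w, v) \<in> E ^^ n" by (meson relpow_Suc_E2)
  then obtain es where "length es = n" "set es \<subseteq> E" "pcas w es v" using Suc.IH by blast
  then show ?case using w(1) by (intro exI[of _ "(u, w) # es"]) auto
qed simp

lemma graph_distance_eq:
  assumes "parcs G \<subseteq> pverts G \<times> pverts G"
  shows "graph_distance G u v =
    (INF es \<in> {es. u \<in> pverts G \<and> set es \<subseteq> parcs G \<and> pcas u es v}. ereal (length es))"
proof -
  note wf = wf_digraph_with_proj[OF assms]
  have "wf_digraph.awalk_cost (\<lambda>_. 1) es = real (length es)" for es :: "('a \<times> 'a) list"
    unfolding wf_digraph.awalk_cost_def[OF wf] by (induction es) auto
  then show ?thesis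
    unfolding graph_distance_def wf_digraph.\<mu>_def[OF wf]
    by (simp add: pre_digraph.awalk_def cas_with_proj_eq)
qed

text \<open>The definition is applied to the subgraph induced by the path itself, in which the ends
  are at distance \<open>k\<close>.\<close>

lemma distance_hereditary_induced_paths_shortest:
  assumes "simple_graph G" "distance_hereditary G"
  shows "induced_paths_shortest (parcs G)"
  unfolding induced_paths_shortest_def
proof (intro allI impI)
  fix p k n
  assume p: "induced_path (parcs G) p k" and w: "(p 0, p k) \<in> parcs G ^^ n"
  note s = simple_graphD[OF assms(1)]
  have adj: "(p i, p j) \<in> parcs G \<longleftrightarrow> i = Suc j \<or> j = Suc i" if "i \<le> k" "j \<le> k" for i j
    using p that by (auto simp: induced_path_def)
  have inj: "p i = p j \<longleftrightarrow> i = j" if "i \<le> k" "j \<le> k" for i j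
    using p that by (auto simp: induced_path_def inj_on_def)
  show "k \<le> n"
  proof (cases "k = 0")
    case False
    have pV: "p i \<in> pverts G" if "i \<le> k" for i
    proof (cases i)
      case 0
      then have "(p i, p (Suc i)) \<in> parcs G" using adj False by auto
      then show ?thesis using s(2) by blast
    next
      case (Suc j)
      then have "(p i, p j) \<in> parcs G" using adj that by auto
      then show ?thesis using s(2) by blast
    qed
    define H where "H = \<lparr>pverts = p ` {..k}, parcs = Restr (parcs G) (p ` {..k})\<rparr>"
    have HV: "pverts H = p ` {..k}" "parcs H = Restr (parcs G) (p ` {..k})" by (simp_all add: H_def)
    have subV: "pverts H \<subseteq> pverts G" using pV by (auto simp: HV)
    have sH: "simple_graph H"
      using assms(1) finite_subset[OF subV s(1)]
      by (auto simp: simple_graph_def HV sym_def irrefl_def)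
    have wfs: "parcs G \<subseteq> pverts G \<times> pverts G" "parcs H \<subseteq> pverts H \<times> pverts H"
      using assms(1) sH by (auto simp: simple_graph_def)
    have "induced_subgraph (with_proj H) (with_proj G)"
      using wfs subV by (auto simp: induced_subgraph_def subgraph_def HV intro: wf_digraph_with_proj)
    moreover have "graph_connected H"
    proof -
      have step: "(p i, p (Suc i)) \<in> parcs H" "(p (Suc i), p i) \<in> parcs H" if "i < k" for i
        using that adj[of i "Suc i"] adj[of "Suc i" i] by (auto simp: HV)
      have "(p 0, p i) \<in> (parcs H)\<^sup>* \<and> (p i, p 0) \<in> (parcs H)\<^sup>*" if "i \<le> k" for i
        using that
      proof (induction i)
        case (Suc i)
        then have "(p 0, p i) \<in> (parcs H)\<^sup>*" "(p i, p 0) \<in> (parcs H)\<^sup>*" "i < k" by auto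
        then show ?case
          using step[OF \<open>i < k\<close>] by (meson converse_rtrancl_into_rtrancl rtrancl_into_rtrancl)
      qed simp
      then show ?thesis by (auto simp: HV intro: rtrancl_trans)
    qed
    moreover have "pverts H \<noteq> {}" by (simp add: HV)
    ultimately have eq: "graph_distance H (p 0) (p k) = graph_distance G (p 0) (p k)"
      using assms(2) connected_with_proj[OF sH] HV(1) unfolding distance_hereditary_def by auto
    obtain es where "length es = n" "set es \<subseteq> parcs G" "pcas (p 0) es (p k)"
      using relpow_pcas[OF w] by blast
    then have "graph_distance G (p 0) (p k) \<le> ereal n"
      unfolding graph_distance_eq[OF wfs(1)] using pV by (intro INF_lower2[of es]) auto
    moreover have "ereal k \<le> graph_distance H (p 0) (p k)"
      unfolding graph_distance_eq[OF wfs(2)]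
    proof (rule INF_greatest)
      fix es assume es: "es \<in> {es. p 0 \<in> pverts H \<and> set es \<subseteq> parcs H \<and> pcas (p 0) es (p k)}"
      \<comment> \<open>Along an arc of the path the index grows by at most one.\<close>
      have "\<exists>j\<le>k. x = p j \<and> j \<le> l" if "(p 0, x) \<in> parcs H ^^ l" for l x
        using that
      proof (induction l arbitrary: x)
        case (Suc l)
        then obtain y where y: "(p 0, y) \<in> parcs H ^^ l" "(y, x) \<in> parcs H" by (auto elim: relpow_Suc_E)
        obtain j where j: "j \<le> k" "y = p j" "j \<le> l" using Suc.IH[OF y(1)] by blast
        obtain i where i: "i \<le> k" "x = p i" using y(2) by (auto simp: HV)
        have "(p j, p i) \<in> parcs G" using y(2) i j by (simp add: HV)
        then have "i \<le> Suc l" using adj i(1) j by auto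
        then show ?case using i by blast
      qed auto
      moreover have "(p 0, p k) \<in> parcs H ^^ length es" using pcas_relpow[of "p 0" es "p k" "parcs H"] es by blast
      ultimately obtain j where "j \<le> k" "p k = p j" "j \<le> length es" by blast
      then have "k \<le> length es" using inj by auto
      then show "ereal k \<le> ereal (length es)" by simp
    qed
    ultimately have "ereal k \<le> ereal n" using eq by (metis order_trans)
    then show ?thesis by simp
  qed simp
qed

section \<open>Paths avoiding a closed neighbourhood\<close>

lemma vwalk_rtrancl:
  assumes "vwalk p (with_proj G)" "set p \<subseteq> A"
  shows "(hd p, last p) \<in> (Restr (parcs G) A)\<^sup>*"
  using assms
proof (induction p rule: vwalk_induct)
  case (Cons u v es)
  then have "(v, last (v # es)) \<in> (Restr (parcs G) A)\<^sup>*" "(u, v) \<in> Restr (parcs G) A" by auto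
  then have "(u, last (v # es)) \<in> (Restr (parcs G) A)\<^sup>*" by (rule converse_rtrancl_into_rtrancl[rotated])
  then show ?case by simp
qed simp

lemma rtrancl_vpath:
  assumes "(x, y) \<in> (Restr (parcs G) A)\<^sup>*" "x \<in> A" "A \<subseteq> pverts G"
  shows "\<exists>p. vpath p (with_proj G) \<and> hd p = x \<and> last p = y \<and> set p \<subseteq> A"
proof -
  have "x \<in> A \<longrightarrow> (\<exists>p. vwalk p (with_proj G) \<and> hd p = x \<and> last p = y \<and> set p \<subseteq> A)"
    using assms(1)
  proof (induction rule: converse_rtrancl_induct)
    case base
    then show ?case using assms(3) by (intro impI exI[of _ "[y]"]) auto
  next
    case (step x z)
    then obtain p where p: "vwalk p (with_proj G)" "hd p = z" "last p = y" "set p \<subseteq> A" by blast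
    then have "p \<noteq> []" by (auto simp: vwalk_def)
    moreover have "vwalk (x # p) (with_proj G)"
      using p step.hyps(1) assms(3) by (intro vwalk_consI) auto
    ultimately show ?case using p step.hyps(1) by (intro impI exI[of _ "x # p"]) auto
  qed
  then obtain p where p: "vwalk p (with_proj G)" "hd p = x" "last p = y" "set p \<subseteq> A"
    using assms(2) by blast
  then have "vpath (vwalk_to_vpath p) (with_proj G)" by (intro vwalk_to_vpath_vpath)
  moreover have "set (vwalk_to_vpath p) \<subseteq> A" using p(4) by (auto dest: vwalk_to_vpath_subset)
  moreover have "hd (vwalk_to_vpath p) = x" "last (vwalk_to_vpath p) = y"
    using p by (simp_all add: vwalk_to_vpath_hd vwalk_to_vpath_last)
  ultimately show ?thesis by blast
qed

lemma joined_avoiding_iff: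
  assumes "simple_graph G"
  shows "joined_avoiding G x y z \<longleftrightarrow> linked_away G x y z"
proof -
  note s = simple_graphD[OF assms]
  have sub: "set p \<inter> closed_neighbourhood G z = {} \<longleftrightarrow> set p \<subseteq> away_from G z" if "set p \<subseteq> pverts G" for p
    using that s(4) by (auto simp: closed_neighbourhood_def neighbours_def away_from_def)
  show ?thesis
  proof
    assume "joined_avoiding G x y z"
    then obtain p where p: "vpath p (with_proj G)" "hd p = x" "last p = y" "set p \<inter> closed_neighbourhood G z = {}"
      by (auto simp: joined_avoiding_def)
    then have v: "vwalk p (with_proj G)" "set p \<subseteq> pverts G" "p \<noteq> []" by (auto simp: vpath_def vwalk_def)
    then have A: "set p \<subseteq> away_from G z" using sub p(4) by blast
    have "x \<in> away_from G z" using A v(3) p(2) by auto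
    then show "linked_away G x y z" using vwalk_rtrancl[OF v(1) A] p by (simp add: linked_away_def)
  next
    assume l: "linked_away G x y z"
    have V: "away_from G z \<subseteq> pverts G" by (auto simp: away_from_def)
    obtain p where p: "vpath p (with_proj G)" "hd p = x" "last p = y" "set p \<subseteq> away_from G z"
      using rtrancl_vpath[OF _ _ V] l unfolding linked_away_def by blast
    then show "joined_avoiding G x y z" using sub V unfolding joined_avoiding_def by blast
  qed
qed

lemma linked_away_end: "linked_away G x y z \<Longrightarrow> y \<in> away_from G z"
  by (auto simp: linked_away_def elim: rtranclE)

text \<open>Distinctness and membership of the three vertices follow from the links, as
  \<open>away_from G z\<close> consists of vertices of \<open>G\<close> other than
  \<open>z\<close>.\<close>

lemma AT_free_iff: assumes "simple_graph G" shows "AT_free G \<longleftrightarrow> \<not> has_AT G"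
proof -
  have "{x, y, z} \<subseteq> pverts G \<and> distinct [x, y, z]"
    if "linked_away G x y z" "linked_away G y z x" for x y z
    using that linked_away_end[OF that(1)] linked_away_end[OF that(2)]
    by (auto simp: linked_away_def away_from_def)
  then show ?thesis
    unfolding AT_free_def asteroidal_triple_def has_AT_def joined_avoiding_iff[OF assms] by blast
qed

section \<open>Segments between parallel lines\<close>

text \<open>As \<open>q - p\<close> is no multiple of \<open>d\<close>, a common point has the same
  parameter \<open>u\<close> on both segments. At equal parameters the offset between the segments
  runs linearly from \<open>s - s'\<close> to \<open>t - t'\<close>, and it vanishes somewhere iff
  these do not have the same strict sign. Common end points count as intersections, whence
  \<le>.\<close>

lemma segments_between_parallel_lines:
  fixes p q d :: "real ^ 2"
  assumes d: "d \<noteq> 0" and indep: "\<And>c e. c *\<^sub>R (q - p) = e *\<^sub>R d \<Longrightarrow> c = 0"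
  shows "closed_segment (p + s *\<^sub>R d) (q + t *\<^sub>R d) \<inter> closed_segment (p + s' *\<^sub>R d) (q + t' *\<^sub>R d) \<noteq> {} \<longleftrightarrow>
    (s - s') * (t - t') \<le> 0"
proof -
  define pt where "pt s t u = (1 - u) *\<^sub>R (p + s *\<^sub>R d) + u *\<^sub>R (q + t *\<^sub>R d)" for s t u
  have diff: "pt s t u - pt s' t' w =
      (u - w) *\<^sub>R (q - p) - ((1 - w) * s' + w * t' - (1 - u) * s - u * t) *\<^sub>R d" for u w
    by (simp add: pt_def algebra_simps)
  have same: "pt s t u = pt s' t' w \<longleftrightarrow> u = w \<and> (1 - u) * (s - s') + u * (t - t') = 0" for u w
  proof
    assume "pt s t u = pt s' t' w"
    then have "pt s t u - pt s' t' w = 0" by simp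
    then have e: "(u - w) *\<^sub>R (q - p) = ((1 - w) * s' + w * t' - (1 - u) * s - u * t) *\<^sub>R d"
      unfolding diff by simp
    then have "u = w" using indep[OF e] by simp
    moreover from this have "(1 - w) * s' + w * t' - (1 - u) * s - u * t = 0" using e d by simp
    ultimately show "u = w \<and> (1 - u) * (s - s') + u * (t - t') = 0" by (simp add: algebra_simps)
  next
    assume a: "u = w \<and> (1 - u) * (s - s') + u * (t - t') = 0"
    then have "(1 - w) * s' + w * t' - (1 - u) * s - u * t = 0" by (auto simp: algebra_simps)
    then have "pt s t u - pt s' t' w = 0" unfolding diff using a by simp
    then show "pt s t u = pt s' t' w" by simp
  qed
  have "closed_segment (p + s *\<^sub>R d) (q + t *\<^sub>R d) \<inter> closed_segment (p + s' *\<^sub>R d) (q + t' *\<^sub>R d) \<noteq> {} \<longleftrightarrow>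
      (\<exists>u w. 0 \<le> u \<and> u \<le> 1 \<and> 0 \<le> w \<and> w \<le> 1 \<and> pt s t u = pt s' t' w)"
    unfolding closed_segment_def pt_def by blast
  also have "\<dots> \<longleftrightarrow> (\<exists>u. 0 \<le> u \<and> u \<le> 1 \<and> (1 - u) * (s - s') + u * (t - t') = 0)"
    unfolding same by auto
  also have "\<dots> \<longleftrightarrow> (s - s') * (t - t') \<le> 0"
  proof
    assume "\<exists>u. 0 \<le> u \<and> u \<le> 1 \<and> (1 - u) * (s - s') + u * (t - t') = 0"
    then obtain u where u: "0 \<le> u" "u \<le> 1" "(1 - u) * (s - s') + u * (t - t') = 0" by blast
    have pos: "0 < (1 - u) * a + u * b" if ab: "0 < a" "0 < b" for a b
    proof (cases "u = 0")
      case False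
      then have "0 \<le> (1 - u) * a" "0 < u * b" using u ab by (auto intro: mult_nonneg_nonneg)
      then show ?thesis by linarith
    qed (use ab in simp)
    show "(s - s') * (t - t') \<le> 0"
    proof (rule ccontr)
      assume "\<not> ?thesis"
      then consider "0 < s - s'" "0 < t - t'" | "s - s' < 0" "t - t' < 0"
        by (auto simp: not_le zero_less_mult_iff)
      then show False
      proof cases
        case 1
        then show False using pos[OF 1] u(3) by simp
      next
        case 2
        then have "0 < (1 - u) * (s' - s) + u * (t' - t)" by (intro pos) auto
        then show False using u(3) by (simp add: algebra_simps)
      qed
    qed
  next
    assume le: "(s - s') * (t - t') \<le> 0"
    show "\<exists>u. 0 \<le> u \<and> u \<le> 1 \<and> (1 - u) * (s - s') + u * (t - t') = 0"
    proof (cases "s - s' = t - t'")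
      case True
      then have "(s - s')\<^sup>2 \<le> 0" using le by (simp add: power2_eq_square)
      then have "s - s' = 0" by simp
      then show ?thesis by (intro exI[of _ 0]) simp
    next
      case False
      \<comment> \<open>The zero of the linear offset.\<close>
      define u where "u = (s - s') / ((s - s') - (t - t'))"
      have ne: "(s - s') - (t - t') \<noteq> 0" using False by simp
      have "0 \<le> u \<and> u \<le> 1"
      proof (cases "s - s' < t - t'")
        case True
        then have "s - s' \<le> 0" "0 \<le> t - t'" using le by (auto simp: mult_le_0_iff)
        then show ?thesis using True by (simp add: u_def divide_simps)
      next
        case False
        then have "0 \<le> s - s'" "t - t' \<le> 0" using le ne by (auto simp: mult_le_0_iff)
        then show ?thesis using ne by (simp add: u_def divide_simps)
      qed
      moreover have "(1 - u) * (s - s') + u * (t - t') = 0"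
        using ne by (simp add: u_def field_simps)
      ultimately show ?thesis by blast
    qed
  qed
  finally show ?thesis .
qed

text \<open>End points may coincide here, so the positions need not form a
  \<open>perm_model\<close>; the sign condition is enough for excluding asteroidal triples.\<close>

lemma permutation_graphE:
  assumes "permutation_graph G"
  shows "\<exists>s t :: 'a \<Rightarrow> real. \<forall>u\<in>pverts G. \<forall>v\<in>pverts G. u \<noteq> v \<longrightarrow>
    ((u, v) \<in> parcs G \<longleftrightarrow> (s u - s v) * (t u - t v) \<le> 0)"
proof -
  obtain L M a b where LM: "parallel_lines L M" and ab: "\<And>v. v \<in> pverts G \<Longrightarrow> a v \<in> L \<and> b v \<in> M"
    and e: "\<And>u v. u \<in> pverts G \<Longrightarrow> v \<in> pverts G \<Longrightarrow> u \<noteq> v \<Longrightarrow>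
      (u, v) \<in> parcs G \<longleftrightarrow> closed_segment (a u) (b u) \<inter> closed_segment (a v) (b v) \<noteq> {}"
    using assms unfolding permutation_graph_def by metis
  obtain p q d where d: "d \<noteq> 0" "L = range (\<lambda>s::real. p + s *\<^sub>R d)" "M = range (\<lambda>s::real. q + s *\<^sub>R d)"
    "L \<inter> M = {}" using LM unfolding parallel_lines_def by blast
  \<comment> \<open>If \<open>q - p\<close> were a multiple of \<open>d\<close>, the point
    \<open>q\<close> would lie on both lines.\<close>
  have indep: "c = 0" if c: "c *\<^sub>R (q - p) = e *\<^sub>R d" for c e
  proof (rule ccontr)
    assume "c \<noteq> 0"
    then have "q - p = (e / c) *\<^sub>R d" using c by (metis (no_types, lifting) divide_inverse_commute scaleR_scaleR scaleR_one left_inverse)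
    then have "q = p + (e / c) *\<^sub>R d" by (simp add: algebra_simps)
    then have "q \<in> L" using d(2) by blast
    moreover have "q = q + 0 *\<^sub>R d" by simp
    then have "q \<in> M" using d(3) by blast
    ultimately show False using d(4) by blast
  qed
  have "\<exists>s t. a v = p + s *\<^sub>R d \<and> b v = q + t *\<^sub>R d" if "v \<in> pverts G" for v
    using ab[OF that] d(2,3) by blast
  then obtain s t where st: "\<And>v. v \<in> pverts G \<Longrightarrow> a v = p + s v *\<^sub>R d \<and> b v = q + t v *\<^sub>R d" by metis
  have "(u, v) \<in> parcs G \<longleftrightarrow> (s u - s v) * (t u - t v) \<le> 0"
    if uv: "u \<in> pverts G" "v \<in> pverts G" "u \<noteq> v" for u v
    using e[OF uv] segments_between_parallel_lines[OF d(1) indep] st[OF uv(1)] st[OF uv(2)] by simp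
  then show ?thesis by blast
qed

lemma perm_model_permutation_graph:
  assumes "perm_model G s t" shows "permutation_graph G"
proof -
  define d :: "real ^ 2" where "d = axis 1 1"
  define q :: "real ^ 2" where "q = axis 2 1"
  have d: "d \<noteq> 0" "d $ 2 = 0" "d $ 1 = 1" and q: "q $ 2 = 1"
    by (simp_all add: d_def q_def axis_def vec_eq_iff exI[of _ 1])
  have indep: "c = 0" if "c *\<^sub>R (q - 0) = e *\<^sub>R d" for c e
  proof -
    have "(c *\<^sub>R (q - 0)) $ 2 = (e *\<^sub>R d) $ 2" using that by simp
    then show ?thesis using d q by simp
  qed
  let ?L = "range (\<lambda>x::real. 0 + x *\<^sub>R d)" and ?M = "range (\<lambda>x::real. q + x *\<^sub>R d)"
  have "?L \<inter> ?M = {}"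
  proof (rule ccontr)
    assume "?L \<inter> ?M \<noteq> {}"
    then obtain x y where "0 + x *\<^sub>R d = q + y *\<^sub>R d" by auto
    then have "(0 + x *\<^sub>R d) $ 2 = (q + y *\<^sub>R d) $ 2" by simp
    then show False using d q by simp
  qed
  then have "parallel_lines ?L ?M" using d(1) unfolding parallel_lines_def by blast
  moreover have "(u, v) \<in> parcs G \<longleftrightarrow>
      closed_segment (0 + real_of_int (s u) *\<^sub>R d) (q + real_of_int (t u) *\<^sub>R d) \<inter>
      closed_segment (0 + real_of_int (s v) *\<^sub>R d) (q + real_of_int (t v) *\<^sub>R d) \<noteq> {}"
    if uv: "u \<in> pverts G" "v \<in> pverts G" "u \<noteq> v" for u v
  proof -
    have "(u, v) \<in> parcs G \<longleftrightarrow>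
        (real_of_int (s u) - real_of_int (s v)) * (real_of_int (t u) - real_of_int (t v)) \<le> 0"
      using perm_modelD[OF assms uv] by (auto simp: mult_le_0_iff)
    moreover have "closed_segment (0 + real_of_int (s u) *\<^sub>R d) (q + real_of_int (t u) *\<^sub>R d) \<inter>
        closed_segment (0 + real_of_int (s v) *\<^sub>R d) (q + real_of_int (t v) *\<^sub>R d) \<noteq> {} \<longleftrightarrow>
        (real_of_int (s u) - real_of_int (s v)) * (real_of_int (t u) - real_of_int (t v)) \<le> 0"
      by (rule segments_between_parallel_lines[OF d(1) indep])
    ultimately show ?thesis by (simp only:)
  qed
  ultimately show ?thesis
    unfolding permutation_graph_def by (intro exI[of _ ?L] exI[of _ ?M]
      exI[of _ "\<lambda>v. 0 + real_of_int (s v) *\<^sub>R d"] exI[of _ "\<lambda>v. q + real_of_int (t v) *\<^sub>R d"]) blast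
qed

text \<open>
  Pairwise non-adjacent vertices of a permutation graph are linearly ordered from left to right, and
  a path between the outer two of a triple cannot avoid the closed neighbourhood of the middle one.
\<close>

lemma permutation_graph_no_AT:
  assumes "simple_graph G" "permutation_graph G"
  shows "\<not> has_AT G"
proof
  assume "has_AT G"
  then obtain x y z where xyz: "linked_away G x y z" "linked_away G y z x" "linked_away G x z y"
    by (auto simp: has_AT_def)
  obtain s t :: "'a \<Rightarrow> real" where st: "\<And>u v. u \<in> pverts G \<Longrightarrow> v \<in> pverts G \<Longrightarrow> u \<noteq> v \<Longrightarrow>
      (u, v) \<in> parcs G \<longleftrightarrow> (s u - s v) * (t u - t v) \<le> 0"
    using permutation_graphE[OF assms(2)] by blast
  define left where "left u v \<longleftrightarrow> s u < s v \<and> t u < t v" for u v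
  have nonadj: "left u v \<or> left v u" if "u \<in> away_from G v" "v \<in> pverts G" for u v
    using st[of u v] that by (auto simp: away_from_def left_def not_le zero_less_mult_iff)
  have adj: "\<not> left u v" "\<not> left v u" if "(u, v) \<in> parcs G" for u v
  proof -
    have "u \<in> pverts G" "v \<in> pverts G" "u \<noteq> v" using simple_graphD(2,3,5)[OF assms(1)] that by metis+
    then have "(s u - s v) * (t u - t v) \<le> 0" using st that by blast
    then show "\<not> left u v" "\<not> left v u" by (auto simp: left_def mult_le_0_iff)
  qed
  \<comment> \<open>A vertex left of \<open>c\<close> is left of every vertex right of
    \<open>c\<close>, hence not adjacent to it; so a walk away from \<open>c\<close> cannot change
    sides.\<close>
  have stay: "left b c \<longleftrightarrow> left a c" if l: "linked_away G a b c" and c: "c \<in> pverts G" for a b c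
  proof -
    have "(a, b) \<in> (Restr (parcs G) (away_from G c))\<^sup>*" using l by (simp add: linked_away_def)
    then show ?thesis
    proof induction
      case (step v w)
      then have e: "(v, w) \<in> parcs G" "v \<in> away_from G c" "w \<in> away_from G c" by auto
      have "left v c \<longleftrightarrow> left w c"
        using nonadj[OF e(2) c] nonadj[OF e(3) c] adj[OF e(1)] by (auto simp: left_def)
      then show ?case using step.IH by simp
    qed simp
  qed
  have V: "x \<in> pverts G" "y \<in> pverts G" "z \<in> pverts G" "x \<in> away_from G z" "y \<in> away_from G z" "x \<in> away_from G y"
    using xyz linked_away_end[OF xyz(1)] linked_away_end[OF xyz(2)]
    by (auto simp: linked_away_def away_from_def)
  have "left x z \<or> left z x" "left y z \<or> left z y" "left x y \<or> left y x"
    using nonadj V by blast+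
  moreover have "left y z \<longleftrightarrow> left x z" "left z x \<longleftrightarrow> left y x" "left z y \<longleftrightarrow> left x y"
    using stay xyz V by blast+
  ultimately show False by (auto simp: left_def)
qed


section \<open>Standard and pruned decompositions\<close>

lemma pverts_initial_node [simp]: "pverts (initial_node G) = Inl ` pverts G"
  by (simp add: initial_node_def)

lemma parcs_initial_node [simp]: "(Inl u, Inl v) \<in> parcs (initial_node G) \<longleftrightarrow> (u, v) \<in> parcs G"
  by (force simp: initial_node_def map_prod_def)

lemma simple_graph_initial_node: assumes "simple_graph G" shows "simple_graph (initial_node G)"
  using simple_graphD[OF assms]
  unfolding simple_graph_def by (auto simp: initial_node_def sym_def irrefl_def)

lemma graph_connected_initial_node:
  assumes "graph_connected G" shows "graph_connected (initial_node G)"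
proof -
  have "(Inl u, Inl v) \<in> (parcs (initial_node G))\<^sup>*" if "(u, v) \<in> (parcs G)\<^sup>*" for u v
    using that by induction (auto intro: rtrancl_into_rtrancl)
  then show ?thesis using assms by auto
qed

lemma embedding_initial_node: "embedding projl (initial_node G) G"
  by (auto simp: embedding_def inj_on_def)

lemma perm_model_initial_node:
  assumes "perm_model (initial_node G) s t"
  shows "perm_model G (s \<circ> Inl) (t \<circ> Inl)"
  by (rule perm_modelI) (use perm_modelD[OF assms, of "Inl _" "Inl _"] in auto)

lemma star_at_join:
  assumes "simple_graph X" "simple_graph Y" "pverts X \<inter> pverts Y = {m}"
    and "star_at m X" "star_at c Y" "c \<noteq> m"
  shows "star_at c (join m X Y)"
proof -
  have mc: "m \<in> pverts X" "m \<in> pverts Y" "c \<in> pverts Y" "c \<notin> pverts X"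
    using assms(3,5,6) by (auto simp: star_at_def)
  have X: "(x, y) \<in> parcs X \<longleftrightarrow> x \<in> pverts X \<and> y \<in> pverts X \<and> x \<noteq> y \<and> (x = m \<or> y = m)" for x y
    using assms(4) by (auto simp: star_at_def)
  have Y: "(x, y) \<in> parcs Y \<longleftrightarrow> x \<in> pverts Y \<and> y \<in> pverts Y \<and> x \<noteq> y \<and> (x = c \<or> y = c)" for x y
    using assms(5) by (auto simp: star_at_def)
  have "(x, y) \<in> parcs (join m X Y) \<longleftrightarrow>
      x \<in> pverts (join m X Y) \<and> y \<in> pverts (join m X Y) \<and> x \<noteq> y \<and> (x = c \<or> y = c)" for x y
    unfolding parcs_join X Y pverts_join using mc assms(6) by auto
  then have "parcs (join m X Y) =
      {c} \<times> (pverts (join m X Y) - {c}) \<union> (pverts (join m X Y) - {c}) \<times> {c}"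
    using mc assms(6) by auto
  then show ?thesis using mc assms(6) by (auto simp: star_at_def)
qed

lemma decomposes_split_decomposition:
  assumes "split_decomposition G D" "decomposes {initial_node G} (initial_node G)"
    and "graph_connected (initial_node G)"
  shows "decomposes D (initial_node G) \<and> (\<forall>X\<in>D. graph_connected X)"
  using assms(1)[unfolded split_decomposition_def]
proof induction
  case base
  then show ?case using assms by auto
next
  case (step D D')
  then show ?case using decomposes_split_step by blast
qed

lemma good_decomposition_nodes:
  assumes "decomposes D H" "\<forall>X\<in>D. graph_connected X" "induced_paths_shortest (parcs H)"
    and "\<forall>X\<in>D. prime_graph X \<or> clique_graph X \<or> star_graph X" "X \<in> D"
  shows "clique_graph X \<or> (\<exists>c. star_at c X)"
proof -
  obtain f where "embedding f X H" using decomposes_node_embedding[OF assms(1,5)] by blast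
  then have "induced_paths_shortest (parcs X)"
    using induced_paths_shortest_embedding decomposesD(7)[OF assms(1,5)] assms(3) by blast
  then have "clique_graph X \<or> star_graph X"
    using node_clique_or_star[OF decomposesD(7)[OF assms(1,5)]] assms(2,4,5) by blast
  then show ?thesis by (simp add: star_graph_iff)
qed

text \<open>Two stars glued at a centre and a leaf form a larger star, so the decomposition is not standard.\<close>

lemma standard_decomposition_reduced:
  assumes "standard_decomposition G D" "decomposes D (initial_node G)"
    and "X \<in> D" "Y \<in> D" "X \<noteq> Y" "m \<in> pverts X" "m \<in> pverts Y" "star_at m X" "star_at c Y"
  shows "c = m"
proof (rule ccontr)
  assume c: "c \<noteq> m"
  define Z where "Z = join m X Y"
  define D0 where "D0 = D - {X, Y} \<union> {Z}"
  note sv = shared_vertex_marker[OF assms(2-7)]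
  have n: "node_graph X" "node_graph Y" "simple_graph X" "simple_graph Y"
    using decomposesD(6,7)[OF assms(2)] assms(3,4) by blast+
  have i: "pverts X \<inter> pverts Y = {m}" using sv(4) assms(6,7) by blast
  obtain k where k: "m = Inr k" using sv(1) by (auto simp: shared_marker_def)
  have "decomposes D0 (initial_node G)"
    using decomposes_merge[OF assms(2-7)] by (simp add: D0_def Z_def)
  then have "split_decomposition G D0" unfolding split_decomposition_def by (rule decomposes_split_steps)
  moreover have "star_graph Z"
    using star_at_join[OF n(3,4) i assms(8,9) c] star_graph_iff by (auto simp: Z_def)
  ultimately have "good_decomposition G D0"
    using assms(1) unfolding standard_decomposition_def good_decomposition_def D0_def by blast
  moreover have "simple_split_step D0 D"
    unfolding simple_split_step_def
  proof (intro bexI[of _ Z] exI conjI)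
    show "Z \<in> D0" by (simp add: D0_def)
    show "is_split Z (pverts X - {m}) (pverts Y - {m})"
      unfolding Z_def by (rule is_split_join(1)[OF n(1,2) i])
    show "\<forall>K\<in>D0. Inr k \<notin> pverts K"
      using sv(3) unfolding D0_def Z_def k[symmetric] by auto
    \<comment> \<open>A node containing all of \<open>X\<close> except \<open>m\<close> would share
      two vertices with \<open>X\<close>.\<close>
    have "Z \<notin> D - {X, Y}"
    proof
      assume Z: "Z \<in> D - {X, Y}"
      obtain v where v: "v \<in> pverts X" "v \<noteq> m" using node_graph_third[OF n(1)] by blast
      obtain w where w: "w \<in> pverts X" "w \<noteq> m" "w \<noteq> v" using node_graph_third[OF n(1)] by metis
      have "v \<in> pverts Z" "w \<in> pverts Z" using v w by (auto simp: Z_def)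
      then show False using shared_vertex_marker(4)[OF assms(2,3), of Z v w] Z v w by auto
    qed
    then have "D0 - {Z} = D - {X, Y}" unfolding D0_def by blast
    then show "D = D0 - {Z} \<union> {split_piece Z (pverts X - {m}) (Inr k), split_piece Z (pverts Y - {m}) (Inr k)}"
      using is_split_join(2,3)[OF n(1,2) i] assms(3,4) unfolding Z_def k[symmetric] by auto
  qed
  then have "strict_refinement D D0" by (simp add: strict_refinement_def)
  ultimately show False using assms(1) unfolding standard_decomposition_def by blast
qed

section \<open>Pruning\<close>

lemma neighbours_decomposition_tree:
  "L \<in> D \<Longrightarrow> neighbours (decomposition_tree D) {L} = {K \<in> D. (L, K) \<in> node_adjacency}"
  by (auto simp: neighbours_def parcs_decomposition_tree node_adjacency_def)

text \<open>Without its leaf, the graph is an induced subgraph of the former one, \<open>m\<close>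
  being represented by a neighbour in \<open>L\<close>; so asteroidal triples pass upwards. Models
  do as well, by substitution, because a leaf in which \<open>m\<close> is universal is a clique or
  a star centred at \<open>m\<close>.\<close>

lemma prune_step_decomposes:
  assumes "decomposes D H" "prune_step D D'" "\<forall>X\<in>D. clique_graph X \<or> (\<exists>c. star_at c X)"
  shows "\<exists>H'. decomposes D' H' \<and> (has_AT H' \<longrightarrow> has_AT H) \<and>
    ((\<exists>s t. perm_model H' s t) \<longrightarrow> (\<exists>s t. perm_model H s t))"
proof -
  obtain L K m where L: "L \<in> D" and K: "neighbours (decomposition_tree D) {L} = {K}"
    and m: "shared_marker L K m" "universal_vertex L m" and D': "D' = D - {L}"
    using assms(2) unfolding prune_step_def prunable_leaf_def by blast
  have K': "K \<in> D" "(L, K) \<in> node_adjacency"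
    and only: "\<And>Z. Z \<in> D \<Longrightarrow> (L, Z) \<in> node_adjacency \<Longrightarrow> Z = K"
    using K unfolding neighbours_decomposition_tree[OF L] by auto
  have m': "K \<noteq> L" "m \<in> pverts K" "m \<in> pverts L"
    using m(1) K'(2) by (auto simp: shared_marker_def node_adjacency_def)
  obtain a D1 H1 where e: "D = insert L D1" "L \<notin> D1" "decomposes D1 H1" "a \<in> pverts L" "a \<in> pverts K"
    "pverts L \<inter> pverts H1 = {a}" "H = join a L H1"
    using leaf_cut[OF assms(1) L K'] only by metis
  have "a = m" using shared_vertex_marker(4)[OF assms(1) K'(1) L m' e(5,4)] .
  have "D' = D1" using D' e(1,2) by simp
  note nL = decomposesD(6)[OF assms(1) L]
  have sL: "simple_graph L" using nL by (simp add: node_graph_def)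
  have i: "pverts H1 \<inter> pverts L = {m}" and H: "H = join m H1 L"
    using e(6,7) \<open>a = m\<close> by (simp_all add: Int_commute join_commute)
  note s1 = decomposesD(2)[OF e(3)]
  obtain w where "(m, w) \<in> parcs L" using nL m'(3) by (auto simp: node_graph_def)
  then have "has_AT H1 \<longrightarrow> has_AT H"
    using has_AT_embedding[OF embedding_join[OF s1 sL i]] H by blast
  moreover have "clique_graph L \<or> star_at m L"
  proof -
    have "3 \<le> card (pverts L)" using nL by (simp add: node_graph_def)
    then show ?thesis using assms(3) L star_at_universal m(2) by metis
  qed
  then have "(\<exists>s t. perm_model H1 s t) \<longrightarrow> (\<exists>s t. perm_model H s t)"
    using perm_model_substitute[OF s1 sL i _ m(2)] H by blast
  ultimately show ?thesis using e(3) \<open>D' = D1\<close> by blast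
qed

lemma prune_steps_decomposes:
  assumes "prune_step\<^sup>*\<^sup>* D P" "decomposes D H" "\<forall>X\<in>D. clique_graph X \<or> (\<exists>c. star_at c X)"
  shows "P \<subseteq> D \<and> (\<exists>H'. decomposes P H' \<and> (has_AT H' \<longrightarrow> has_AT H) \<and>
    ((\<exists>s t. perm_model H' s t) \<longrightarrow> (\<exists>s t. perm_model H s t)))"
  using assms(1)
proof induction
  case base
  then show ?case using assms(2) by blast
next
  case (step P Q)
  obtain H' where H': "decomposes P H'" "has_AT H' \<longrightarrow> has_AT H"
    "(\<exists>s t. perm_model H' s t) \<longrightarrow> (\<exists>s t. perm_model H s t)" and P: "P \<subseteq> D" using step.IH by blast
  have "\<forall>X\<in>P. clique_graph X \<or> (\<exists>c. star_at c X)" using assms(3) P by blast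
  then obtain H'' where "decomposes Q H''" "has_AT H'' \<longrightarrow> has_AT H'"
    "(\<exists>s t. perm_model H'' s t) \<longrightarrow> (\<exists>s t. perm_model H' s t)"
    using prune_step_decomposes[OF H'(1) step.hyps(2)] by blast
  moreover have "Q \<subseteq> P" using step.hyps(2) by (auto simp: prune_step_def)
  ultimately show ?case using H' P by blast
qed

lemma prune_terminates:
  assumes "finite D"
  shows "\<exists>P. prune_step\<^sup>*\<^sup>* D P \<and> (\<nexists>L. prunable_leaf P L)"
  using assms
proof (induction "card D" arbitrary: D rule: less_induct)
  case less
  show ?case
  proof (cases "\<exists>L. prunable_leaf D L")
    case True
    then obtain L where L: "prunable_leaf D L" by blast
    then have "L \<in> D" by (simp add: prunable_leaf_def)
    then have "card (D - {L}) < card D" using card_Diff1_less[OF less.prems] by blast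
    then obtain P where P: "prune_step\<^sup>*\<^sup>* (D - {L}) P" "\<nexists>L. prunable_leaf P L"
      using less.hyps less.prems by blast
    have "prune_step D (D - {L})" using L by (auto simp: prune_step_def)
    then show ?thesis using P by (meson converse_rtranclp_into_rtranclp)
  qed blast
qed

text \<open>If \<open>X\<close> shared no second vertex with other nodes, \<open>Y\<close> would be
  its only neighbour in the tree and \<open>X\<close> a prunable leaf.\<close>

lemma pruned_nodes_locale:
  assumes "decomposes P H" "\<forall>X\<in>P. clique_graph X \<or> (\<exists>c. star_at c X)" "\<nexists>L. prunable_leaf P L"
    and "\<And>X Y m c. X \<in> P \<Longrightarrow> Y \<in> P \<Longrightarrow> X \<noteq> Y \<Longrightarrow> m \<in> pverts X \<Longrightarrow> m \<in> pverts Y \<Longrightarrow>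
      star_at m X \<Longrightarrow> star_at c Y \<Longrightarrow> c = m"
  shows "pruned_nodes P"
proof
  fix X Y m assume X: "X \<in> P" "Y \<in> P" "X \<noteq> Y" "m \<in> pverts X" "m \<in> pverts Y" and u: "universal_vertex X m"
  show "\<exists>a\<in>pverts X. a \<noteq> m \<and> (\<exists>Z\<in>P. Z \<noteq> X \<and> a \<in> pverts Z)"
  proof (rule ccontr)
    assume no: "\<not> ?thesis"
    note sv = shared_vertex_marker[OF assms(1) X]
    have "(X, Z) \<in> node_adjacency \<longleftrightarrow> Z = Y" if Z: "Z \<in> P" for Z
    proof
      assume "(X, Z) \<in> node_adjacency"
      then obtain a where a: "X \<noteq> Z" "a \<in> pverts X" "a \<in> pverts Z"
        using node_adjacency_iff[OF assms(1) X(1) Z] by blast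
      then have "a = m" using no Z by metis
      then show "Z = Y" using sv(3)[OF Z] a by blast
    next
      assume "Z = Y"
      then show "(X, Z) \<in> node_adjacency" using node_adjacency_iff[OF assms(1) X(1,2)] X by blast
    qed
    then have "neighbours (decomposition_tree P) {X} = {Y}"
      unfolding neighbours_decomposition_tree[OF X(1)] using X(2) by auto
    then have "prunable_leaf P X" using X(1) sv(1) u unfolding prunable_leaf_def by blast
    then show False using assms(3) by blast
  qed
qed (use assms in blast)+

section \<open>Existence of a standard decomposition\<close>

text \<open>A decomposition with the most nodes admits no further split, so all its nodes are prime
  and it is good. A good one with the fewest nodes is standard, because refinement increases the
  number of nodes.\<close>

lemma standard_decomposition_exists:
  assumes "\<And>D. split_decomposition G D \<Longrightarrow> finite D \<and> finite (all_verts D) \<and> card D \<le> N"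
  shows "\<exists>D. standard_decomposition G D"
proof -
  have "split_decomposition G {initial_node G}" by (simp add: split_decomposition_def)
  moreover have "\<forall>D. split_decomposition G D \<longrightarrow> card D < Suc N" using assms by (simp add: less_Suc_eq_le)
  ultimately obtain D where D: "split_decomposition G D"
    "\<forall>D'. split_decomposition G D' \<longrightarrow> card D' \<le> card D"
    using ex_has_greatest_nat[of "split_decomposition G" "{initial_node G}" card "Suc N"] by blast
  have "prime_graph H" if H: "H \<in> D" for H
  proof (rule ccontr)
    assume "\<not> prime_graph H"
    then obtain V1 V2 where sp: "is_split H V1 V2" by (auto simp: prime_graph_def)
    have "finite {n. Inr n \<in> all_verts D}"
      using assms[OF D(1)] by (intro finite_vimageI[of _ Inr, unfolded vimage_def]) auto
    then obtain n where "n \<notin> {n. Inr n \<in> all_verts D}" using ex_new_if_finite infinite_UNIV_nat by metis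
    then have n: "\<forall>K\<in>D. Inr n \<notin> pverts K" by blast
    define D' where "D' = (D - {H}) \<union> {split_piece H V1 (Inr n), split_piece H V2 (Inr n)}"
    have "simple_split_step D D'" using H sp n unfolding simple_split_step_def D'_def by blast
    moreover from this have "split_decomposition G D'"
      using D(1) unfolding split_decomposition_def by (rule rtranclp.rtrancl_into_rtrancl[rotated])
    ultimately show False using split_step_card[of D D'] assms[OF D(1)] D(2) by force
  qed
  then have "good_decomposition G D" using D(1) by (simp add: good_decomposition_def)
  then obtain D where D: "good_decomposition G D" "\<And>D'. good_decomposition G D' \<Longrightarrow> card D \<le> card D'"
    using ex_has_least_nat[of "good_decomposition G" D card] by blast
  have mono: "finite D2 \<and> card D1 < card D2" if "simple_split_step\<^sup>+\<^sup>+ D1 D2" "finite D1" for D1 D2 :: "'a node set"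
    using that
  proof induction
    case (base D2)
    then show ?case using split_step_card[of D1 D2] by simp
  next
    case (step D2 D3)
    then show ?case using split_step_card[of D2 D3] by simp
  qed
  have "\<not> strict_refinement D D0" if D0: "good_decomposition G D0" for D0
  proof
    assume "strict_refinement D D0"
    moreover have "finite D0" using D0 assms by (simp add: good_decomposition_def)
    ultimately have "card D0 < card D" using mono by (simp add: strict_refinement_def)
    then show False using D(2)[OF D0] by simp
  qed
  then show ?thesis using D(1) by (auto simp: standard_decomposition_def)
qed

section \<open>Graphs with at most two vertices\<close>

text \<open>A split needs two vertices on each side, so the initial node is never split.\<close>

lemma small_graph_decomposition:
  assumes "card (pverts G) \<le> 2" "split_decomposition G D"
  shows "D = {initial_node G}"
  using assms(2)[unfolded split_decomposition_def]
proof induction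
  case (step D D')
  then obtain V1 V2 where "is_split (initial_node G) V1 V2" unfolding simple_split_step_def by blast
  then have V: "V1 \<union> V2 = Inl ` pverts G" "V1 \<inter> V2 = {}" "1 < card V1" "1 < card V2"
    by (auto simp: is_split_def)
  then have "finite V1" "finite V2" by (simp_all add: card_ge_0_finite)
  then have "card (Inl ` pverts G :: ('a + nat) set) = card V1 + card V2"
    using V card_Un_disjoint by metis
  then show ?case using V assms(1) by (simp add: card_image)
qed simp

lemma path_graph_singleton: "path_graph (decomposition_tree {X})"
  unfolding path_graph_decomposition_tree
  by (intro exI[of _ "[X]"]) (auto simp: path_arcs_def node_adjacency_def)

text \<open>A connected graph on at most two vertices is complete, and reversing one order inverts
  every pair.\<close>

lemma small_graph_permutation:
  assumes "simple_graph G" "graph_connected G" "card (pverts G) \<le> 2"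
  shows "permutation_graph G"
proof -
  note s = simple_graphD[OF assms(1)]
  obtain g :: "'a \<Rightarrow> int" and n where g: "inj_on g (pverts G)"
    using finite_ranking[OF s(1)] by metis
  have "(u, v) \<in> parcs G" if uv: "u \<in> pverts G" "v \<in> pverts G" "u \<noteq> v" for u v
  proof -
    have "(u, v) \<in> (parcs G)\<^sup>*" using assms(2) uv by blast
    then obtain w where w: "(u, w) \<in> parcs G" using uv(3) by (auto elim: converse_rtranclE)
    have "pverts G = {u, v}" using card_seteq[OF s(1), of "{u, v}"] uv assms(3) by simp
    moreover have "w \<in> pverts G" "w \<noteq> u" using w s(3,5) by metis+
    ultimately have "w = v" by blast
    then show ?thesis using w by simp
  qed
  then have "perm_model G g (\<lambda>v. - g v)"
    using inj_onD[OF g] by (intro perm_modelI) fastforce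
  then show ?thesis by (rule perm_model_permutation_graph)
qed

theorem theorem6:
  fixes G :: "'a pair_pre_digraph"
  assumes "pair_graph G"
    and "Digraph_Component.connected (with_proj G)"
    and "distance_hereditary G"
  shows "(\<exists>T. pruned_decomposition_tree G T) \<and>
    (permutation_graph G \<longleftrightarrow> AT_free G) \<and>
    (\<forall>T. pruned_decomposition_tree G T \<longrightarrow> (AT_free G \<longleftrightarrow> path_graph T))"
proof -
  let ?I = "initial_node G"
  note sG = simple_graph_pair_graph[OF assms(1)]
  have conn: "graph_connected G" using assms(2) connected_with_proj[OF sG] by blast
  note sI = simple_graph_initial_node[OF sG] and cI = graph_connected_initial_node[OF conn]
  have perm_AT_free: "permutation_graph G \<Longrightarrow> AT_free G"
    using permutation_graph_no_AT[OF sG] AT_free_iff[OF sG] by blast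
  \<comment> \<open>Both claims are shown for every outcome \<open>P\<close> of pruning; together
    with \<open>perm_AT_free\<close> they close the circle of implications.\<close>
  have "(\<exists>D. standard_decomposition G D \<and> finite D) \<and>
    (\<forall>D P. standard_decomposition G D \<longrightarrow> prune_step\<^sup>*\<^sup>* D P \<longrightarrow> (\<nexists>L. prunable_leaf P L) \<longrightarrow>
      (path_graph (decomposition_tree P) \<longrightarrow> permutation_graph G) \<and>
      (\<not> path_graph (decomposition_tree P) \<longrightarrow> \<not> AT_free G))"
  \<comment> \<open>\<open>node_graph\<close> requires three vertices, so smaller graphs, whose only
    node is the initial one, are handled directly.\<close>
  proof (cases "card (pverts G) \<le> 2")
    case True
    note D = small_graph_decomposition[OF True]
    have "finite D \<and> finite (all_verts D) \<and> card D \<le> 1" if "split_decomposition G D" for D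
      using simple_graphD(1)[OF sI] unfolding D[OF that] by simp
    then have ex: "\<exists>D. standard_decomposition G D" by (rule standard_decomposition_exists)
    have stdD: "D = {?I}" if "standard_decomposition G D" for D
      using that D by (simp add: standard_decomposition_def good_decomposition_def)
    have "P = {?I}" if "prune_step\<^sup>*\<^sup>* {?I} P" for P
      using that
    proof induction
      case (step P Q)
      then obtain L K where LK: "L \<in> P" "neighbours (decomposition_tree P) {L} = {K}"
        unfolding prune_step_def prunable_leaf_def by blast
      then have "K \<in> P" "(L, K) \<in> node_adjacency"
        unfolding neighbours_decomposition_tree[OF LK(1)] by blast+
      then have "False" using LK(1) step.IH by (simp add: node_adjacency_def)
      then show ?case ..
    qed simp
    moreover have "\<exists>D. standard_decomposition G D \<and> finite D"
      using ex stdD by (metis finite.emptyI finite_insert)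
    ultimately show ?thesis
      using stdD path_graph_singleton small_graph_permutation[OF sG conn True] by metis
  next
    case False
    have nI: "node_graph ?I" using False by (intro node_graphI sI cI) (simp add: card_image)
    have dec: "decomposes D ?I \<and> (\<forall>X\<in>D. graph_connected X)" if "split_decomposition G D" for D
      using decomposes_split_decomposition[OF that decomposes.single[OF nI] cI] .
    have fin: "finite D \<and> finite (all_verts D) \<and> card D \<le> card (pverts ?I)"
      if "split_decomposition G D" for D
    proof -
      have d: "decomposes D ?I" using dec that by blast
      then have "finite D" "\<forall>X\<in>D. finite (pverts X)" "card D + 2 \<le> card (pverts ?I)"
        using decomposesD(4,7) simple_graphD(1) decomposes_card by blast+
      then show ?thesis by (auto simp: all_verts_def)
    qed
    have ips: "induced_paths_shortest (parcs ?I)"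
      using induced_paths_shortest_embedding[OF embedding_initial_node sI]
        distance_hereditary_induced_paths_shortest[OF sG assms(3)] by blast
    have std: "split_decomposition G D" "decomposes D ?I"
      "\<forall>X\<in>D. clique_graph X \<or> (\<exists>c. star_at c X)" if D: "standard_decomposition G D" for D
    proof -
      show sd: "split_decomposition G D" using D by (simp add: standard_decomposition_def good_decomposition_def)
      show d: "decomposes D ?I" using dec[OF sd] by blast
      have "\<forall>X\<in>D. prime_graph X \<or> clique_graph X \<or> star_graph X"
        using D by (simp add: standard_decomposition_def good_decomposition_def)
      then show "\<forall>X\<in>D. clique_graph X \<or> (\<exists>c. star_at c X)"
        using good_decomposition_nodes[OF d _ ips] dec[OF sd] by blast
    qed
    have ex: "\<exists>D. standard_decomposition G D" using standard_decomposition_exists[OF fin] .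
    have "(path_graph (decomposition_tree P) \<longrightarrow> permutation_graph G) \<and>
        (\<not> path_graph (decomposition_tree P) \<longrightarrow> \<not> AT_free G)"
      if D: "standard_decomposition G D" and P: "prune_step\<^sup>*\<^sup>* D P" "\<nexists>L. prunable_leaf P L" for D P
    proof -
      obtain H where PD: "P \<subseteq> D" and H: "decomposes P H" "has_AT H \<longrightarrow> has_AT ?I"
        "(\<exists>s t. perm_model H s t) \<longrightarrow> (\<exists>s t. perm_model ?I s t)"
        using prune_steps_decomposes[OF P(1) std(2,3)[OF D]] by blast
      have nodes: "\<forall>X\<in>P. clique_graph X \<or> (\<exists>c. star_at c X)" using std(3)[OF D] PD by blast
      have "pruned_nodes P"
      proof (rule pruned_nodes_locale[OF H(1) nodes P(2)])
        fix X Y m c assume "X \<in> P" "Y \<in> P" "X \<noteq> Y" "m \<in> pverts X" "m \<in> pverts Y" "star_at m X" "star_at c Y"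
        then show "c = m" using standard_decomposition_reduced[OF D std(2)[OF D]] PD by blast
      qed
      then have "path_graph (decomposition_tree P) \<or> has_AT H" by (rule pruned_nodes.path_or_AT[OF _ H(1)])
      moreover have "has_AT ?I \<Longrightarrow> \<not> AT_free G"
        using has_AT_embedding[OF embedding_initial_node] AT_free_iff[OF sG] by blast
      moreover have "permutation_graph G" if "path_graph (decomposition_tree P)"
        using path_tree_perm_model[OF H(1) nodes that] H(3) perm_model_initial_node
          perm_model_permutation_graph by blast
      ultimately show ?thesis using H(2) by blast
    qed
    then show ?thesis using ex fin std(1) by blast
  qed
  then obtain D where D: "standard_decomposition G D" "finite D"
    and main: "\<And>D P. standard_decomposition G D \<Longrightarrow> prune_step\<^sup>*\<^sup>* D P \<Longrightarrow> \<nexists>L. prunable_leaf P L \<Longrightarrow>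
      (path_graph (decomposition_tree P) \<longrightarrow> permutation_graph G) \<and>
      (\<not> path_graph (decomposition_tree P) \<longrightarrow> \<not> AT_free G)" by blast
  obtain P where P: "prune_step\<^sup>*\<^sup>* D P" "\<nexists>L. prunable_leaf P L" using prune_terminates[OF D(2)] by blast
  have T: "(path_graph T \<longrightarrow> permutation_graph G) \<and> (\<not> path_graph T \<longrightarrow> \<not> AT_free G)"
    if "pruned_decomposition_tree G T" for T
    using that main unfolding pruned_decomposition_tree_def by blast
  have ex: "\<exists>T. pruned_decomposition_tree G T"
    using D(1) P unfolding pruned_decomposition_tree_def by blast
  then show ?thesis using T perm_AT_free by blast
qed

end
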